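(* Let $0<q<1$, $n\ge1$, and let $a,b\ge0$ and $m\ge1$ be integers. Then \[ \sum_{T\in\mathrm{RPP}(n^n)}\mathrm{wt}_{a,b,m}(T)=\frac{q^{(1-a+m+am)\binom n2-2\binom{n+1}3+2m^2\binom n3}}{(1-q)^{n^2}}\prod_{j=1}^n\frac{[a+(j-1)m]_q!\,[b+(j-1)m]_q!\,[jm-1]_q!}{[a+b+(n+j-2)m+1]_q!\,[m-1]_q!\,([j-1]_q!)^2}. \]
   Context: A reverse plane partition of the square shape $(n^n)$ is an $n\times n$ array of nonnegative integers weakly increasing along rows and down columns; $|T|$ is the sum of entries, $\mathrm{tr}(T)=\sum_iT(i,i)$, and $(\mu_1,\dots,\mu_n)=(T(n,n),\dots,T(1,1))$. With $v_i=\mu_i+n-i$, $\mathrm{wt}_{a,b,m}(T)=q^{|T|+a\,\mathrm{tr}(T)}\prod_{i=1}^n(q^{v_i+1};q)_b\prod_{1\le i<j\le n}\frac{(q^{v_j})^{2m-1}(q^{1-m+v_i-v_j};q)_{2m-1}}{q^{v_j}-q^{v_i}}$, where $(y;q)_k=\prod_{l=0}^{k-1}(1-yq^l)$. $[k]_q!=\prod_{l=1}^k\frac{1-q^l}{1-q}$. *)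

theory Defs
  imports "HOL-Analysis.Infinite_Sum"
begin

definition qpoch :: "real \<Rightarrow> real \<Rightarrow> nat \<Rightarrow> real" where
  "qpoch y q k = (\<Prod>l<k. 1 - y * q ^ l)"

definition qfact :: "real \<Rightarrow> nat \<Rightarrow> real" where
  "qfact q k = (\<Prod>l = 1..k. (1 - q ^ l) / (1 - q))"

text \<open>Arrays are indexed by \<open>{1..n} \<times> {1..n}\<close>. The entries outside this square are required
  to be \<open>0\<close>, so that each array is represented by exactly one function.\<close>

definition RPP :: "nat \<Rightarrow> (nat \<Rightarrow> nat \<Rightarrow> nat) set" where
  "RPP n = {T.
     (\<forall>i\<in>{1..n}. \<forall>j\<in>{1..n}. \<forall>k\<in>{1..n}. j \<le> k \<longrightarrow> T i j \<le> T i k) \<and>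
     (\<forall>i\<in>{1..n}. \<forall>j\<in>{1..n}. \<forall>k\<in>{1..n}. i \<le> k \<longrightarrow> T i j \<le> T k j) \<and>
     (\<forall>i j. i \<notin> {1..n} \<or> j \<notin> {1..n} \<longrightarrow> T i j = 0)}"

definition rpp_size :: "nat \<Rightarrow> (nat \<Rightarrow> nat \<Rightarrow> nat) \<Rightarrow> nat" where
  "rpp_size n T = (\<Sum>i = 1..n. \<Sum>j = 1..n. T i j)"

definition rpp_trace :: "nat \<Rightarrow> (nat \<Rightarrow> nat \<Rightarrow> nat) \<Rightarrow> nat" where
  "rpp_trace n T = (\<Sum>i = 1..n. T i i)"

definition rpp_mu :: "nat \<Rightarrow> (nat \<Rightarrow> nat \<Rightarrow> nat) \<Rightarrow> nat \<Rightarrow> nat" where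
  "rpp_mu n T i = T (n + 1 - i) (n + 1 - i)"

definition rpp_v :: "nat \<Rightarrow> (nat \<Rightarrow> nat \<Rightarrow> nat) \<Rightarrow> nat \<Rightarrow> nat" where
  "rpp_v n T i = rpp_mu n T i + (n - i)"

text \<open>The exponent \<open>1 - m + v\<^sub>i - v\<^sub>j\<close> may be negative, hence the integer power.\<close>

definition wt :: "real \<Rightarrow> nat \<Rightarrow> nat \<Rightarrow> nat \<Rightarrow> nat \<Rightarrow> (nat \<Rightarrow> nat \<Rightarrow> nat) \<Rightarrow> real" where
  "wt q n a b m T =
     q ^ (rpp_size n T + a * rpp_trace n T)
     * (\<Prod>i = 1..n. qpoch (q ^ (rpp_v n T i + 1)) q b)
     * (\<Prod>i = 1..n. \<Prod>j\<in>{i<..n}.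
          (q ^ rpp_v n T j) ^ (2 * m - 1)
          * qpoch (q powi (1 - int m + int (rpp_v n T i) - int (rpp_v n T j))) q (2 * m - 1)
          / (q ^ rpp_v n T j - q ^ rpp_v n T i))"

end

theory Submission
  imports Defs "HOL-Analysis.Elementary_Metric_Spaces" "Jordan_Normal_Form.Determinant"
begin

text \<open>
  Grouping the arrays by their diagonal reduces the sum to a \<open>q\<close>-Selberg sum: an array splits into
  two Gelfand-Tsetlin patterns with the same top row, and the generating function of such patterns
  is a quotient of Vandermonde determinants, which cancels the denominators of the weight. With
  \<open>x\<^sub>i = q ^ v\<^sub>i\<close> the remaining summand is \<open>\<Prod>x\<^sub>i\<^bsup>a+1\<^esup> (q x\<^sub>i; q)\<^sub>b\<close> times a symmetric
  homogeneous polynomial \<open>D(x)\<close> that vanishes unless all the \<open>v\<^sub>i\<close> are at distance at least \<open>m\<close>.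

  Summing \<open>D\<close> monomial by monomial with the \<open>q\<close>-beta sum gives, for \<open>z = q\<^bsup>a+1\<^esup>\<close> and fixed \<open>a + b\<close>,
  a polynomial in \<open>z\<close>, so it suffices to evaluate it at \<open>z = q\<^bsup>-d\<^esup>\<close> for all large \<open>d\<close>. There it is a
  coefficient of \<open>D(x) \<Prod>\<^sub>i\<Prod>\<^sub>r (x\<^sub>0 - q ^ r x\<^sub>i)\<close>, which the Combinatorial Nullstellensatz, in the style
  of Karolyi and Nagy, computes from the values on the grid \<open>x\<^sub>i \<in> {1, q, \<dots>, q ^ d}\<close>: up to
  permutation the only point that contributes is \<open>x\<^sub>i = q\<^bsup>m i\<^esup>\<close>.
\<close>

section \<open>Vandermonde determinants and Gelfand-Tsetlin patterns\<close>

text \<open>The q-beta sum gives a monomial with exponents \<open>p i\<close> the factors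
  \<open>qpoch z q (p i) / qpoch w q (p i)\<close> with \<open>w = q ^ (a + b + 2)\<close>; this is
  why \<open>a + b\<close> is held fixed. The points \<open>z = 1 / q ^ d\<close> are not of the
  form \<open>q ^ (a + 1)\<close>, so the series itself says nothing there. They are chosen because
  each such quotient becomes a signed q-binomial coefficient of lower index \<open>d - p i\<close>,
  up to a factor that depends on the monomial only through its total degree. Homogeneity of
  \<open>D\<close> makes this factor common to all monomials, and the q-binomial theorem then
  recognises the sum as a coefficient.

  The obstacle in evaluating that coefficient is that the zeros of \<open>D\<close> alone leave many
  grid points. Where \<open>D\<close> does not vanish, however, the exponents are at least
  \<open>m\<close> apart, which confines each of them to a window. The roots in the extra variable
  that all these points share are divided out, and the extra variable is set to a value at which the
  remaining quotient vanishes for every point except the tightest packing.\<close>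

definition pair_prod :: "nat \<Rightarrow> ('b \<Rightarrow> 'b \<Rightarrow> 'a::comm_monoid_mult) \<Rightarrow> (nat \<Rightarrow> 'b) \<Rightarrow> 'a" where
  "pair_prod n h x = (\<Prod>j<n. \<Prod>i<j. h (x i) (x j))"

abbreviation vandermonde :: "nat \<Rightarrow> (nat \<Rightarrow> 'a::comm_ring_1) \<Rightarrow> 'a" where
  "vandermonde n x \<equiv> pair_prod n (\<lambda>a b. b - a) x"

lemma pair_prod_Suc: "pair_prod (Suc n) h x = pair_prod n h x * (\<Prod>i<n. h (x i) (x n))"
  by (simp add: pair_prod_def)

lemma pair_prod_cong:
  "(\<And>i. i < n \<Longrightarrow> x i = y i) \<Longrightarrow> pair_prod n h x = pair_prod n h y"
  by (auto simp: pair_prod_def intro!: prod.cong)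

lemma det_mat_eq_sum:
  "det (mat n n (\<lambda>(i, j). f i j)) = (\<Sum>p | p permutes {0..<n}. signof p * (\<Prod>i<n. f i (p i)))"
proof -
  have "p i < n" if "p permutes {0..<n}" "i < n" for p i
    using that by (metis atLeastLessThan_iff permutes_in_image zero_le)
  then show ?thesis
    by (subst det_def'[of _ n])
      (auto simp: atLeast0LessThan intro!: sum.cong prod.cong arg_cong2[of _ _ _ _ "(*)"])
qed

lemma det_mat_row_scale:
  "det (mat n n (\<lambda>(i, j). c i * f i j)) = (\<Prod>i<n. c i) * det (mat n n (\<lambda>(i, j). f i j))"
  for c :: "nat \<Rightarrow> 'a::comm_ring_1"
  unfolding det_mat_eq_sum by (simp add: prod.distrib sum_distrib_left mult.left_commute)

text \<open>Multiplication by such a \<open>U\<close> performs row or column operations; both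
  determinant evaluations below begin this way.\<close>

lemma det_mat_mult_unitriangular:
  fixes A U :: "'a::idom mat"
  assumes "A \<in> carrier_mat n n" "U \<in> carrier_mat n n" "upper_triangular U"
    and "\<And>i. i < n \<Longrightarrow> U $$ (i, i) = 1"
  shows "det (A * U) = det A" "det (U * A) = det A"
proof -
  have "prod_list (diag_mat U) = (\<Prod>i = 0..<n. U $$ (i, i))"
    using assms by (simp add: prod_list_diag_prod)
  then have "det U = 1"
    using assms by (simp add: det_upper_triangular[of U n])
  then show "det (A * U) = det A" "det (U * A) = det A"
    using assms by (simp_all add: det_mult[of _ n])
qed

text \<open>From each column, \<open>x n\<close> times its left neighbour is subtracted. The last
  row becomes a unit vector, and expansion along it leaves the smaller matrix with row
  \<open>i\<close> scaled by \<open>x i - x n\<close>.\<close>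

lemma det_vandermonde:
  "det (mat n n (\<lambda>(i, j). x i ^ j)) = vandermonde n x" for x :: "nat \<Rightarrow> 'a::idom"
proof (induction n)
  case 0
  then show ?case by (simp add: pair_prod_def)
next
  case (Suc n)
  define V where "V = mat (Suc n) (Suc n) (\<lambda>(i, j). x i ^ j)"
  define U where "U = mat (Suc n) (Suc n) (\<lambda>(i, j). if i = j then 1 else if Suc i = j then - x n else 0)"
  have V: "V \<in> carrier_mat (Suc n) (Suc n)" and U: "U \<in> carrier_mat (Suc n) (Suc n)"
    by (simp_all add: V_def U_def)
  have W: "V * U \<in> carrier_mat (Suc n) (Suc n)" using V U by simp
  have entry: "(V * U) $$ (i, j) = (if j = 0 then 1 else (x i - x n) * x i ^ (j - 1))"
    if "i < Suc n" "j < Suc n" for i j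
  proof -
    have "(V * U) $$ (i, j) = (\<Sum>k = 0..<Suc n. x i ^ k * (if k = j then 1 else if Suc k = j then - x n else 0))"
      using that by (simp add: V_def U_def scalar_prod_def)
    also have "\<dots> = (\<Sum>k = 0..<Suc n. (if k = j then x i ^ k else 0) + (if Suc k = j then - x n * x i ^ k else 0))"
      by (intro sum.cong) auto
    also have "\<dots> = x i ^ j + (\<Sum>k = 0..<Suc n. if Suc k = j then - x n * x i ^ k else 0)"
      using that by (simp add: sum.distrib)
    also have "(\<Sum>k = 0..<Suc n. if Suc k = j then - x n * x i ^ k else 0) =
        (if j = 0 then 0 else - x n * x i ^ (j - 1))"
    proof (cases j)
      case (Suc j')
      then show ?thesis using that by simp
    qed simp
    finally show ?thesis
      by (cases j) (simp_all add: algebra_simps)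
  qed
  have "det V = det (V * U)"
    using V U by (subst det_mat_mult_unitriangular) (auto simp: U_def upper_triangular_def)
  also have "\<dots> = (\<Sum>j<Suc n. (V * U) $$ (n, j) * cofactor (V * U) n j)"
    by (rule laplace_expansion_row[OF W]) simp
  also have "\<dots> = (\<Sum>j<Suc n. if j = 0 then cofactor (V * U) n 0 else 0)"
    by (intro sum.cong) (auto simp: entry simp del: index_mult_mat)
  also have "\<dots> = cofactor (V * U) n 0"
    by simp
  also have "mat_delete (V * U) n 0 = mat n n (\<lambda>(i, j). (x i - x n) * x i ^ j)"
    using V U by (intro eq_matI) (auto simp: mat_delete_def entry simp del: index_mult_mat(1))
  then have "cofactor (V * U) n 0 = (-1) ^ n * ((\<Prod>i<n. x i - x n) * vandermonde n x)"
    unfolding cofactor_def by (simp add: det_mat_row_scale Suc.IH)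
  also have "\<dots> = (\<Prod>i<n. (-1) * (x i - x n)) * vandermonde n x"
    by (subst prod.distrib) simp
  finally show ?case
    by (simp add: V_def pair_prod_Suc mult.commute)
qed

text \<open>From each row its successor is subtracted. Column 0 keeps only its last entry, and the
  remaining minor consists of the differences that appear as numerators of geometric sums.\<close>

lemma vandermonde_Suc_eq_det_diff:
  fixes x :: "nat \<Rightarrow> 'a::idom"
  shows "(-1) ^ n * vandermonde (Suc n) x = det (mat n n (\<lambda>(i, j). x i ^ Suc j - x (Suc i) ^ Suc j))"
proof -
  define V where "V = mat (Suc n) (Suc n) (\<lambda>(i, j). x i ^ j)"
  define U :: "'a mat" where "U = mat (Suc n) (Suc n) (\<lambda>(i, j). if i = j then 1 else if Suc i = j then - 1 else 0)"
  have V: "V \<in> carrier_mat (Suc n) (Suc n)" and U: "U \<in> carrier_mat (Suc n) (Suc n)"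
    by (simp_all add: V_def U_def)
  have W: "U * V \<in> carrier_mat (Suc n) (Suc n)" using V U by simp
  have entry: "(U * V) $$ (i, j) = (if i = n then x n ^ j else x i ^ j - x (Suc i) ^ j)"
    if "i < Suc n" "j < Suc n" for i j
  proof -
    have "(U * V) $$ (i, j) = (\<Sum>k = 0..<Suc n. (if i = k then 1 else if Suc i = k then - 1 else 0) * x k ^ j)"
      using that by (simp add: V_def U_def scalar_prod_def)
    also have "\<dots> = (\<Sum>k = 0..<Suc n. (if i = k then x k ^ j else 0) + (if Suc i = k then - (x k ^ j) else 0))"
      by (intro sum.cong) auto
    also have "\<dots> = x i ^ j + (\<Sum>k = 0..<Suc n. if Suc i = k then - (x k ^ j) else 0)"
      using that by (simp add: sum.distrib)
    also have "(\<Sum>k = 0..<Suc n. if Suc i = k then - (x k ^ j) else 0) =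
        (if i = n then 0 else - (x (Suc i) ^ j))"
      using that by auto
    finally show ?thesis by simp
  qed
  have "vandermonde (Suc n) x = det V"
    unfolding V_def by (rule det_vandermonde[symmetric])
  also have "\<dots> = det (U * V)"
    using V U by (subst det_mat_mult_unitriangular) (auto simp: U_def upper_triangular_def)
  also have "\<dots> = (\<Sum>i<Suc n. (U * V) $$ (i, 0) * cofactor (U * V) i 0)"
    by (rule laplace_expansion_column[OF W]) simp
  also have "\<dots> = (\<Sum>i<Suc n. if i = n then cofactor (U * V) n 0 else 0)"
    by (intro sum.cong) (auto simp: entry simp del: index_mult_mat)
  also have "\<dots> = cofactor (U * V) n 0"
    by simp
  also have "mat_delete (U * V) n 0 = mat n n (\<lambda>(i, j). x i ^ Suc j - x (Suc i) ^ Suc j)"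
    using V U by (intro eq_matI) (auto simp: mat_delete_def entry simp del: index_mult_mat(1))
  then have "cofactor (U * V) n 0 = (-1) ^ n * det (mat n n (\<lambda>(i, j). x i ^ Suc j - x (Suc i) ^ Suc j))"
    unfolding cofactor_def by simp
  finally show ?thesis
    by (simp flip: mult.assoc power_add)
qed

lemma sum_geometric_interval:
  fixes y :: real
  assumes "y \<noteq> 1" "a \<le> b"
  shows "(\<Sum>k = a..<b. y ^ k) = (y ^ a - y ^ b) / (1 - y)"
  using assms(2)
proof (induction rule: dec_induct)
  case (step k)
  then have "(\<Sum>k = a..<Suc k. y ^ k) = (y ^ a - y ^ k) / (1 - y) + y ^ k" by simp
  also have "\<dots> = (y ^ a - y ^ Suc k) / (1 - y)" using assms(1) by (simp add: field_simps)
  finally show ?case .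
qed simp

text \<open>In the Leibniz expansion every \<open>k i\<close> ranges over its own interval, so the
  sum factors into geometric sums. Their denominators multiply to the same product for each
  permutation, and the numerators assemble into the determinant of differences.\<close>

lemma sum_vandermonde_interlacing:
  fixes q :: real
  assumes q: "0 < q" "q < 1" and u: "\<And>i. i < n \<Longrightarrow> u i \<le> u (Suc i)"
  shows "(\<Sum>k\<in>PiE {..<n} (\<lambda>i. {u i..<u (Suc i)}). (\<Prod>i<n. q ^ k i) * vandermonde n (\<lambda>i. q ^ k i)) =
    (-1) ^ n * vandermonde (Suc n) (\<lambda>i. q ^ u i) / (\<Prod>j<n. 1 - q ^ Suc j)" (is "?lhs = ?rhs")
proof -
  let ?P = "{p. p permutes {0..<n}}"
  have qq: "q ^ Suc j \<noteq> 1" for j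
    using power_strict_decreasing[of 0 "Suc j" q] q by auto
  have "?lhs = (\<Sum>k\<in>PiE {..<n} (\<lambda>i. {u i..<u (Suc i)}). \<Sum>p\<in>?P. signof p * (\<Prod>i<n. (q ^ Suc (p i)) ^ k i))"
  proof (intro sum.cong refl)
    fix k
    have "(\<Prod>i<n. q ^ k i) * vandermonde n (\<lambda>i. q ^ k i) =
        (\<Prod>i<n. q ^ k i) * (\<Sum>p\<in>?P. signof p * (\<Prod>i<n. (q ^ k i) ^ p i))"
      by (simp only: det_vandermonde[symmetric] det_mat_eq_sum)
    also have "\<dots> = (\<Sum>p\<in>?P. signof p * ((\<Prod>i<n. q ^ k i) * (\<Prod>i<n. (q ^ k i) ^ p i)))"
      by (simp add: sum_distrib_left mult.left_commute)
    also have "\<dots> = (\<Sum>p\<in>?P. signof p * (\<Prod>i<n. (q ^ Suc (p i)) ^ k i))"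
      by (simp flip: prod.distrib power_mult power_add add: algebra_simps)
    finally show "(\<Prod>i<n. q ^ k i) * vandermonde n (\<lambda>i. q ^ k i) = \<dots>" .
  qed
  also have "\<dots> = (\<Sum>p\<in>?P. signof p * (\<Sum>k\<in>PiE {..<n} (\<lambda>i. {u i..<u (Suc i)}). \<Prod>i<n. (q ^ Suc (p i)) ^ k i))"
    by (subst sum.swap) (simp add: sum_distrib_left)
  also have "\<dots> = (\<Sum>p\<in>?P. signof p * (\<Prod>i<n. \<Sum>k = u i..<u (Suc i). (q ^ Suc (p i)) ^ k))"
    by (subst prod_sum_PiE) auto
  also have "\<dots> = (\<Sum>p\<in>?P. signof p *
      ((\<Prod>i<n. (q ^ u i) ^ Suc (p i) - (q ^ u (Suc i)) ^ Suc (p i)) / (\<Prod>j<n. 1 - q ^ Suc j)))"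
  proof (intro sum.cong refl arg_cong2[of _ _ _ _ "(*)"])
    fix p assume p: "p \<in> ?P"
    have "(\<Prod>i<n. \<Sum>k = u i..<u (Suc i). (q ^ Suc (p i)) ^ k) =
        (\<Prod>i<n. ((q ^ u i) ^ Suc (p i) - (q ^ u (Suc i)) ^ Suc (p i)) / (1 - q ^ Suc (p i)))"
    proof (intro prod.cong refl)
      fix i assume "i \<in> {..<n}"
      then have "(\<Sum>k = u i..<u (Suc i). (q ^ Suc (p i)) ^ k) =
          ((q ^ Suc (p i)) ^ u i - (q ^ Suc (p i)) ^ u (Suc i)) / (1 - q ^ Suc (p i))"
        by (intro sum_geometric_interval) (use u qq in auto)
      then show "(\<Sum>k = u i..<u (Suc i). (q ^ Suc (p i)) ^ k) =
          ((q ^ u i) ^ Suc (p i) - (q ^ u (Suc i)) ^ Suc (p i)) / (1 - q ^ Suc (p i))"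
        by (metis power_mult mult.commute)
    qed
    also have "\<dots> = (\<Prod>i<n. (q ^ u i) ^ Suc (p i) - (q ^ u (Suc i)) ^ Suc (p i)) / (\<Prod>i<n. 1 - q ^ Suc (p i))"
      by (rule prod_dividef)
    also have "(\<Prod>i<n. 1 - q ^ Suc (p i)) = (\<Prod>j<n. 1 - q ^ Suc j)"
      using p prod.permute[of p "{..<n}" "\<lambda>j. 1 - q ^ Suc j"] by (simp add: atLeast0LessThan o_def)
    finally show "(\<Prod>i<n. \<Sum>k = u i..<u (Suc i). (q ^ Suc (p i)) ^ k) =
      (\<Prod>i<n. (q ^ u i) ^ Suc (p i) - (q ^ u (Suc i)) ^ Suc (p i)) / (\<Prod>j<n. 1 - q ^ Suc j)" .
  qed
  also have "\<dots> = (\<Sum>p\<in>?P. signof p * (\<Prod>i<n. (q ^ u i) ^ Suc (p i) - (q ^ u (Suc i)) ^ Suc (p i)))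
      / (\<Prod>j<n. 1 - q ^ Suc j)"
    by (simp add: sum_divide_distrib)
  also have "\<dots> = ?rhs"
    unfolding vandermonde_Suc_eq_det_diff det_mat_eq_sum ..
  finally show ?thesis .
qed

section \<open>Interlacing sequences and Gelfand-Tsetlin patterns\<close>

definition interlacing :: "nat \<Rightarrow> (nat \<Rightarrow> nat) \<Rightarrow> (nat \<Rightarrow> nat) set" where
  "interlacing n d = {e. (\<forall>i<n. d i \<le> e i \<and> e i \<le> d (Suc i)) \<and> (\<forall>i\<ge>n. e i = 0)}"

text \<open>\<open>s k i\<close> is the entry in position \<open>(i, i + k)\<close>, counted from \<open>0\<close>, of a triangular array with diagonal \<open>d\<close>.\<close>

definition gt_patterns :: "nat \<Rightarrow> (nat \<Rightarrow> nat) \<Rightarrow> (nat \<Rightarrow> nat \<Rightarrow> nat) set" where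
  "gt_patterns n d = {s. s 0 = d \<and>
     (\<forall>k i. Suc (i + k) < n \<longrightarrow> s k i \<le> s (Suc k) i \<and> s (Suc k) i \<le> s k (Suc i)) \<and>
     (\<forall>k i. n \<le> i + k \<longrightarrow> s k i = 0)}"

text \<open>The diagonal \<open>s 0\<close> is left out because the two patterns that make up an
  array share it.\<close>

definition gt_size :: "nat \<Rightarrow> (nat \<Rightarrow> nat \<Rightarrow> nat) \<Rightarrow> nat" where
  "gt_size n s = (\<Sum>k<n. \<Sum>i<n - Suc k. s (Suc k) i)"

text \<open>Adding \<open>i\<close> to the entry at \<open>i\<close> turns weak interlacing into
  membership in half-open intervals, each starting where the previous one ends, as
  \<open>sum_vandermonde_interlacing\<close> requires.\<close>

lemma bij_betw_interlacing:
  "bij_betw (\<lambda>k i. if i < n then k i - i else 0)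
    (PiE {..<n} (\<lambda>i. {d i + i..<d (Suc i) + Suc i})) (interlacing n d)"
proof (rule bij_betw_byWitness[where f' = "\<lambda>e. restrict (\<lambda>i. e i + i) {..<n}"])
  let ?B = "PiE {..<n} (\<lambda>i. {d i + i..<d (Suc i) + Suc i})"
  show "\<forall>k\<in>?B. restrict (\<lambda>i. (if i < n then k i - i else 0) + i) {..<n} = k"
  proof
    fix k assume k: "k \<in> ?B"
    show "restrict (\<lambda>i. (if i < n then k i - i else 0) + i) {..<n} = k"
    proof
      fix i
      show "restrict (\<lambda>i. (if i < n then k i - i else 0) + i) {..<n} i = k i"
        using PiE_mem[OF k, of i] PiE_arb[OF k, of i] by (cases "i < n") auto
    qed
  qed
  show "\<forall>e\<in>interlacing n d. (\<lambda>i. if i < n then restrict (\<lambda>i. e i + i) {..<n} i - i else 0) = e"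
    by (auto simp: interlacing_def fun_eq_iff)
  show "(\<lambda>k i. if i < n then k i - i else 0) ` ?B \<subseteq> interlacing n d"
  proof clarify
    fix k assume k: "k \<in> ?B"
    show "(\<lambda>i. if i < n then k i - i else 0) \<in> interlacing n d"
      using PiE_mem[OF k] by (fastforce simp: interlacing_def)
  qed
  show "(\<lambda>e. restrict (\<lambda>i. e i + i) {..<n}) ` interlacing n d \<subseteq> ?B"
    by (auto simp: interlacing_def intro!: le_imp_less_Suc add_right_mono split: if_splits)
qed

lemma bij_betw_gt_patterns_Suc:
  assumes d: "\<forall>i\<ge>Suc n. d i = 0"
  shows "bij_betw (\<lambda>(e, t). case_nat d t) (SIGMA e : interlacing n d. gt_patterns n e) (gt_patterns (Suc n) d)"
proof (rule bij_betw_byWitness[where f' = "\<lambda>s. (s 1, \<lambda>k. s (Suc k))"])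
  show "\<forall>a\<in>SIGMA e : interlacing n d. gt_patterns n e.
      ((case a of (e, t) \<Rightarrow> case_nat d t) 1, \<lambda>k. (case a of (e, t) \<Rightarrow> case_nat d t) (Suc k)) = a"
    by (auto simp: gt_patterns_def)
  show "\<forall>s\<in>gt_patterns (Suc n) d. (case (s 1, \<lambda>k. s (Suc k)) of (e, t) \<Rightarrow> case_nat d t) = s"
    by (auto simp: gt_patterns_def fun_eq_iff split: nat.split)
  show "(\<lambda>(e, t). case_nat d t) ` (SIGMA e : interlacing n d. gt_patterns n e) \<subseteq> gt_patterns (Suc n) d"
    using d by (auto simp: gt_patterns_def interlacing_def split: nat.split)
  show "(\<lambda>s. (s 1, \<lambda>k. s (Suc k))) ` gt_patterns (Suc n) d \<subseteq> (SIGMA e : interlacing n d. gt_patterns n e)"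
  proof (clarify)
    fix s assume s: "s \<in> gt_patterns (Suc n) d"
    have mono: "s k i \<le> s (Suc k) i" "s (Suc k) i \<le> s k (Suc i)" if "i + k < n" for k i
      using s that by (auto simp: gt_patterns_def)
    have zero: "s k i = 0" if "n < i + k" for k i
      using s that by (auto simp: gt_patterns_def)
    have "s 0 = d" using s by (simp add: gt_patterns_def)
    then have "s 1 \<in> interlacing n d"
      using mono[of _ 0] zero by (auto simp: interlacing_def)
    moreover have "(\<lambda>k. s (Suc k)) \<in> gt_patterns n (s 1)"
      using mono zero by (auto simp: gt_patterns_def)
    ultimately show "s 1 \<in> interlacing n d \<and> (\<lambda>k. s (Suc k)) \<in> gt_patterns n (s 1)" by simp
  qed
qed

lemma gt_size_Suc: "gt_size (Suc n) (case_nat d t) = (\<Sum>i<n. t 0 i) + gt_size n t"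
  by (simp add: gt_size_def sum.lessThan_Suc_shift del: sum.lessThan_Suc)

lemma vandermonde_q_powers_Suc:
  fixes q :: real
  shows "vandermonde (Suc n) (\<lambda>i. q ^ i) =
    vandermonde n (\<lambda>i. q ^ i) * ((-1) ^ n * (\<Prod>i<n. q ^ i) * (\<Prod>j<n. 1 - q ^ Suc j))"
proof -
  have "(\<Prod>i<n. q ^ n - q ^ i) = (\<Prod>i<n. (-1) * q ^ i * (1 - q ^ (n - i)))"
    by (intro prod.cong refl) (simp add: algebra_simps flip: power_add)
  also have "\<dots> = (-1) ^ n * (\<Prod>i<n. q ^ i) * (\<Prod>i<n. 1 - q ^ (n - i))"
    by (simp only: prod.distrib) simp
  also have "(\<Prod>i<n. 1 - q ^ (n - i)) = (\<Prod>i<n. 1 - q ^ Suc (n - Suc i))"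
    by (intro prod.cong refl) (simp add: Suc_diff_Suc)
  also have "\<dots> = (\<Prod>j<n. 1 - q ^ Suc j)"
    by (rule prod.nat_diff_reindex)
  finally show ?thesis by (simp add: pair_prod_Suc)
qed

lemma vandermonde_q_powers_nonzero:
  fixes q :: real
  assumes "0 < q" "q < 1"
  shows "vandermonde n (\<lambda>i. q ^ i) \<noteq> 0"
proof -
  have "q ^ j - q ^ i \<noteq> 0" if "i < j" for i j
    using power_strict_decreasing[OF that assms] by simp
  then show ?thesis by (simp add: pair_prod_def)
qed

text \<open>This is the principal specialisation \<open>s_\<lambda>(1, q, ..., q ^ (n - 1))\<close>
  of the Schur polynomial of the partition with parts \<open>d i\<close>, as a quotient of
  alternants. The induction strips off the diagonal. Finiteness is proved alongside, since a sum
  over an infinite set would be \<open>0\<close> by convention.\<close>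

lemma sum_gt_patterns:
  fixes q :: real
  assumes q: "0 < q" "q < 1"
  assumes "\<And>i. Suc i < n \<Longrightarrow> d i \<le> d (Suc i)" "\<forall>i\<ge>n. d i = 0"
  shows "finite (gt_patterns n d) \<and> (\<Sum>s\<in>gt_patterns n d. q ^ gt_size n s) =
    vandermonde n (\<lambda>i. q ^ (d i + i)) / vandermonde n (\<lambda>i. q ^ i)"
  using assms(3,4)
proof (induction n arbitrary: d)
  case 0
  then have "gt_patterns 0 d = {\<lambda>_ _. 0}"
    by (auto simp: gt_patterns_def fun_eq_iff)
  then show ?case by (simp add: gt_size_def pair_prod_def)
next
  case (Suc n)
  define B where "B = PiE {..<n} (\<lambda>i. {d i + i..<d (Suc i) + Suc i})"
  have finB: "finite B" by (auto simp: B_def intro: finite_PiE)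
  have bij: "bij_betw (\<lambda>k i. if i < n then k i - i else 0) B (interlacing n d)"
    unfolding B_def by (rule bij_betw_interlacing)
  have finI: "finite (interlacing n d)"
    using bij_betw_finite[OF bij] finB by simp
  have IH: "finite (gt_patterns n e)" "(\<Sum>s\<in>gt_patterns n e. q ^ gt_size n s) =
      vandermonde n (\<lambda>i. q ^ (e i + i)) / vandermonde n (\<lambda>i. q ^ i)" if e: "e \<in> interlacing n d" for e
  proof -
    have "e i \<le> e (Suc i)" if "Suc i < n" for i
      using e that by (intro order_trans[of "e i" "d (Suc i)" "e (Suc i)"]) (auto simp: interlacing_def)
    then show "finite (gt_patterns n e)" "(\<Sum>s\<in>gt_patterns n e. q ^ gt_size n s) =
      vandermonde n (\<lambda>i. q ^ (e i + i)) / vandermonde n (\<lambda>i. q ^ i)"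
      using Suc.IH[of e] e by (auto simp: interlacing_def)
  qed
  note bij2 = bij_betw_gt_patterns_Suc[OF Suc.prems(2)]
  have fin: "finite (gt_patterns (Suc n) d)"
    using bij_betw_finite[OF bij2] finite_SigmaI[OF finI IH(1)] by simp
  have "(\<Sum>s\<in>gt_patterns (Suc n) d. q ^ gt_size (Suc n) s) =
      (\<Sum>(e, t)\<in>(SIGMA e : interlacing n d. gt_patterns n e). q ^ gt_size (Suc n) (case_nat d t))"
    by (subst sum.reindex_bij_betw[OF bij2, symmetric]) (auto intro!: sum.cong)
  also have "\<dots> = (\<Sum>e\<in>interlacing n d. \<Sum>t\<in>gt_patterns n e. q ^ gt_size (Suc n) (case_nat d t))"
    using finI IH(1) by (subst sum.Sigma) auto
  also have "\<dots> = (\<Sum>e\<in>interlacing n d. q ^ (\<Sum>i<n. e i) * (\<Sum>t\<in>gt_patterns n e. q ^ gt_size n t))"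
    by (simp add: sum_distrib_left gt_size_Suc power_add) (auto simp: gt_patterns_def intro!: sum.cong)
  also have "\<dots> = (\<Sum>e\<in>interlacing n d. (\<Prod>i<n. q ^ e i) *
      (vandermonde n (\<lambda>i. q ^ (e i + i)) / vandermonde n (\<lambda>i. q ^ i)))"
    by (simp add: IH(2) power_sum)
  also have "\<dots> = (\<Sum>k\<in>B. (\<Prod>i<n. q ^ (k i - i)) *
      (vandermonde n (\<lambda>i. q ^ (k i - i + i)) / vandermonde n (\<lambda>i. q ^ i)))"
    by (subst sum.reindex_bij_betw[OF bij, symmetric])
      (auto intro!: sum.cong arg_cong2[of _ _ _ _ "(*)"] arg_cong2[of _ _ _ _ "(/)"] pair_prod_cong prod.cong)
  \<comment> \<open>Passing from the entries to the shifted values \<open>k i\<close> costs the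
    factor \<open>\<Prod>i<n. q ^ i\<close>. It is absorbed at the end by
    \<open>vandermonde_q_powers_Suc\<close>, which also accounts for the sign and for the
    denominators of the geometric sums.\<close>
  also have "\<dots> = (\<Sum>k\<in>B. (\<Prod>i<n. q ^ k i) * vandermonde n (\<lambda>i. q ^ k i)) /
      ((\<Prod>i<n. q ^ i) * vandermonde n (\<lambda>i. q ^ i))"
  proof -
    have "(\<Prod>i<n. q ^ (k i - i)) * (vandermonde n (\<lambda>i. q ^ (k i - i + i)) / vandermonde n (\<lambda>i. q ^ i)) =
      (\<Prod>i<n. q ^ k i) * vandermonde n (\<lambda>i. q ^ k i) / ((\<Prod>i<n. q ^ i) * vandermonde n (\<lambda>i. q ^ i))"
      if "k \<in> B" for k
    proof -
      have ge: "i \<le> k i" if "i < n" for i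
        using \<open>k \<in> B\<close> that unfolding B_def by (fastforce simp: PiE_def Pi_def)
      have 1: "(\<Prod>i<n. q ^ (k i - i)) = (\<Prod>i<n. q ^ k i) / (\<Prod>i<n. q ^ i)"
        unfolding prod_dividef[symmetric] using ge q by (intro prod.cong) (auto simp: power_diff)
      have 2: "vandermonde n (\<lambda>i. q ^ (k i - i + i)) = vandermonde n (\<lambda>i. q ^ k i)"
        using ge by (intro pair_prod_cong) auto
      show ?thesis unfolding 1 2 by simp
    qed
    then show ?thesis by (simp add: sum_divide_distrib)
  qed
  also have "\<dots> = ((-1) ^ n * vandermonde (Suc n) (\<lambda>i. q ^ (d i + i)) / (\<Prod>j<n. 1 - q ^ Suc j)) /
      ((\<Prod>i<n. q ^ i) * vandermonde n (\<lambda>i. q ^ i))"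
    unfolding B_def using Suc.prems(1)
    by (subst sum_vandermonde_interlacing[OF q, where u = "\<lambda>i. d i + i"]) (auto intro: add_mono le_SucI)
  also have "\<dots> = vandermonde (Suc n) (\<lambda>i. q ^ (d i + i)) / vandermonde (Suc n) (\<lambda>i. q ^ i)"
  proof -
    have "1 - q ^ Suc j \<noteq> 0" for j
      using power_strict_decreasing[of 0 "Suc j" q] q by simp
    then have "(\<Prod>j<n. 1 - q ^ Suc j) \<noteq> 0"
      by (simp del: power_Suc)
    moreover have "(\<Prod>i<n. q ^ i) \<noteq> 0" using q by simp
    moreover have "(-1) ^ n * (-1) ^ n = (1::real)" by (simp flip: power_add)
    ultimately show ?thesis
      using vandermonde_q_powers_nonzero[OF q, of n] q
      unfolding vandermonde_q_powers_Suc by (simp add: divide_simps)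
  qed
  finally show ?case using fin by blast
qed

section \<open>Symmetric sums over increasing sequences\<close>

definition increasing_seqs :: "nat \<Rightarrow> nat set \<Rightarrow> (nat \<Rightarrow> nat) set" where
  "increasing_seqs n B = {u \<in> PiE {..<n} (\<lambda>_. B). \<forall>i j. i < j \<and> j < n \<longrightarrow> u i < u j}"

lemma increasing_seqs_inj_on: "u \<in> increasing_seqs n B \<Longrightarrow> inj_on u {..<n}"
  by (rule inj_onI) (metis (mono_tags, lifting) increasing_seqs_def lessThan_iff mem_Collect_eq
      nat_neq_iff)

lemma increasing_seqs_eqI:
  assumes u: "u \<in> increasing_seqs n B" and v: "v \<in> increasing_seqs n B" and im: "u ` {..<n} = v ` {..<n}"
  shows "u = v"
proof -
  have s: "sorted (map w [0..<n])" "distinct (map w [0..<n])" if "w \<in> increasing_seqs n B" for w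
    using that increasing_seqs_inj_on[OF that]
    by (force simp: increasing_seqs_def sorted_iff_nth_mono_less distinct_map atLeast0LessThan less_imp_le)+
  have "map u [0..<n] = map v [0..<n]"
    using s[OF u] s[OF v] im by (intro sorted_distinct_set_unique) (auto simp: atLeast0LessThan)
  then have "u i = v i" if "i < n" for i
    using that by (auto simp: list_eq_iff_nth_eq)
  then show ?thesis
    using u v by (intro PiE_ext[of u "{..<n}" "\<lambda>_. B" v]) (auto simp: increasing_seqs_def)
qed

text \<open>The image of an injective sequence determines its sorted rearrangement \<open>u\<close>,
  and injectivity of \<open>u\<close> then determines the permutation.\<close>

lemma bij_betw_permute_increasing_seqs:
  "bij_betw (\<lambda>(p, u). u \<circ> p) ({p. p permutes {..<n}} \<times> increasing_seqs n B)
    {v \<in> PiE {..<n} (\<lambda>_. B). inj_on v {..<n}}"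
  unfolding bij_betw_def
proof (intro conjI)
  show "inj_on (\<lambda>(p, u). u \<circ> p) ({p. p permutes {..<n}} \<times> increasing_seqs n B)"
  proof (rule inj_onI, clarify)
    fix p u p' u' assume p: "p permutes {..<n}" "p' permutes {..<n}"
      and u: "u \<in> increasing_seqs n B" "u' \<in> increasing_seqs n B" and eq: "u \<circ> p = u' \<circ> p'"
    have "u ` {..<n} = (u \<circ> p) ` {..<n}" "u' ` {..<n} = (u' \<circ> p') ` {..<n}"
      using p by (simp_all only: image_comp[symmetric] permutes_image)
    then have "u = u'" using increasing_seqs_eqI[OF u] eq by simp
    moreover have "p i = p' i" for i
    proof (cases "i < n")
      case True
      then have "p i \<in> {..<n}" "p' i \<in> {..<n}"
        using p by (simp_all only: permutes_in_image) simp_all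
      then show ?thesis
        using inj_onD[OF increasing_seqs_inj_on[OF u(1)], of "p i" "p' i"] fun_cong[OF eq, of i] \<open>u = u'\<close> by simp
    next
      case False
      then show ?thesis using p by (simp add: permutes_not_in)
    qed
    ultimately show "p = p' \<and> u = u'" by auto
  qed
  show "(\<lambda>(p, u). u \<circ> p) ` ({p. p permutes {..<n}} \<times> increasing_seqs n B) =
      {v \<in> PiE {..<n} (\<lambda>_. B). inj_on v {..<n}}"
  proof (intro equalityI subsetI)
    fix v assume "v \<in> (\<lambda>(p, u). u \<circ> p) ` ({p. p permutes {..<n}} \<times> increasing_seqs n B)"
    then obtain p u where v: "v = u \<circ> p" and p: "p permutes {..<n}" and u: "u \<in> increasing_seqs n B" by auto
    have "inj_on v {..<n}"
      unfolding v using increasing_seqs_inj_on[OF u] p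
      by (intro comp_inj_on) (auto simp: permutes_image intro: permutes_inj_on)
    moreover have "v \<in> PiE {..<n} (\<lambda>_. B)"
      using u p permutes_in_image[OF p] unfolding v
      by (auto simp: increasing_seqs_def PiE_iff extensional_def permutes_not_in)
    ultimately show "v \<in> {v \<in> PiE {..<n} (\<lambda>_. B). inj_on v {..<n}}" by simp
  next
    fix v assume "v \<in> {v \<in> PiE {..<n} (\<lambda>_. B). inj_on v {..<n}}"
    then have vB: "v \<in> PiE {..<n} (\<lambda>_. B)" and inj: "inj_on v {..<n}" by auto
    define l where "l = sorted_list_of_set (v ` {..<n})"
    have l: "length l = n" "set l = v ` {..<n}" "sorted_wrt (<) l"
      using inj by (simp_all add: l_def card_image)
    define u where "u = restrict (\<lambda>i. l ! i) {..<n}"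
    have u: "u \<in> increasing_seqs n B"
      unfolding increasing_seqs_def
    proof (intro CollectI conjI allI impI)
      show "u \<in> PiE {..<n} (\<lambda>_. B)"
      proof (rule PiE_I)
        fix i assume "i \<in> {..<n}"
        then have "u i \<in> set l" using l(1) by (simp add: u_def)
        then show "u i \<in> B" using l(2) vB by (auto simp: PiE_iff)
      qed (simp add: u_def)
      show "u i < u j" if "i < j \<and> j < n" for i j
        using that l(1,3) by (auto simp: u_def intro: sorted_wrt_nth_less)
    qed
    have "u ` {..<n} = set l"
      unfolding u_def using l(1) by (auto simp: set_conv_nth)
    then have bij: "bij_betw u {..<n} (v ` {..<n})"
      using increasing_seqs_inj_on[OF u] l by (simp add: bij_betw_def)
    define p where "p i = (if i < n then inv_into {..<n} u (v i) else i)" for i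
    have "bij_betw (inv_into {..<n} u \<circ> v) {..<n} {..<n}"
      using inj by (intro bij_betw_trans[OF _ bij_betw_inv_into[OF bij]]) (simp add: bij_betw_def)
    then have "bij_betw p {..<n} {..<n}"
      by (rule bij_betw_cong[THEN iffD1, rotated]) (simp add: p_def)
    then have p: "p permutes {..<n}"
      by (rule bij_imp_permutes) (simp add: p_def)
    moreover have "v = u \<circ> p"
    proof
      fix i show "v i = (u \<circ> p) i"
      proof (cases "i < n")
        case True
        then have "v i \<in> u ` {..<n}" using bij by (auto simp: bij_betw_def)
        then show ?thesis using True by (simp add: p_def f_inv_into_f)
      next
        case False
        then show ?thesis using PiE_arb[OF vB, of i] by (simp add: p_def u_def)
      qed
    qed
    ultimately show "v \<in> (\<lambda>(p, u). u \<circ> p) ` ({p. p permutes {..<n}} \<times> increasing_seqs n B)"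
      using u by force
  qed
qed

text \<open>Each increasing sequence has \<open>n!\<close> rearrangements, and sequences with
  repeated entries contribute nothing. Applied with \<open>B = UNIV\<close> to the infinite Selberg
  sum and with \<open>B = {..d}\<close> to the interpolation grid.\<close>

lemma has_sum_increasing_seqs:
  fixes f :: "(nat \<Rightarrow> nat) \<Rightarrow> real"
  assumes f: "(f has_sum S) (PiE {..<n} (\<lambda>_. B))"
    and sym: "\<And>p u. p permutes {..<n} \<Longrightarrow> u \<in> increasing_seqs n B \<Longrightarrow> f (u \<circ> p) = f u"
    and zero: "\<And>v. v \<in> PiE {..<n} (\<lambda>_. B) \<Longrightarrow> \<not> inj_on v {..<n} \<Longrightarrow> f v = 0"
  shows "(f has_sum (S / fact n)) (increasing_seqs n B)"
proof -
  let ?P = "{p. p permutes {..<n}}"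
  \<comment> \<open>The sum \<open>s\<close> over increasing sequences must be known to exist before
    the sum over pairs can be split by permutations.\<close>
  have "f summable_on PiE {..<n} (\<lambda>_. B)" using f by (auto simp: summable_on_def)
  then have "f summable_on increasing_seqs n B"
    by (rule summable_on_subset_banach) (auto simp: increasing_seqs_def)
  then obtain s where s: "(f has_sum s) (increasing_seqs n B)" by (auto simp: summable_on_def)
  have "(f has_sum S) {v \<in> PiE {..<n} (\<lambda>_. B). inj_on v {..<n}}"
    using f by (rule has_sum_cong_neutral[THEN iffD1, rotated -1]) (auto simp: zero)
  then have "((\<lambda>(p, u). f (u \<circ> p)) has_sum S) (?P \<times> increasing_seqs n B)"
    by (subst (asm) has_sum_reindex_bij_betw[OF bij_betw_permute_increasing_seqs, symmetric])
      (simp add: case_prod_unfold)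
  then have "((\<lambda>(p, u). f u) has_sum S) (?P \<times> increasing_seqs n B)"
    by (rule has_sum_cong[THEN iffD1, rotated]) (auto simp: sym)
  then have "((\<lambda>p. s) has_sum S) ?P"
    by (rule has_sum_SigmaD[where f = "\<lambda>(p, u). f u" and g = "\<lambda>_. s"]) (use s in auto)
  moreover have "((\<lambda>p. s) has_sum (\<Sum>p\<in>?P. s)) ?P"
    by (intro has_sum_finite finite_permutations) simp
  ultimately have "S = fact n * s"
    using infsumI by (fastforce simp: card_permutations)
  then show ?thesis using s by simp
qed

section \<open>Reverse plane partitions by diagonals\<close>

definition diag_seqs :: "nat \<Rightarrow> (nat \<Rightarrow> nat) set" where
  "diag_seqs n = {d. (\<forall>i. Suc i < n \<longrightarrow> d i \<le> d (Suc i)) \<and> (\<forall>i\<ge>n. d i = 0)}"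

lemma diag_seqs_mono:
  assumes "d \<in> diag_seqs n" "i \<le> j" "j < n"
  shows "d i \<le> d j"
  using assms(2,3)
proof (induction rule: dec_induct)
  case (step k)
  then show ?case using assms(1) by (auto simp: diag_seqs_def intro: order_trans)
qed simp

text \<open>The patterns \<open>s\<close> and \<open>t\<close> hold the parts on and above, and on and below, the diagonal. They are
  indexed from \<open>0\<close>, while the array is indexed from \<open>1\<close>.\<close>

definition rpp_of :: "nat \<Rightarrow> (nat \<Rightarrow> nat \<Rightarrow> nat) \<Rightarrow> (nat \<Rightarrow> nat \<Rightarrow> nat) \<Rightarrow> nat \<Rightarrow> nat \<Rightarrow> nat" where
  "rpp_of n s t = (\<lambda>i j. if i \<in> {1..n} \<and> j \<in> {1..n}
     then if i \<le> j then s (j - i) (i - 1) else t (i - j) (j - 1) else 0)"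

lemma rpp_of_transpose:
  assumes "s \<in> gt_patterns n d" "t \<in> gt_patterns n d"
  shows "rpp_of n s t i j = rpp_of n t s j i"
  using assms by (auto simp: rpp_of_def gt_patterns_def)

lemma rpp_of_row_mono:
  assumes s: "s \<in> gt_patterns n d" and t: "t \<in> gt_patterns n d"
    and ij: "i \<in> {1..n}" "1 \<le> j" "j \<le> k" "k \<le> n"
  shows "rpp_of n s t i j \<le> rpp_of n s t i k"
proof -
  have step: "rpp_of n s t i l \<le> rpp_of n s t i (Suc l)" if l: "1 \<le> l" "Suc l \<le> n" for l
  proof -
    have s1: "s k i \<le> s (Suc k) i" if "Suc (i + k) < n" for k i
      using s that by (auto simp: gt_patterns_def)
    have t2: "t (Suc k) i \<le> t k (Suc i)" if "Suc (i + k) < n" for k i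
      using t that by (auto simp: gt_patterns_def)
    consider "i \<le> l" | "i = Suc l" | "Suc l < i" by linarith
    then show ?thesis
    proof cases
      case 1
      then show ?thesis using s1[of "i - 1" "l - i"] ij l
        by (simp add: rpp_of_def Suc_diff_le)
    next
      case 2
      \<comment> \<open>This step arrives on the diagonal from the lower part, where the common
        diagonal glues the two patterns.\<close>
      have "t 0 = s 0" using s t by (simp add: gt_patterns_def)
      then show ?thesis using t2[of "l - 1" 0] ij l 2
        by (simp add: rpp_of_def)
    next
      case 3
      then have "Suc (i - Suc l) = i - l" by simp
      then show ?thesis using t2[of "l - 1" "i - Suc l"] ij l 3
        by (simp add: rpp_of_def)
    qed
  qed
  show ?thesis
    using \<open>j \<le> k\<close> \<open>k \<le> n\<close>
  proof (induction rule: dec_induct)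
    case (step l)
    then show ?case using assms(4) \<open>\<And>l. \<lbrakk>1 \<le> l; Suc l \<le> n\<rbrakk> \<Longrightarrow> _ l\<close>[of l] by auto
  qed simp
qed

lemma bij_betw_rpp_of:
  "bij_betw (\<lambda>(d, s, t). rpp_of n s t)
    (SIGMA d : diag_seqs n. gt_patterns n d \<times> gt_patterns n d) (RPP n)"
proof (rule bij_betw_byWitness[where f' = "\<lambda>T. (\<lambda>i. T (Suc i) (Suc i),
    \<lambda>k i. T (Suc i) (Suc (i + k)), \<lambda>k i. T (Suc (i + k)) (Suc i))"], goal_cases)
  case 1
  have "((\<lambda>i. rpp_of n s t (Suc i) (Suc i)), (\<lambda>k i. rpp_of n s t (Suc i) (Suc (i + k))),
      (\<lambda>k i. rpp_of n s t (Suc (i + k)) (Suc i))) = (d, s, t)"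
    if s: "s \<in> gt_patterns n d" and t: "t \<in> gt_patterns n d" for d s t
  proof -
    have zero: "s k i = 0" "t k i = 0" if "n \<le> i + k" for k i
      using s t that by (auto simp: gt_patterns_def)
    have diag: "s 0 = d" "t 0 = d" using s t by (auto simp: gt_patterns_def)
    have "rpp_of n s t (Suc i) (Suc (i + k)) = s k i" for i k
      using zero[where i = i and k = k] by (cases "i + k < n") (auto simp: rpp_of_def)
    moreover have "rpp_of n s t (Suc (i + k)) (Suc i) = t k i" for i k
      using zero[where i = i and k = k] diag
      by (cases "i + k < n"; cases k) (auto simp: rpp_of_def)
    moreover have "rpp_of n s t (Suc i) (Suc i) = d i" for i
      using calculation(1)[of i 0] diag by simp
    ultimately show ?thesis by (intro prod_eqI ext) auto
  qed
  then show ?case by auto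
next
  case 2
  show ?case
    by (auto simp: RPP_def rpp_of_def fun_eq_iff)
next
  case 3
  show ?case
  proof clarify
    fix d s t assume d: "d \<in> diag_seqs n" and s: "s \<in> gt_patterns n d" and t: "t \<in> gt_patterns n d"
    show "rpp_of n s t \<in> RPP n"
      unfolding RPP_def
    proof (intro CollectI conjI ballI allI impI)
      fix i j k assume "i \<in> {1..n}" "j \<in> {1..n}" "k \<in> {1..n}" "j \<le> k"
      then show "rpp_of n s t i j \<le> rpp_of n s t i k"
        by (intro rpp_of_row_mono[OF s t]) auto
    next
      fix i j k assume "i \<in> {1..n}" "j \<in> {1..n}" "k \<in> {1..n}" "i \<le> k"
      then show "rpp_of n s t i j \<le> rpp_of n s t k j"
        unfolding rpp_of_transpose[OF s t] by (intro rpp_of_row_mono[OF t s]) auto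
    qed (auto simp: rpp_of_def)
  qed
next
  case 4
  show ?case
  proof (rule image_subsetI)
    fix T assume T: "T \<in> RPP n"
    have row: "T i j \<le> T i k" if "1 \<le> i" "i \<le> n" "1 \<le> j" "j \<le> k" "k \<le> n" for i j k
      using T that by (auto simp: RPP_def)
    have col: "T i j \<le> T k j" if "1 \<le> i" "i \<le> k" "k \<le> n" "1 \<le> j" "j \<le> n" for i j k
      using T that by (auto simp: RPP_def)
    have zero: "T i j = 0" if "n < i \<or> n < j" for i j
      using T that by (auto simp: RPP_def)
    have "T (Suc i) (Suc i) \<le> T (Suc (Suc i)) (Suc (Suc i))" if "Suc i < n" for i
      using row[of "Suc i" "Suc i" "Suc (Suc i)"] col[of "Suc i" "Suc (Suc i)" "Suc (Suc i)"] that by simp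
    then show "(\<lambda>i. T (Suc i) (Suc i), \<lambda>k i. T (Suc i) (Suc (i + k)), \<lambda>k i. T (Suc (i + k)) (Suc i))
      \<in> (SIGMA d : diag_seqs n. gt_patterns n d \<times> gt_patterns n d)"
      by (auto simp: diag_seqs_def gt_patterns_def zero intro!: row col)
  qed
qed

lemma sum_square_by_diagonals:
  fixes f :: "nat \<Rightarrow> nat \<Rightarrow> 'a::comm_monoid_add"
  shows "(\<Sum>i<n. \<Sum>j<n. f i j) = (\<Sum>i<n. f i i) + (\<Sum>k<n. \<Sum>i<n - Suc k. f i (i + Suc k))
    + (\<Sum>k<n. \<Sum>i<n - Suc k. f (i + Suc k) i)"
proof (induction n)
  case (Suc n)
  have aux: "(\<Sum>k<Suc n. \<Sum>i<Suc n - Suc k. g i (i + Suc k)) =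
      (\<Sum>k<n. \<Sum>i<n - Suc k. g i (i + Suc k)) + (\<Sum>i<n. g i n)" for g :: "nat \<Rightarrow> nat \<Rightarrow> 'a"
  proof -
    have "(\<Sum>k<Suc n. \<Sum>i<Suc n - Suc k. g i (i + Suc k)) = (\<Sum>k<n. \<Sum>i<Suc (n - Suc k). g i (i + Suc k))"
      by (simp add: Suc_diff_Suc)
    also have "\<dots> = (\<Sum>k<n. \<Sum>i<n - Suc k. g i (i + Suc k)) + (\<Sum>k<n. g (n - Suc k) n)"
      by (simp add: sum.distrib)
    also have "(\<Sum>k<n. g (n - Suc k) n) = (\<Sum>i<n. g i n)"
      by (rule sum.nat_diff_reindex)
    finally show ?thesis .
  qed
  show ?case
    unfolding aux[of f] aux[of "\<lambda>i j. f j i"]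
    by (simp add: sum.distrib Suc.IH) (simp add: ac_simps)
qed simp

lemma rpp_size_rpp_of:
  assumes "s \<in> gt_patterns n d" "t \<in> gt_patterns n d"
  shows "rpp_size n (rpp_of n s t) = (\<Sum>i<n. d i) + gt_size n s + gt_size n t"
proof -
  have diag: "s 0 = d" using assms by (simp add: gt_patterns_def)
  have "rpp_size n (rpp_of n s t) = (\<Sum>i<n. \<Sum>j<n. rpp_of n s t (Suc i) (Suc j))"
    unfolding rpp_size_def
    by (simp add: sum.shift_bounds_cl_Suc_ivl sum.atLeast1_atMost_eq)
  also have "\<dots> = (\<Sum>i<n. d i) + gt_size n s + gt_size n t"
    unfolding sum_square_by_diagonals gt_size_def
    by (intro arg_cong2[of _ _ _ _ "(+)"] sum.cong refl) (auto simp: rpp_of_def diag)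
  finally show ?thesis .
qed

lemma rpp_trace_rpp_of:
  assumes "s \<in> gt_patterns n d"
  shows "rpp_trace n (rpp_of n s t) = (\<Sum>i<n. d i)"
  using assms unfolding rpp_trace_def
  by (simp add: sum.atLeast1_atMost_eq rpp_of_def gt_patterns_def)

text \<open>\<open>rpp_mu\<close> reads the diagonal from its lower end, so \<open>v\<close> is the
  increasing sequence \<open>d i + i\<close> backwards. The next lemma undoes this reversal in
  products over pairs.\<close>

lemma rpp_v_rpp_of:
  assumes "s \<in> gt_patterns n d" "i \<in> {1..n}"
  shows "rpp_v n (rpp_of n s t) i = d (n - i) + (n - i)"
  using assms by (auto simp: rpp_v_def rpp_mu_def rpp_of_def gt_patterns_def)

lemma prod_pairs_reverse:
  "(\<Prod>i = 1..n. \<Prod>j\<in>{i<..n}. F (n - i) (n - j)) = (\<Prod>j<n. \<Prod>i<j. F j i)"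
  for F :: "nat \<Rightarrow> nat \<Rightarrow> 'a::comm_monoid_mult"
proof -
  have "(\<Prod>i = 1..n. \<Prod>j\<in>{i<..n}. F (n - i) (n - j)) = (\<Prod>i = 1..n. \<Prod>j<n - i. F (n - i) j)"
  proof (rule prod.cong[OF refl])
    fix i assume "i \<in> {1..n}"
    then show "(\<Prod>j\<in>{i<..n}. F (n - i) (n - j)) = (\<Prod>j<n - i. F (n - i) j)"
      by (intro prod.reindex_bij_witness[where i = "\<lambda>j. n - j" and j = "\<lambda>j. n - j"]) auto
  qed
  also have "\<dots> = (\<Prod>i<n. \<Prod>j<i. F i j)"
    by (rule prod.reindex_bij_witness[where i = "\<lambda>j. n - j" and j = "\<lambda>j. n - j"]) auto
  finally show ?thesis .
qed

section \<open>The weight as a function of the diagonal\<close>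

lemma qpoch_0: "qpoch y q 0 = 1"
  by (simp add: qpoch_def)

lemma qpoch_Suc: "qpoch y q (Suc k) = qpoch y q k * (1 - y * q ^ k)"
  by (simp add: qpoch_def)

lemma qpoch_q_nonzero:
  assumes "0 < q" "q < 1"
  shows "qpoch q q k \<noteq> 0"
proof -
  have "1 - q * q ^ l \<noteq> 0" for l
    using power_strict_decreasing[of 0 "Suc l" q] assms by simp
  then show ?thesis by (simp add: qpoch_def)
qed

text \<open>For \<open>x \<noteq> 0\<close> this is \<open>(x - y) x\<^bsup>2m-1\<^esup> (q\<^bsup>1-m\<^esup> y/x; q)\<^bsub>2m-1\<^esub>\<close>, that is, the factor of the weight for the
  pair \<open>x, y\<close> times \<open>(x - y)\<^sup>2\<close>.\<close>

definition selberg_factor :: "real \<Rightarrow> nat \<Rightarrow> real \<Rightarrow> real \<Rightarrow> real" where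
  "selberg_factor q m x y = (x - y) * (\<Prod>l<2 * m - 1. x - q powi (1 - int m + int l) * y)"

text \<open>The exponents \<open>1 - m + l\<close> run through all integers from
  \<open>1 - m\<close> to \<open>m - 1\<close>, so one of them is \<open>-(j - i)\<close>. This is
  the source of the minimal distance \<open>m\<close>.\<close>

lemma selberg_factor_eq_0:
  assumes q: "0 < q" and "i \<le> j" "j - i < m"
  shows "selberg_factor q m (q ^ i) (q ^ j) = 0"
proof -
  define l where "l = m - 1 - (j - i)"
  have "l < 2 * m - 1" using assms by (auto simp: l_def)
  moreover have "q powi (1 - int m + int l) * q ^ j = q ^ i"
  proof -
    have "q powi (1 - int m + int l) * q ^ j = q powi (1 - int m + int l + int j)"
      using q by (simp add: power_int_add)
    also have "1 - int m + int l + int j = int i"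
      using assms by (auto simp: l_def)
    finally show ?thesis by simp
  qed
  ultimately have "\<exists>l\<in>{..<2 * m - 1}. q ^ i - q powi (1 - int m + int l) * q ^ j = 0"
    by (metis lessThan_iff right_minus_eq)
  then have "(\<Prod>l<2 * m - 1. q ^ i - q powi (1 - int m + int l) * q ^ j) = 0"
    by (rule prod_zero[OF finite_lessThan])
  then show ?thesis by (simp only: selberg_factor_def mult_zero_right)
qed

text \<open>Nonnegativity provides summability: it allows the iterated sum over diagonals and
  patterns to be read as a sum over arrays. Gaps below \<open>m\<close> give \<open>0\<close>, and
  for larger gaps no exponent \<open>1 - m + l + j\<close> falls below \<open>i\<close>.\<close>

lemma selberg_factor_nonneg:
  assumes q: "0 < q" "q < 1" and "i < j"
  shows "0 \<le> selberg_factor q m (q ^ i) (q ^ j)"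
proof (cases "j - i < m")
  case True
  then show ?thesis using selberg_factor_eq_0[OF q(1), of i j m] \<open>i < j\<close> by simp
next
  case False
  have "q powi (1 - int m + int l) * q ^ j \<le> q ^ i" for l
  proof -
    have "q powi (1 - int m + int l) * q ^ j = q powi (1 - int m + int l + int j)"
      using q by (simp add: power_int_add)
    also have "1 - int m + int l + int j = int (j + l + 1 - m)"
      using False by auto
    also have "q powi int (j + l + 1 - m) \<le> q ^ i"
      unfolding power_int_of_nat using q False \<open>i < j\<close> by (intro power_decreasing) auto
    finally show ?thesis .
  qed
  moreover have "q ^ j \<le> q ^ i" using q \<open>i < j\<close> by (intro power_decreasing) auto
  ultimately show ?thesis
    by (auto simp: selberg_factor_def intro!: mult_nonneg_nonneg prod_nonneg)
qed

lemma power_mult_powi_mult_power: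
  "q \<noteq> 0 \<Longrightarrow> q ^ i * q powi k * q ^ j = q powi (int i + k + int j)" for q :: real
  by (simp add: power_int_add)

text \<open>The exponent \<open>1 + a\<close> arises because the diagonal counts once in the size
  and \<open>a\<close> times through the trace. The squared Vandermonde product is cancelled later
  by the two pattern sums, one for each triangle.\<close>

lemma wt_rpp_of:
  assumes q: "0 < q" "q < 1" and d: "d \<in> diag_seqs n"
    and s: "s \<in> gt_patterns n d" and t: "t \<in> gt_patterns n d"
  shows "wt q n a b m (rpp_of n s t) =
    q ^ gt_size n s * q ^ gt_size n t *
    ((\<Prod>i<n. q ^ ((1 + a) * d i) * qpoch (q ^ (d i + i + 1)) q b)
      * pair_prod n (selberg_factor q m) (\<lambda>i. q ^ (d i + i)) / (vandermonde n (\<lambda>i. q ^ (d i + i)))\<^sup>2)"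
proof -
  define u where "u = (\<lambda>i. d i + i)"
  have v: "rpp_v n (rpp_of n s t) i = u (n - i)" if "i \<in> {1..n}" for i
    using rpp_v_rpp_of[OF s that] by (simp add: u_def)
  have less: "u i < u j" if "i < j" "j < n" for i j
    using diag_seqs_mono[OF d, of i j] that by (simp add: u_def)
  have "(\<Prod>i<n. q ^ ((1 + a) * d i)) = q ^ ((1 + a) * (\<Sum>i<n. d i))"
    by (simp only: power_sum sum_distrib_left)
  then have "q ^ (rpp_size n (rpp_of n s t) + a * rpp_trace n (rpp_of n s t)) =
      q ^ gt_size n s * q ^ gt_size n t * (\<Prod>i<n. q ^ ((1 + a) * d i))"
    unfolding rpp_size_rpp_of[OF s t] rpp_trace_rpp_of[OF s]
    by (simp add: power_add algebra_simps)
  moreover have "(\<Prod>i = 1..n. qpoch (q ^ (rpp_v n (rpp_of n s t) i + 1)) q b) =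
      (\<Prod>i<n. qpoch (q ^ (u i + 1)) q b)"
    by (intro prod.reindex_bij_witness[where i = "\<lambda>j. n - j" and j = "\<lambda>j. n - j"]) (auto simp: v)
  moreover have "(\<Prod>i = 1..n. \<Prod>j\<in>{i<..n}.
          (q ^ rpp_v n (rpp_of n s t) j) ^ (2 * m - 1)
          * qpoch (q powi (1 - int m + int (rpp_v n (rpp_of n s t) i) - int (rpp_v n (rpp_of n s t) j))) q (2 * m - 1)
          / (q ^ rpp_v n (rpp_of n s t) j - q ^ rpp_v n (rpp_of n s t) i)) =
      (\<Prod>i = 1..n. \<Prod>j\<in>{i<..n}. (\<lambda>i j.
          (q ^ u j) ^ (2 * m - 1)
          * qpoch (q powi (1 - int m + int (u i) - int (u j))) q (2 * m - 1) / (q ^ u j - q ^ u i)) (n - i) (n - j))"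
    by (intro prod.cong refl) (auto simp: v)
  moreover have "\<dots> = (\<Prod>j<n. \<Prod>i<j. (q ^ u i) ^ (2 * m - 1)
          * qpoch (q powi (1 - int m + int (u j) - int (u i))) q (2 * m - 1) / (q ^ u i - q ^ u j))"
    by (rule prod_pairs_reverse)
  moreover have "\<dots> = (\<Prod>j<n. \<Prod>i<j. selberg_factor q m (q ^ u i) (q ^ u j) / (q ^ u j - q ^ u i)\<^sup>2)"
  proof (intro prod.cong refl)
    fix i j assume "j \<in> {..<n}" "i \<in> {..<j}"
    then have "q ^ u j < q ^ u i" using less[of i j] q by (auto intro: power_strict_decreasing)
    have "(q ^ u i) ^ (2 * m - 1) * qpoch (q powi (1 - int m + int (u j) - int (u i))) q (2 * m - 1) =
        (\<Prod>l<2 * m - 1. q ^ u i * (1 - q powi (1 - int m + int (u j) - int (u i)) * q ^ l))"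
      by (simp add: qpoch_def prod.distrib)
    also have "\<dots> = (\<Prod>l<2 * m - 1. q ^ u i - q powi (1 - int m + int l) * q ^ u j)"
    proof (intro prod.cong refl)
      fix l
      have "q ^ u i * q powi (1 - int m + int (u j) - int (u i)) * q ^ l =
         q powi (int (u i) + (1 - int m + int (u j) - int (u i)) + int l)"
        using q by (intro power_mult_powi_mult_power) simp
      also have "int (u i) + (1 - int m + int (u j) - int (u i)) + int l = 1 - int m + int l + int (u j)"
        by simp
      also have "q powi (1 - int m + int l + int (u j)) = q powi (1 - int m + int l) * q ^ u j"
        using power_mult_powi_mult_power[of q 0 "1 - int m + int l" "u j"] q by simp
      finally show "q ^ u i * (1 - q powi (1 - int m + int (u j) - int (u i)) * q ^ l) =
         q ^ u i - q powi (1 - int m + int l) * q ^ u j"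
        by (simp add: algebra_simps)
    qed
    finally show "(q ^ u i) ^ (2 * m - 1) * qpoch (q powi (1 - int m + int (u j) - int (u i))) q (2 * m - 1) / (q ^ u i - q ^ u j) =
       selberg_factor q m (q ^ u i) (q ^ u j) / (q ^ u j - q ^ u i)\<^sup>2"
      using \<open>q ^ u j < q ^ u i\<close> by (simp add: selberg_factor_def power2_commute[of "q ^ u j"] power2_eq_square[of "q ^ u i - q ^ u j"])
  qed
  moreover have "\<dots> = pair_prod n (selberg_factor q m) (\<lambda>i. q ^ u i) / (vandermonde n (\<lambda>i. q ^ u i))\<^sup>2"
    by (simp add: pair_prod_def prod_dividef prod_power_distrib)
  ultimately show ?thesis
    unfolding wt_def by (simp add: u_def prod.distrib)
qed

lemma has_sum_wt_RPP:
  assumes q: "0 < q" "q < 1"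
    and "((\<lambda>d. (\<Prod>i<n. q ^ ((1 + a) * d i) * qpoch (q ^ (d i + i + 1)) q b)
      * pair_prod n (selberg_factor q m) (\<lambda>i. q ^ (d i + i))) has_sum S) (diag_seqs n)"
  shows "(wt q n a b m has_sum (S / (vandermonde n (\<lambda>i. q ^ i))\<^sup>2)) (RPP n)"
proof -
  define g where "g d = (\<Prod>i<n. q ^ ((1 + a) * d i) * qpoch (q ^ (d i + i + 1)) q b)
      * pair_prod n (selberg_factor q m) (\<lambda>i. q ^ (d i + i))" for d
  have V: "vandermonde n (\<lambda>i. q ^ (d i + i)) \<noteq> 0" if "d \<in> diag_seqs n" for d
  proof -
    have "q ^ (d j + j) - q ^ (d i + i) \<noteq> 0" if "i < j" "j < n" for i j
      using power_strict_decreasing[OF _ q, of "d i + i" "d j + j"] diag_seqs_mono[of d n i j] that \<open>d \<in> diag_seqs n\<close> by simp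
    then show ?thesis by (auto simp: pair_prod_def)
  qed
  have qp: "0 \<le> qpoch (q ^ (k + 1)) q b" for k
    unfolding qpoch_def using q
    by (intro prod_nonneg) (auto simp: power_le_one simp flip: power_add power_Suc)
  have g: "0 \<le> g d" if "d \<in> diag_seqs n" for d
  proof -
    have "0 \<le> selberg_factor q m (q ^ (d i + i)) (q ^ (d j + j))" if "i < j" "j < n" for i j
      using diag_seqs_mono[of d n i j] that \<open>d \<in> diag_seqs n\<close> by (intro selberg_factor_nonneg q) auto
    then show ?thesis
      unfolding g_def pair_prod_def using qp q by (auto intro!: mult_nonneg_nonneg prod_nonneg)
  qed
  define V where "V d = vandermonde n (\<lambda>i. q ^ (d i + i))" for d
  define f :: "(nat \<Rightarrow> nat) \<times> (nat \<Rightarrow> nat \<Rightarrow> nat) \<times> (nat \<Rightarrow> nat \<Rightarrow> nat) \<Rightarrow> real"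
    where "f = (\<lambda>(d, s, t). wt q n a b m (rpp_of n s t))"
  have f: "f (d, s, t) = q ^ gt_size n s * q ^ gt_size n t * (g d / (V d)\<^sup>2)"
    if "d \<in> diag_seqs n" "s \<in> gt_patterns n d" "t \<in> gt_patterns n d" for d s t
    unfolding f_def using wt_rpp_of[OF q that] by (simp add: g_def V_def)
  have inner: "((\<lambda>st. f (d, st)) has_sum (g d / (vandermonde n (\<lambda>i. q ^ i))\<^sup>2))
      (gt_patterns n d \<times> gt_patterns n d)" if d: "d \<in> diag_seqs n" for d
  proof -
    have gt: "finite (gt_patterns n d)" "(\<Sum>s\<in>gt_patterns n d. q ^ gt_size n s) = V d / vandermonde n (\<lambda>i. q ^ i)"
      using sum_gt_patterns[OF q, of n d] d by (auto simp: diag_seqs_def V_def)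
    have "(\<Sum>st\<in>gt_patterns n d \<times> gt_patterns n d. f (d, st)) =
       (\<Sum>s\<in>gt_patterns n d. \<Sum>t\<in>gt_patterns n d. q ^ gt_size n s * q ^ gt_size n t * (g d / (V d)\<^sup>2))"
      by (simp add: sum.cartesian_product f[OF d] cong: sum.cong split: prod.splits) (auto intro!: sum.cong simp: f[OF d])
    also have "\<dots> = (\<Sum>s\<in>gt_patterns n d. q ^ gt_size n s) * (\<Sum>t\<in>gt_patterns n d. q ^ gt_size n t) * (g d / (V d)\<^sup>2)"
      by (simp add: sum_distrib_right sum_distrib_left mult_ac)
    also have "\<dots> = g d / (vandermonde n (\<lambda>i. q ^ i))\<^sup>2"
      unfolding gt(2) using V[OF d] by (simp add: V_def power2_eq_square)
    finally show ?thesis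
      using has_sum_finite[of "gt_patterns n d \<times> gt_patterns n d" "\<lambda>st. f (d, st)"] gt(1) by simp
  qed
  have outer: "((\<lambda>d. g d / (vandermonde n (\<lambda>i. q ^ i))\<^sup>2) has_sum (S / (vandermonde n (\<lambda>i. q ^ i))\<^sup>2)) (diag_seqs n)"
    using has_sum_cmult_left[OF assms(3), of "inverse ((vandermonde n (\<lambda>i. q ^ i))\<^sup>2)"]
    by (simp add: g_def divide_inverse)
  have "f summable_on (SIGMA d : diag_seqs n. gt_patterns n d \<times> gt_patterns n d)"
  proof (rule summable_on_SigmaI[OF inner])
    show "0 \<le> f (d, st)" if "d \<in> diag_seqs n" "st \<in> gt_patterns n d \<times> gt_patterns n d" for d st
      using that g[of d] q by (auto simp: f)
  qed (use outer in \<open>auto simp: summable_on_def\<close>)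
  then have "(f has_sum (S / (vandermonde n (\<lambda>i. q ^ i))\<^sup>2)) (SIGMA d : diag_seqs n. gt_patterns n d \<times> gt_patterns n d)"
    by (intro has_sum_SigmaI[OF _ outer] inner)
  then show ?thesis
    by (subst has_sum_reindex_bij_betw[OF bij_betw_rpp_of, symmetric]) (simp add: f_def case_prod_unfold)
qed

section \<open>Coefficient extraction on a grid\<close>

text \<open>A polynomial is presented as a list of terms in which exponent vectors may repeat.
  Everything applied to it later is linear and works term by term.\<close>

definition homogeneous :: "nat \<Rightarrow> nat \<Rightarrow> ((nat \<Rightarrow> real) \<Rightarrow> real) \<Rightarrow> bool" where
  "homogeneous n e f \<longleftrightarrow> (\<exists>L. (\<forall>(c, p)\<in>set L. (\<Sum>i<n. p i) = e) \<and>
     (\<forall>x. f x = (\<Sum>(c, p)\<leftarrow>L. c * (\<Prod>i<n. x i ^ p i))))"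

lemma homogeneous_const: "homogeneous n 0 (\<lambda>x. c)"
  unfolding homogeneous_def by (rule exI[of _ "[(c, \<lambda>_. 0)]"]) simp

lemma homogeneous_add:
  assumes "homogeneous n e f" "homogeneous n e g"
  shows "homogeneous n e (\<lambda>x. f x + g x)"
proof -
  obtain L where L: "\<forall>(c, p)\<in>set L. (\<Sum>i<n. p i) = e" "\<And>x. f x = (\<Sum>(c, p)\<leftarrow>L. c * (\<Prod>i<n. x i ^ p i))"
    using assms(1) by (auto simp: homogeneous_def)
  obtain M where M: "\<forall>(c, p)\<in>set M. (\<Sum>i<n. p i) = e" "\<And>x. g x = (\<Sum>(c, p)\<leftarrow>M. c * (\<Prod>i<n. x i ^ p i))"
    using assms(2) by (auto simp: homogeneous_def)
  show ?thesis
    unfolding homogeneous_def by (rule exI[of _ "L @ M"]) (use L M in auto)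
qed

lemma homogeneous_mult_var:
  assumes "homogeneous n e f" "j < n"
  shows "homogeneous n (Suc e) (\<lambda>x. b * x j * f x)"
proof -
  obtain L where L: "\<forall>(c, p)\<in>set L. (\<Sum>i<n. p i) = e" "\<And>x. f x = (\<Sum>(c, p)\<leftarrow>L. c * (\<Prod>i<n. x i ^ p i))"
    using assms(1) by (auto simp: homogeneous_def)
  have sum: "(\<Sum>i<n. (p(j := Suc (p j))) i) = Suc (\<Sum>i<n. p i)" for p
  proof -
    have "(\<Sum>i<n. (p(j := Suc (p j))) i) = (\<Sum>i<n. p i + (if i = j then 1 else 0))"
      by (intro sum.cong) auto
    then show ?thesis using assms(2) by (simp add: sum.distrib)
  qed
  have prod: "(\<Prod>i<n. x i ^ (p(j := Suc (p j))) i) = x j * (\<Prod>i<n. x i ^ p i)" for p and x :: "nat \<Rightarrow> real"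
  proof -
    have "(\<Prod>i<n. x i ^ (p(j := Suc (p j))) i) = (\<Prod>i<n. (if i = j then x j else 1) * x i ^ p i)"
      by (intro prod.cong) auto
    then show ?thesis using assms(2) by (simp add: prod.distrib)
  qed
  show ?thesis
    unfolding homogeneous_def
  proof (rule exI[of _ "map (\<lambda>(c, p). (b * c, p(j := Suc (p j)))) L"], intro conjI allI)
    show "\<forall>(c, p)\<in>set (map (\<lambda>(c, p). (b * c, p(j := Suc (p j)))) L). (\<Sum>i<n. p i) = Suc e"
      using L(1) by (auto simp: sum simp del: fun_upd_apply)
    show "b * x j * f x = (\<Sum>(c, p)\<leftarrow>map (\<lambda>(c, p). (b * c, p(j := Suc (p j)))) L. c * (\<Prod>i<n. x i ^ p i))" for x
      unfolding L(2)
      by (simp add: sum_list_const_mult[symmetric] o_def case_prod_unfold prod mult_ac del: fun_upd_apply)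
  qed
qed

lemma homogeneous_mult_linear:
  assumes "homogeneous n e f" "i < n" "j < n"
  shows "homogeneous n (Suc e) (\<lambda>x. (x i - b * x j) * f x)"
proof -
  have "homogeneous n (Suc e) (\<lambda>x. 1 * x i * f x + (- b) * x j * f x)"
    using assms by (intro homogeneous_add homogeneous_mult_var)
  then show ?thesis by (simp add: algebra_simps)
qed

lemma homogeneous_mult_prod_linear:
  assumes "homogeneous n e f" "i < n" "j < n"
  shows "homogeneous n (k + e) (\<lambda>x. (\<Prod>l<k. x i - b l * x j) * f x)"
proof (induction k)
  case (Suc k)
  have "homogeneous n (Suc (k + e)) (\<lambda>x. (x i - b k * x j) * ((\<Prod>l<k. x i - b l * x j) * f x))"
    by (rule homogeneous_mult_linear[OF Suc.IH assms(2,3)])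
  then show ?case by (simp add: mult_ac)
qed (use assms in simp)

text \<open>The interpolant \<open>r\<close> at the \<open>d + 1\<close> nodes equals
  \<open>p\<close>, since \<open>p - r\<close> has degree at most \<open>d\<close> and too many
  roots. Its basis polynomials are monic of degree \<open>d\<close>, so the top coefficient of
  \<open>r\<close> is the sum of their weights.\<close>

lemma lagrange_coeff:
  fixes p :: "real poly" and t :: "nat \<Rightarrow> real"
  assumes "degree p \<le> d" "inj_on t {..d}"
  shows "(\<Sum>j\<le>d. poly p (t j) / (\<Prod>k\<in>{..d} - {j}. t j - t k)) = coeff p d"
proof -
  define l where "l j = (\<Prod>k\<in>{..d} - {j}. [:- t k, 1:])" for j
  define w where "w j = (\<Prod>k\<in>{..d} - {j}. t j - t k)" for j
  have w: "w j \<noteq> 0" if "j \<le> d" for j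
    using assms(2) that by (auto simp: w_def dest: inj_onD)
  have pl: "poly (l j) (t i) = (if i = j then w j else 0)" if "i \<le> d" "j \<le> d" for i j
  proof (cases "i = j")
    case False
    then show ?thesis using that unfolding l_def poly_prod by (auto intro!: prod_zero bexI[of _ i])
  qed (simp add: l_def w_def poly_prod)
  have deg: "degree (l j) = d" if "j \<le> d" for j
    using that by (simp add: l_def degree_prod_eq_sum_degree)
  moreover have "lead_coeff (l j) = 1" for j
    by (simp add: l_def lead_coeff_prod)
  ultimately have lc: "coeff (l j) d = 1" if "j \<le> d" for j
    using that by metis
  define r where "r = (\<Sum>j\<le>d. smult (poly p (t j) / w j) (l j))"
  have "degree r \<le> d"
    unfolding r_def using deg by (intro degree_sum_le) (auto intro: order_trans[OF degree_smult_le])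
  then have "degree (p - r) \<le> d" using assms(1) by (intro degree_diff_le) auto
  moreover have "poly (p - r) (t i) = 0" if "i \<le> d" for i
  proof -
    have "(\<Sum>j\<le>d. poly p (t j) / w j * poly (l j) (t i)) = (\<Sum>j\<le>d. if j = i then poly p (t i) else 0)"
      using that w pl by (intro sum.cong) auto
    then show ?thesis using that by (simp add: r_def poly_sum)
  qed
  then have "t ` {..d} \<subseteq> {x. poly (p - r) x = 0}" by auto
  ultimately have "p - r = 0"
  proof (rule_tac ccontr)
    assume a: "degree (p - r) \<le> d" "t ` {..d} \<subseteq> {x. poly (p - r) x = 0}" "p - r \<noteq> 0"
    have "card (t ` {..d}) \<le> card {x. poly (p - r) x = 0}"
      using a by (intro card_mono poly_roots_finite)
    also have "\<dots> \<le> degree (p - r)" using a by (intro card_poly_roots_bound)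
    finally show False using a(1) assms(2) by (simp add: card_image)
  qed
  then have "coeff p d = coeff r d" by simp
  also have "\<dots> = (\<Sum>j\<le>d. poly p (t j) / w j)"
    by (simp add: r_def coeff_sum lc)
  finally show ?thesis by (simp add: w_def)
qed

lemma poly_div_sum_left: "(\<Sum>i\<in>A. f i) div g = (\<Sum>i\<in>A. f i div g)" for g :: "'a::field poly"
  by (induction A rule: infinite_finite_induct) (simp_all add: poly_div_add_left)

text \<open>Division by \<open>g\<close> followed by evaluation is thus a functional that vanishes
  on powers below \<open>k\<close> and is \<open>1\<close> on the power \<open>k\<close>, in analogy
  with the top interpolation coefficient.\<close>

lemma poly_div_monom_of_degree:
  fixes g :: "real poly"
  assumes "degree g = k" "lead_coeff g = 1"
  shows "e < k \<Longrightarrow> monom c e div g = 0" "monom c k div g = [:c:]"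
proof -
  show "monom c e div g = 0" if "e < k"
    using that assms by (intro div_poly_less) (metis degree_monom_le le_less_trans)
  have "g \<noteq> 0" using assms by auto
  show "monom c k div g = [:c:]"
  proof (cases "k = 0")
    case True
    obtain a where "g = [:a:]" using True assms(1) by (auto elim: degree_eq_zeroE)
    then have "g = 1" using assms(2) by (simp add: one_pCons)
    then show ?thesis using True by (simp add: monom_0)
  next
    case False
    have "degree (monom c k - smult c g) < k"
    proof -
      have "degree (monom c k - smult c g) \<le> k"
        using assms degree_monom_le by (intro degree_diff_le) (auto intro: order_trans[OF degree_smult_le])
      moreover have "coeff (monom c k - smult c g) k = 0" using assms by simp
      ultimately show ?thesis using False
        by (metis degree_0 le_neq_implies_less leading_coeff_0_iff)
    qed
    then have "(monom c k - smult c g) div g = 0" using assms by (intro div_poly_less) simp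
    then have "monom c k div g = smult c g div g"
      by (metis add.left_neutral diff_add_cancel poly_div_add_left)
    also have "\<dots> = smult c (g div g)" by (rule div_smult_left)
    finally show ?thesis using \<open>g \<noteq> 0\<close> by simp
  qed
qed

section \<open>Symmetry and degree of the Selberg product\<close>

text \<open>A permutation moves the unordered pairs among themselves; \<open>f r\<close> maps a pair
  to its image, sorted again so that the larger index comes first.\<close>

lemma pair_prod_permute:
  assumes h: "\<And>a b. h a b = h b a" and p: "p permutes {..<n}"
  shows "pair_prod n h (x \<circ> p) = pair_prod n h x"
proof -
  define S where "S = (SIGMA j : {..<n}. {..<j})"
  define f where "f r = (\<lambda>(j, i). (max (r j) (r i), min (r j) (r i)))" for r :: "nat \<Rightarrow> nat"
  have f_S: "f r a \<in> S" if r: "r permutes {..<n}" and "a \<in> S" for r a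
  proof -
    obtain j i where a: "a = (j, i)" "i < j" "j < n" using \<open>a \<in> S\<close> by (auto simp: S_def)
    have "r j < n" "r i < n" using permutes_in_image[OF r, of j] permutes_in_image[OF r, of i] a by auto
    moreover have "r j \<noteq> r i" using permutes_inj[OF r] a(2) by (auto dest: injD)
    ultimately show ?thesis by (auto simp: S_def f_def a(1) max_def min_def)
  qed
  have f_f: "f r (f s a) = a" if "\<And>i. r (s i) = i" "a \<in> S" for r s a
    using that by (auto simp: S_def f_def max_def min_def)
  have pp: "pair_prod n h y = (\<Prod>(j, i)\<in>S. h (y i) (y j))" for y
    by (simp add: pair_prod_def S_def prod.Sigma)
  show ?thesis
    unfolding pp
  proof (rule prod.reindex_bij_witness[where i = "f (inv_into UNIV p)" and j = "f p"])
    show "f (inv_into UNIV p) (f p a) = a" "f p a \<in> S" if "a \<in> S" for a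
      using that f_f[of "inv_into UNIV p" p] f_S[OF p] permutes_inverses[OF p] by auto
    show "f p (f (inv_into UNIV p) a) = a" "f (inv_into UNIV p) a \<in> S" if "a \<in> S" for a
      using that f_f[of p "inv_into UNIV p"] f_S[OF permutes_inv[OF p]] permutes_inverses[OF p] by auto
    show "(case f p a of (j, i) \<Rightarrow> h (x i) (x j)) = (case a of (j, i) \<Rightarrow> h ((x \<circ> p) i) ((x \<circ> p) j))" for a
      by (cases a) (auto simp: f_def max_def min_def h)
  qed
qed

text \<open>Reversing the order of the factors negates their exponents. Extracting powers of
  \<open>q\<close> then exchanges \<open>x\<close> and \<open>y\<close> at the cost of
  \<open>2 * m - 1\<close> signs, an odd number, which the factor \<open>x - y\<close>
  compensates.\<close>

lemma selberg_factor_commute: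
  assumes q: "0 < q" and m: "m \<ge> 1"
  shows "selberg_factor q m x y = selberg_factor q m y x"
proof -
  let ?k = "\<lambda>l. 1 - int m + int l"
  define N where "N = 2 * m - 1"
  have rev: "(\<Prod>l<N. g (- ?k l)) = (\<Prod>l<N. g (?k l))" for g :: "int \<Rightarrow> real"
  proof -
    have "(\<Prod>l<N. g (- ?k l)) = (\<Prod>l<N. g (?k (N - Suc l)))"
      by (intro prod.cong refl arg_cong[of _ _ g]) (auto simp: N_def)
    then show ?thesis using prod.nat_diff_reindex[of "\<lambda>l. g (?k l)" N] by simp
  qed
  \<comment> \<open>By the same reversal the product of the extracted powers is its own inverse;
    being positive, it is \<open>1\<close>.\<close>
  define c where "c = (\<Prod>l<N. q powi ?k l)"
  have "c > 0" using q by (simp add: c_def prod_pos)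
  have inv: "q powi (- k) * q powi k = 1" for k using q by (simp add: power_int_minus)
  have "(\<Prod>l<N. q powi (- ?k l)) = c"
    unfolding c_def by (rule rev)
  then have "c * c = (\<Prod>l<N. q powi (- ?k l)) * (\<Prod>l<N. q powi ?k l)"
    by (simp only: c_def)
  also have "\<dots> = 1"
    unfolding prod.distrib[symmetric] by (intro prod.neutral ballI inv)
  finally have "(c - 1) * (c + 1) = 0" by (simp add: algebra_simps)
  then have "c = 1" using \<open>c > 0\<close> by simp
  have "(\<Prod>l<N. x - q powi ?k l * y) = (\<Prod>l<N. x - q powi (- ?k l) * y)"
    by (rule rev[symmetric, of "\<lambda>k. x - q powi k * y"])
  also have "(\<Prod>l<N. x - q powi (- ?k l) * y) * c = (\<Prod>l<N. (-1) * (y - q powi ?k l * x))"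
  proof -
    have "(x - q powi (- k) * y) * q powi k = (-1) * (y - q powi k * x)" for k
    proof -
      have "(x - q powi (- k) * y) * q powi k = x * q powi k - (q powi (- k) * q powi k) * y"
        by (simp add: algebra_simps)
      then show ?thesis by (simp add: inv)
    qed
    then show ?thesis unfolding c_def prod.distrib[symmetric] by (simp only:)
  qed
  also have "\<dots> = (-1) ^ N * (\<Prod>l<N. y - q powi ?k l * x)"
    by (subst prod.distrib) simp
  finally have "(\<Prod>l<N. x - q powi ?k l * y) = (-1) ^ N * (\<Prod>l<N. y - q powi ?k l * x)"
    using \<open>c = 1\<close> by simp
  moreover have "(-1 :: real) ^ N = -1" using m by (simp add: N_def)
  ultimately show ?thesis unfolding selberg_factor_def N_def by (simp add: algebra_simps)
qed

lemma pair_prod_selberg_permute: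
  assumes "0 < q" "m \<ge> 1" "p permutes {..<n}"
  shows "pair_prod n (selberg_factor q m) (\<lambda>i. q ^ (u \<circ> p) i) =
    pair_prod n (selberg_factor q m) (\<lambda>i. q ^ u i)"
  using pair_prod_permute[OF selberg_factor_commute[OF assms(1,2)] assms(3), where x = "\<lambda>i. q ^ u i"]
  by (simp add: o_def)

lemma pair_prod_selberg_not_inj_on:
  assumes "\<not> inj_on u {..<n}"
  shows "pair_prod n (selberg_factor q m) (\<lambda>i. q ^ u i) = 0"
proof -
  obtain i' j' where "i' < n" "j' < n" "u i' = u j'" "i' \<noteq> j'"
    using assms by (auto simp: inj_on_def)
  then obtain i j where "i < j" "j < n" "u i = u j"
    by (cases "i' < j'") (auto simp: not_less dest: le_neq_implies_less)
  then show ?thesis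
    unfolding pair_prod_def by (intro prod_zero bexI[of _ j] bexI[of _ i]) (auto simp: selberg_factor_def)
qed

text \<open>The variable \<open>x k\<close> brings \<open>k\<close> factors of degree
  \<open>2 * m\<close>. The ambient number \<open>n\<close> of variables stays fixed while
  \<open>k\<close> grows, so all partial products are polynomials in the same variables.\<close>

lemma homogeneous_selberg:
  assumes m: "m \<ge> 1"
  shows "k \<le> n \<Longrightarrow> homogeneous n (\<Sum>j<k. j * (2 * m)) (\<lambda>x. pair_prod k (selberg_factor q m) x)"
proof (induction k)
  case 0
  then show ?case using homogeneous_const[of n 1] by (simp add: pair_prod_def)
next
  case (Suc k)
  have "homogeneous n (j * (2 * m) + (\<Sum>j<k. j * (2 * m)))
      (\<lambda>x. (\<Prod>i<j. selberg_factor q m (x i) (x k)) * pair_prod k (selberg_factor q m) x)" if "j \<le> k" for j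
    using that
  proof (induction j)
    case 0
    then show ?case using Suc by simp
  next
    case (Suc j)
    let ?f = "\<lambda>x. (\<Prod>i<j. selberg_factor q m (x i) (x k)) * pair_prod k (selberg_factor q m) x"
    have "homogeneous n (2 * m - 1 + (j * (2 * m) + (\<Sum>j<k. j * (2 * m))))
        (\<lambda>x. (\<Prod>l<2 * m - 1. x j - q powi (1 - int m + int l) * x k) * ?f x)"
      using Suc \<open>Suc k \<le> n\<close> by (intro homogeneous_mult_prod_linear) auto
    then have "homogeneous n (Suc (2 * m - 1 + (j * (2 * m) + (\<Sum>j<k. j * (2 * m)))))
        (\<lambda>x. (x j - 1 * x k) * ((\<Prod>l<2 * m - 1. x j - q powi (1 - int m + int l) * x k) * ?f x))"
      using Suc \<open>Suc k \<le> n\<close> by (intro homogeneous_mult_linear) auto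
    moreover have "Suc (2 * m - 1 + (j * (2 * m) + (\<Sum>j<k. j * (2 * m)))) = Suc j * (2 * m) + (\<Sum>j<k. j * (2 * m))"
      using m by simp
    moreover have "(x j - 1 * x k) * ((\<Prod>l<2 * m - 1. x j - q powi (1 - int m + int l) * x k) * ?f x) =
        (\<Prod>i<Suc j. selberg_factor q m (x i) (x k)) * pair_prod k (selberg_factor q m) x" for x
    proof -
      have "selberg_factor q m (x j) (x k) =
          (x j - 1 * x k) * (\<Prod>l<2 * m - 1. x j - q powi (1 - int m + int l) * x k)"
        by (simp add: selberg_factor_def)
      then show ?thesis by (simp only: prod.lessThan_Suc mult_ac)
    qed
    ultimately show ?case by (simp only:)
  qed
  from this[of k] show ?case by (simp add: pair_prod_Suc mult_ac add_ac)
qed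

section \<open>The q-binomial theorem and the grid functional\<close>

text \<open>These are the coefficients of \<open>(X - y) * (X - q * y) * ...\<close>, with sign and
  power of \<open>q\<close> included. The value \<open>0\<close> beyond \<open>k\<close> makes the
  Pascal rule hold also at \<open>j = k\<close>.\<close>

definition signed_qbinomial :: "real \<Rightarrow> nat \<Rightarrow> nat \<Rightarrow> real" where
  "signed_qbinomial q k j = (if j \<le> k
     then (-1) ^ j * q ^ (j choose 2) * qpoch q q k / (qpoch q q j * qpoch q q (k - j)) else 0)"

lemma signed_qbinomial_pascal:
  assumes q: "0 < q" "q < 1" and "j \<le> k"
  shows "signed_qbinomial q (Suc k) (Suc j) = signed_qbinomial q k (Suc j) - q ^ k * signed_qbinomial q k j"
proof (cases "j = k")
  case True
  then show ?thesis
    using qpoch_q_nonzero[OF q] by (simp add: signed_qbinomial_def numeral_2_eq_2 power_add qpoch_0)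
next
  case False
  then obtain r where r: "k = j + Suc r" using \<open>j \<le> k\<close> by (metis add_Suc_right le_imp_less_or_eq less_imp_Suc_add)
  have nz: "1 - q * q ^ l \<noteq> 0" for l
    using power_strict_decreasing[of 0 "Suc l" q] q by simp
  have c: "Suc j choose 2 = j + (j choose 2)" by (simp add: numeral_2_eq_2)
  \<comment> \<open>The hypothesis on \<open>w\<close> is \<open>1 - q ^ (k + 1) = (1 - q ^ (r + 1))
    + q ^ (r + 1) * (1 - q ^ (j + 1))\<close>, valid because \<open>k = j + r + 1\<close>.\<close>
  have gen: "- (s * x) * (K * w) / (A * u * (B * v)) = - (s * x) * K / (A * u * B) - x * y * (s * K / (A * (B * v)))"
    if "A \<noteq> 0" "B \<noteq> 0" "u \<noteq> 0" "v \<noteq> 0" "w = v + y * u" for A B u v w x y K s :: real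
    using that(1-4) unfolding that(5) by (simp add: field_simps)
  show ?thesis
    using gen[of "qpoch q q j" "qpoch q q r" "1 - q * q ^ j" "1 - q * q ^ r" "1 - q * q ^ k" "q * q ^ r"
        "(-1) ^ j * q ^ (j choose 2)" "q ^ j" "qpoch q q k"] qpoch_q_nonzero[OF q] nz
    by (simp add: signed_qbinomial_def r c qpoch_Suc power_add Suc_diff_le algebra_simps)
qed

lemma q_binomial_theorem:
  assumes q: "0 < q" "q < 1"
  shows "(\<Prod>r<k. [:- (q ^ r * y), 1:]) = (\<Sum>j\<le>k. monom (signed_qbinomial q k j * y ^ j) (k - j))"
proof (induction k)
  case 0
  then show ?case by (simp add: signed_qbinomial_def qpoch_def numeral_2_eq_2 monom_0 one_pCons)
next
  case (Suc k)
  let ?s = "signed_qbinomial q"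
  have lin: "[:- (q ^ k * y), 1:] = monom 1 1 + monom (- (q ^ k * y)) 0"
    by (simp add: monom_0 monom_Suc)
  have "(\<Prod>r<Suc k. [:- (q ^ r * y), 1:]) =
      (\<Sum>j\<le>k. monom (?s k j * y ^ j) (Suc k - j)) + (\<Sum>j\<le>k. monom (- (q ^ k * ?s k j) * y ^ Suc j) (k - j))"
    unfolding prod.lessThan_Suc Suc.IH lin distrib_left sum_distrib_right mult_monom
    by (intro arg_cong2[of _ _ _ _ "(+)"] sum.cong refl) (simp_all add: Suc_diff_le mult_ac)
  also have "(\<Sum>j\<le>k. monom (?s k j * y ^ j) (Suc k - j)) = (\<Sum>j\<le>Suc k. monom (?s k j * y ^ j) (Suc k - j))"
    by (simp add: signed_qbinomial_def)
  also have "\<dots> = monom (?s k 0) (Suc k) + (\<Sum>j\<le>k. monom (?s k (Suc j) * y ^ Suc j) (k - j))"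
    by (subst sum.atMost_Suc_shift) simp
  also have "monom (?s k 0) (Suc k) = monom (?s (Suc k) 0) (Suc k)"
    using qpoch_q_nonzero[OF q] by (simp add: signed_qbinomial_def)
  also have "monom (?s (Suc k) 0) (Suc k) + (\<Sum>j\<le>k. monom (?s k (Suc j) * y ^ Suc j) (k - j))
      + (\<Sum>j\<le>k. monom (- (q ^ k * ?s k j) * y ^ Suc j) (k - j)) =
      monom (?s (Suc k) 0) (Suc k) + (\<Sum>j\<le>k. monom (?s (Suc k) (Suc j) * y ^ Suc j) (k - j))"
    unfolding add.assoc sum.distrib[symmetric] add_monom
    by (intro arg_cong2[of _ _ _ _ "(+)"] sum.cong refl arg_cong2[of _ _ _ _ monom])
      (simp add: signed_qbinomial_pascal[OF q] algebra_simps)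
  also have "\<dots> = (\<Sum>j\<le>Suc k. monom (?s (Suc k) j * y ^ j) (Suc k - j))"
    by (simp add: sum.atMost_Suc_shift del: sum.atMost_Suc)
  finally show ?case .
qed

lemma prod_monom: "(\<Prod>i\<in>A. monom (c i) (e i)) = monom (\<Prod>i\<in>A. c i) (\<Sum>i\<in>A. e i)"
  for c :: "'b \<Rightarrow> 'a::comm_semiring_1"
  by (induction A rule: infinite_finite_induct) (simp_all add: mult_monom)

definition lagrange_weight :: "real \<Rightarrow> nat \<Rightarrow> nat \<Rightarrow> real" where
  "lagrange_weight q d j = inverse (\<Prod>k\<in>{..d} - {j}. q ^ j - q ^ k)"

lemma sum_lagrange_weight:
  assumes q: "0 < q" "q < 1" and "e \<le> d"
  shows "(\<Sum>j\<le>d. lagrange_weight q d j * (q ^ j) ^ e) = (if e = d then 1 else 0)"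
proof -
  have "inj_on (\<lambda>j. q ^ j) {..d}"
    using q by (intro inj_onI) (simp add: power_inject_exp')
  from lagrange_coeff[OF _ this, of "monom 1 e"] assms(3)
  show ?thesis
    by (simp add: degree_monom_eq poly_monom lagrange_weight_def divide_inverse mult.commute)
qed

lemma sum_list_case_prod_mult_right:
  "(\<Sum>(c, p)\<leftarrow>L. f c p) * b = (\<Sum>(c, p)\<leftarrow>L. f c p * b)" for b :: real
  by (induction L) (auto simp: algebra_simps)

lemma sum_sum_list_swap:
  "(\<Sum>a\<in>A. \<Sum>(c, p)\<leftarrow>L. f a c p) = (\<Sum>(c, p)\<leftarrow>L. \<Sum>a\<in>A. f a c p)" for f :: "_ \<Rightarrow> _ \<Rightarrow> _ \<Rightarrow> real"
  by (induction L) (auto simp: sum.distrib)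

text \<open>The functional applied here is a Lagrange interpolation coefficient in each \<open>x\<^sub>i\<close> and, in the
  variable \<open>x\<^sub>0\<close>, the value at \<open>c\<close> of the quotient by \<open>Q\<close>. By the degree conditions it only sees the
  coefficient of \<open>x\<^sub>0\<^bsup>n l\<^esup> \<Prod>x\<^sub>i\<^bsup>d\<^esup>\<close>. Using polynomial division instead of interpolation in \<open>x\<^sub>0\<close>
  allows \<open>Q\<close> to have multiple roots.\<close>

lemma sum_grid_monomial:
  assumes q: "0 < q" "q < 1"
    and Q: "degree Q = n * l" "lead_coeff Q = 1"
    and E: "(\<Sum>i<n. p i) = E" "E \<le> d" "n * l + n * d = E + n * k" "d \<le> k"
  shows "(\<Sum>\<alpha>\<in>PiE {..<n} (\<lambda>_. {..d}). (\<Prod>i<n. lagrange_weight q d (\<alpha> i)) * (\<Prod>i<n. (q ^ \<alpha> i) ^ p i)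
      * poly ((\<Prod>i<n. \<Prod>r<k. [:- (q ^ r * q ^ \<alpha> i), 1:]) div Q) c) =
    (\<Prod>i<n. signed_qbinomial q k (d - p i))"
proof -
  define \<phi> where "\<phi> e = poly (monom 1 e div Q) c" for e
  define J where "J = PiE {..<n} (\<lambda>_. {..k})"
  have finJ: "finite J" by (auto simp: J_def intro: finite_PiE)
  have phi: "\<phi> e = 0" if "e < n * l" for e
    using poly_div_monom_of_degree(1)[OF Q that] by (simp add: \<phi>_def)
  have phi1: "\<phi> (n * l) = 1"
    using poly_div_monom_of_degree(2)[OF Q] by (simp add: \<phi>_def)
  have expand: "poly ((\<Prod>i<n. \<Prod>r<k. [:- (q ^ r * q ^ \<alpha> i), 1:]) div Q) c =
      (\<Sum>j\<in>J. (\<Prod>i<n. signed_qbinomial q k (j i)) * (\<Prod>i<n. (q ^ \<alpha> i) ^ j i) * \<phi> (\<Sum>i<n. k - j i))"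
    for \<alpha>
  proof -
    have "(\<Prod>i<n. \<Prod>r<k. [:- (q ^ r * q ^ \<alpha> i), 1:]) =
        (\<Sum>j\<in>J. monom (\<Prod>i<n. signed_qbinomial q k (j i) * (q ^ \<alpha> i) ^ j i) (\<Sum>i<n. k - j i))"
      unfolding q_binomial_theorem[OF q] J_def prod_monom[symmetric] by (rule prod_sum_PiE) auto
    also have "\<dots> div Q = (\<Sum>j\<in>J. smult (\<Prod>i<n. signed_qbinomial q k (j i) * (q ^ \<alpha> i) ^ j i)
        (monom 1 (\<Sum>i<n. k - j i) div Q))"
      unfolding poly_div_sum_left div_smult_left[symmetric] by (simp add: smult_monom)
    finally show ?thesis
      by (simp add: poly_sum prod.distrib \<phi>_def)
  qed
  have "(\<Sum>\<alpha>\<in>PiE {..<n} (\<lambda>_. {..d}). (\<Prod>i<n. lagrange_weight q d (\<alpha> i)) * (\<Prod>i<n. (q ^ \<alpha> i) ^ p i)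
      * poly ((\<Prod>i<n. \<Prod>r<k. [:- (q ^ r * q ^ \<alpha> i), 1:]) div Q) c) =
      (\<Sum>\<alpha>\<in>PiE {..<n} (\<lambda>_. {..d}). \<Sum>j\<in>J. (\<Prod>i<n. signed_qbinomial q k (j i)) * \<phi> (\<Sum>i<n. k - j i)
        * (\<Prod>i<n. lagrange_weight q d (\<alpha> i) * (q ^ \<alpha> i) ^ (p i + j i)))"
    unfolding expand sum_distrib_left by (intro sum.cong refl) (simp add: prod.distrib power_add mult_ac)
  also have "\<dots> = (\<Sum>j\<in>J. (\<Prod>i<n. signed_qbinomial q k (j i)) * \<phi> (\<Sum>i<n. k - j i)
        * (\<Sum>\<alpha>\<in>PiE {..<n} (\<lambda>_. {..d}). \<Prod>i<n. lagrange_weight q d (\<alpha> i) * (q ^ \<alpha> i) ^ (p i + j i)))"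
    by (subst sum.swap) (simp only: sum_distrib_left)
  also have "\<dots> = (\<Sum>j\<in>J. (\<Prod>i<n. signed_qbinomial q k (j i)) * \<phi> (\<Sum>i<n. k - j i)
        * (\<Prod>i<n. \<Sum>a\<le>d. lagrange_weight q d a * (q ^ a) ^ (p i + j i)))" (is "_ = sum ?t J")
    by (subst prod_sum_PiE) auto
  also have "\<dots> = ?t (restrict (\<lambda>i. d - p i) {..<n})"
  proof -
    define j0 where "j0 = restrict (\<lambda>i. d - p i) {..<n}"
    have j0: "j0 \<in> J" using E(4) by (auto simp: J_def j0_def)
    \<comment> \<open>A nonzero term needs \<open>p i + j i \<ge> d\<close> for every
      \<open>i\<close>, by the interpolation functional, and
      \<open>(\<Sum>i<n. k - j i) \<ge> n * l\<close>, by the division functional. The degree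
      equation turns the second bound into \<open>(\<Sum>i<n. p i + j i) \<le> n * d\<close>, so all
      the first bounds are equalities.\<close>
    have "?t j = 0" if j: "j \<in> J" "j \<noteq> j0" for j
    proof (rule ccontr)
      assume nz: "?t j \<noteq> 0"
      have jk: "j i \<le> k" if "i < n" for i using j(1) that by (auto simp: J_def)
      have ge: "d \<le> p i + j i" if "i < n" for i
      proof (rule ccontr)
        assume "\<not> d \<le> p i + j i"
        then have "(\<Sum>a\<le>d. lagrange_weight q d a * (q ^ a) ^ (p i + j i)) = 0"
          using sum_lagrange_weight[OF q, of "p i + j i" d] by simp
        then have "(\<Prod>i<n. \<Sum>a\<le>d. lagrange_weight q d a * (q ^ a) ^ (p i + j i)) = 0"
          using that by (intro prod_zero) auto
        then show False using nz by simp
      qed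
      have "n * l \<le> (\<Sum>i<n. k - j i)"
        using nz phi[of "\<Sum>i<n. k - j i"] by (intro leI) auto
      moreover have "(\<Sum>i<n. k - j i) + (\<Sum>i<n. j i) = n * k"
        using jk by (simp flip: sum.distrib)
      ultimately have "(\<Sum>i<n. p i + j i) \<le> (\<Sum>i<n. d)"
        using E by (simp add: sum.distrib)
      have "p i + j i = d" if "i < n" for i
      proof (rule ccontr)
        assume "p i + j i \<noteq> d"
        then have "(\<Sum>i<n. d) < (\<Sum>i<n. p i + j i)"
          using ge that by (intro sum_strict_mono_ex1) (auto intro!: bexI[of _ i] le_neq_implies_less)
        then show False using \<open>(\<Sum>i<n. p i + j i) \<le> (\<Sum>i<n. d)\<close> by simp
      qed
      then have "j i = j0 i" if "i < n" for i using that by (force simp: j0_def)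
      then have "j = j0"
        using j(1) j0 by (intro PiE_ext[of j "{..<n}" "\<lambda>_. {..k}" j0]) (auto simp: J_def)
      then show False using j(2) by simp
    qed
    then have "sum ?t J = sum ?t {j0}"
      using finJ j0 by (intro sum.mono_neutral_right) auto
    then show ?thesis by (simp add: j0_def)
  qed
  also have "\<dots> = (\<Prod>i<n. signed_qbinomial q k (d - p i))"
  proof -
    have pd: "p i \<le> d" if "i < n" for i
      using member_le_sum[of i "{..<n}" p] that E(1,2) by simp
    have "(\<Sum>i<n. k - (d - p i)) + (\<Sum>i<n. d) = (\<Sum>i<n. k + p i)"
      unfolding sum.distrib[symmetric] using pd E(4) by (intro sum.cong) auto
    then have "(\<Sum>i<n. k - (d - p i)) = n * l" using E(1,3) by (simp add: sum.distrib)
    then show ?thesis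
      using sum_lagrange_weight[OF q, of d d] phi1 pd by simp
  qed
  finally show ?thesis .
qed

section \<open>The \<open>q\<close>-Selberg coefficient\<close>

lemma degree_prod_linear:
  "degree (\<Prod>i\<in>A. [:- (f i :: real), 1:]) = card A" "lead_coeff (\<Prod>i\<in>A. [:- (f i :: real), 1:]) = 1"
proof -
  show "degree (\<Prod>i\<in>A. [:- (f i :: real), 1:]) = card A"
    by (subst degree_prod_eq_sum_degree) simp_all
  show "lead_coeff (\<Prod>i\<in>A. [:- (f i :: real), 1:]) = 1"
    by (subst lead_coeff_prod) simp
qed

context
  fixes q :: real and m n A d :: nat and L :: "(real \<times> (nat \<Rightarrow> nat)) list"
  assumes q: "0 < q" "q < 1" and m: "m \<ge> 1" and n: "n \<ge> 1"
    and d: "m * n * (n - 1) \<le> d"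
    and L_deg: "\<And>c p. (c, p) \<in> set L \<Longrightarrow> (\<Sum>i<n. p i) = m * n * (n - 1)"
    and L_eq: "\<And>x. pair_prod n (selberg_factor q m) x = (\<Sum>(c, p)\<leftarrow>L. c * (\<Prod>i<n. x i ^ p i))"
begin

text \<open>The grid functional is evaluated in two ways: term by term over the monomials of
  \<open>D\<close>, which gives q-binomial coefficients, and point by point, where only
  \<open>u i = m * i\<close> and its \<open>fact n\<close> rearrangements survive.\<close>

lemma selberg_coefficient:
  "(\<Sum>(c, p)\<leftarrow>L. c * (\<Prod>i<n. signed_qbinomial q (A + d) (d - p i))) =
    fact n * ((\<Prod>i<n. lagrange_weight q d (m * i)) * pair_prod n (selberg_factor q m) (\<lambda>i. q ^ (m * i)) *
    ((\<Prod>i<n. \<Prod>k = m * i..<m * i + (A + d). q ^ (A + d + m * (n - 1)) - q ^ k) /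
     (\<Prod>i<n. \<Prod>k = d - m * (n - 1 - i)..<A + d + m * i. q ^ (A + d + m * (n - 1)) - q ^ k)))"
proof -
  \<comment> \<open>The exponent is the first one beyond the root interval of the last variable when
    \<open>u (n - 1) = m * (n - 1)\<close>; it falls inside this interval as soon as
    \<open>u (n - 1)\<close> is larger, and it exceeds all exponents occurring in
    \<open>Q\<close>.\<close>
  define C where "C = q ^ (A + d + m * (n - 1))"
  define D where "D = pair_prod n (selberg_factor q m)"
  \<comment> \<open>Gaps of at least \<open>m\<close> force
    \<open>m * i \<le> u i \<le> d - m * (n - 1 - i)\<close>, and the interval taken here is the
    part common to all the root intervals \<open>{u i..<u i + (A + d)}\<close> in this range. Its
    length \<open>A + m * (n - 1)\<close> is the one required by the degree count in
    \<open>sum_grid_monomial\<close>.\<close>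
  define Q where "Q = (\<Prod>i<n. \<Prod>k = d - m * (n - 1 - i)..<A + d + m * i. [:- (q ^ k), 1:])"
  define G where "G u = (\<Prod>i<n. \<Prod>r<A + d. [:- (q ^ r * q ^ u i), 1:])" for u :: "nat \<Rightarrow> nat"
  define F where "F u = (\<Prod>i<n. lagrange_weight q d (u i)) * D (\<lambda>i. q ^ u i) * poly (G u div Q) C" for u
  have G_eq: "G u = (\<Prod>i<n. \<Prod>k = u i..<u i + (A + d). [:- (q ^ k), 1:])" for u
    unfolding G_def
  proof (rule prod.cong[OF refl])
    fix i
    show "(\<Prod>r<A + d. [:- (q ^ r * q ^ u i), 1:]) = (\<Prod>k = u i..<u i + (A + d). [:- (q ^ k), 1:])"
      by (rule prod.reindex_bij_witness[where i = "\<lambda>k. k - u i" and j = "\<lambda>r. r + u i"]) (auto simp: power_add)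
  qed
  have d1: "m * (n - 1) \<le> d"
  proof -
    have "m * (n - 1) \<le> n * (m * (n - 1))" using n by (cases n) auto
    also have "\<dots> = m * n * (n - 1)" by simp
    finally show ?thesis using d by linarith
  qed
  have d2: "m * (n - 1 - i) \<le> d" for i
    using d1 mult_le_mono2[of "n - 1 - i" "n - 1" m] by linarith
  have Q: "degree Q = n * (A + m * (n - 1))" "lead_coeff Q = 1"
  proof -
    have "degree Q = (\<Sum>i<n. A + d + m * i - (d - m * (n - 1 - i)))"
      unfolding Q_def by (subst degree_prod_eq_sum_degree) (simp_all add: degree_prod_linear)
    also have "\<dots> = (\<Sum>i<n. A + m * (n - 1))"
    proof (intro sum.cong refl)
      fix i assume "i \<in> {..<n}"
      then have "m * i + m * (n - 1 - i) = m * (n - 1)" by (simp flip: distrib_left)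
      then show "A + d + m * i - (d - m * (n - 1 - i)) = A + m * (n - 1)" using d2[of i] by linarith
    qed
    finally show "degree Q = n * (A + m * (n - 1))" by simp
    show "lead_coeff Q = 1"
      unfolding Q_def by (simp only: lead_coeff_prod degree_prod_linear(2)) simp
  qed
  have "(\<Sum>u\<in>PiE {..<n} (\<lambda>_. {..d}). F u) =
      (\<Sum>u\<in>PiE {..<n} (\<lambda>_. {..d}). \<Sum>(c, p)\<leftarrow>L. c * ((\<Prod>i<n. lagrange_weight q d (u i)) *
        (\<Prod>i<n. (q ^ u i) ^ p i) * poly (G u div Q) C))"
  proof (rule sum.cong[OF refl])
    fix u
    have "F u = D (\<lambda>i. q ^ u i) * ((\<Prod>i<n. lagrange_weight q d (u i)) * poly (G u div Q) C)"
      by (simp add: F_def)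
    also have "\<dots> = (\<Sum>(c, p)\<leftarrow>L. c * (\<Prod>i<n. (q ^ u i) ^ p i) *
        ((\<Prod>i<n. lagrange_weight q d (u i)) * poly (G u div Q) C))"
      unfolding D_def L_eq by (rule sum_list_case_prod_mult_right)
    also have "\<dots> = (\<Sum>(c, p)\<leftarrow>L. c * ((\<Prod>i<n. lagrange_weight q d (u i)) *
        (\<Prod>i<n. (q ^ u i) ^ p i) * poly (G u div Q) C))"
      by (intro arg_cong[of _ _ sum_list] map_cong refl) (simp add: case_prod_unfold)
    finally show "F u = (\<Sum>(c, p)\<leftarrow>L. c * ((\<Prod>i<n. lagrange_weight q d (u i)) *
        (\<Prod>i<n. (q ^ u i) ^ p i) * poly (G u div Q) C))" .
  qed
  also have "\<dots> = (\<Sum>(c, p)\<leftarrow>L. c * (\<Sum>u\<in>PiE {..<n} (\<lambda>_. {..d}). (\<Prod>i<n. lagrange_weight q d (u i)) *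
        (\<Prod>i<n. (q ^ u i) ^ p i) * poly (G u div Q) C))"
    unfolding sum_sum_list_swap by (simp only: sum_distrib_left)
  also have "\<dots> = (\<Sum>(c, p)\<leftarrow>L. c * (\<Prod>i<n. signed_qbinomial q (A + d) (d - p i)))"
  proof (intro arg_cong[of _ _ sum_list] map_cong refl)
    fix t assume "t \<in> set L"
    obtain c p where t: "t = (c, p)" by (cases t)
    have "n * (A + m * (n - 1)) + n * d = m * n * (n - 1) + n * (A + d)"
      by (cases n) (simp_all add: algebra_simps)
    then show "(case t of (c, p) \<Rightarrow> c * (\<Sum>u\<in>PiE {..<n} (\<lambda>_. {..d}). (\<Prod>i<n. lagrange_weight q d (u i)) *
        (\<Prod>i<n. (q ^ u i) ^ p i) * poly (G u div Q) C)) =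
        (case t of (c, p) \<Rightarrow> c * (\<Prod>i<n. signed_qbinomial q (A + d) (d - p i)))"
      unfolding t G_def using L_deg[of c p] \<open>t \<in> set L\<close> d t
      by (simp add: sum_grid_monomial[OF q Q])
  qed
  finally have total: "(\<Sum>u\<in>PiE {..<n} (\<lambda>_. {..d}). F u) =
      (\<Sum>(c, p)\<leftarrow>L. c * (\<Prod>i<n. signed_qbinomial q (A + d) (d - p i)))" .
  have fin: "finite (PiE {..<n} (\<lambda>_. {..d}))" by (auto intro: finite_PiE)
  have finI: "finite (increasing_seqs n {..d})"
    by (rule finite_subset[OF _ fin]) (auto simp: increasing_seqs_def)
  have hs: "(F has_sum ((\<Sum>u\<in>PiE {..<n} (\<lambda>_. {..d}). F u) / fact n)) (increasing_seqs n {..d})"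
  proof (rule has_sum_increasing_seqs)
    show "(F has_sum (\<Sum>u\<in>PiE {..<n} (\<lambda>_. {..d}). F u)) (PiE {..<n} (\<lambda>_. {..d}))"
      by (intro has_sum_finite fin)
    show "F (u \<circ> p) = F u" if p: "p permutes {..<n}" for p u
    proof -
      have "D (\<lambda>i. q ^ (u \<circ> p) i) = D (\<lambda>i. q ^ u i)"
        unfolding D_def by (rule pair_prod_selberg_permute[OF q(1) m p])
      moreover have "(\<Prod>i<n. lagrange_weight q d ((u \<circ> p) i)) = (\<Prod>i<n. lagrange_weight q d (u i))"
        using prod.permute[OF p, of "\<lambda>i. lagrange_weight q d (u i)"] by (simp add: o_def)
      moreover have "G (u \<circ> p) = G u"
        using prod.permute[OF p, of "\<lambda>i. \<Prod>r<A + d. [:- (q ^ r * q ^ u i), 1:]"] by (simp add: G_def o_def)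
      ultimately show ?thesis by (simp add: F_def)
    qed
    show "F u = 0" if "\<not> inj_on u {..<n}" for u
      using pair_prod_selberg_not_inj_on[OF that] by (simp add: F_def D_def)
  qed
  define u0 where "u0 = restrict (\<lambda>i. m * i) {..<n}"
  have u0: "u0 \<in> increasing_seqs n {..d}"
  proof -
    have "m * i \<le> d" if "i < n" for i
      using d1 mult_le_mono2[of i "n - 1" m] that by linarith
    then show ?thesis using m by (auto simp: increasing_seqs_def u0_def)
  qed
  \<comment> \<open>Where \<open>D\<close> vanishes, \<open>Q\<close> need not divide
    \<open>G u\<close>, but there both sides are \<open>0\<close>. Everywhere else the polynomial
    division is exact and can be evaluated as a quotient of values.\<close>
  have main: "F u = (\<Prod>i<n. lagrange_weight q d (u i)) * D (\<lambda>i. q ^ u i) * (poly (G u) C / poly Q C)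
      \<and> (u \<noteq> u0 \<longrightarrow> F u = 0)" if u: "u \<in> increasing_seqs n {..d}" for u
  proof (cases "D (\<lambda>i. q ^ u i) = 0")
    case True
    then show ?thesis by (simp add: F_def)
  next
    case False
    have less: "u i < u j" if "i < j" "j < n" for i j using u that by (auto simp: increasing_seqs_def)
    have ud: "u i \<le> d" if "i < n" for i using u that by (auto simp: increasing_seqs_def)
    have gap: "u i + m \<le> u j" if "i < j" "j < n" for i j
    proof (rule ccontr)
      assume "\<not> u i + m \<le> u j"
      then have "selberg_factor q m (q ^ u i) (q ^ u j) = 0"
        using less[OF that] by (intro selberg_factor_eq_0 q) auto
      then have "D (\<lambda>i. q ^ u i) = 0"
        unfolding D_def pair_prod_def using that by (intro prod_zero bexI[of _ j] bexI[of _ i]) auto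
      then show False using False by simp
    qed
    have gaps: "u i + m * k \<le> u (i + k)" if "i + k < n" for i k
      using that
    proof (induction k)
      case (Suc k)
      then show ?case using gap[of "i + k" "i + Suc k"] by simp
    qed simp
    have lo: "m * i \<le> u i" if "i < n" for i using gaps[of 0 i] that by simp
    have hi: "u i + m * (n - 1 - i) \<le> u (n - 1)" if "i < n" for i using gaps[of i "n - 1 - i"] that by simp
    have "Q dvd G u"
      unfolding Q_def G_eq
    proof (intro prod_dvd_prod prod_dvd_prod_subset)
      fix i assume "i \<in> {..<n}"
      then show "{d - m * (n - 1 - i)..<A + d + m * i} \<subseteq> {u i..<u i + (A + d)}"
        using lo[of i] hi[of i] ud[of "n - 1"] by auto
    qed auto
    then obtain H where H: "G u = Q * H" by (elim dvdE)
    have "Q \<noteq> 0" using Q(2) by auto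
    have "poly Q C \<noteq> 0"
    proof -
      have "C \<noteq> q ^ k" if "i < n" "k < A + d + m * i" for i k
      proof -
        have "m * i \<le> m * (n - 1)" using that by (intro mult_le_mono2) auto
        then have "k < A + d + m * (n - 1)" using that(2) by linarith
        from power_strict_decreasing[OF this q] show ?thesis by (simp add: C_def)
      qed
      then show ?thesis by (auto simp: Q_def poly_prod)
    qed
    then have 1: "poly (G u div Q) C = poly (G u) C / poly Q C"
      using \<open>Q \<noteq> 0\<close> by (simp add: H)
    \<comment> \<open>With gaps of at least \<open>m\<close>, the bound
      \<open>u (n - 1) \<le> m * (n - 1)\<close> leaves only the tightest packing \<open>u0\<close>.
      Otherwise \<open>C\<close> is a root contributed by the last variable.\<close>
    have 2: "poly (G u) C = 0" if "u \<noteq> u0"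
    proof -
      have "m * (n - 1) < u (n - 1)"
      proof (rule ccontr)
        assume "\<not> m * (n - 1) < u (n - 1)"
        then have "u i = m * i" if "i < n" for i
        proof -
          have "m * i + m * (n - 1 - i) = m * (n - 1)" using that by (simp flip: distrib_left)
          then show ?thesis using lo[OF that] hi[OF that] \<open>\<not> m * (n - 1) < u (n - 1)\<close> by linarith
        qed
        then have "u = u0"
          using u u0 by (intro PiE_ext[of u "{..<n}" "\<lambda>_. {..d}" u0]) (auto simp: increasing_seqs_def u0_def)
        then show False using that by simp
      qed
      then have "A + d + m * (n - 1) \<in> {u (n - 1)..<u (n - 1) + (A + d)}"
        using ud[of "n - 1"] n by auto
      then have "(\<Prod>k = u (n - 1)..<u (n - 1) + (A + d). poly [:- (q ^ k), 1:] C) = 0"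
        unfolding C_def by (intro prod_zero bexI[of _ "A + d + m * (n - 1)"]) simp_all
      then have "\<exists>i\<in>{..<n}. (\<Prod>k = u i..<u i + (A + d). poly [:- (q ^ k), 1:] C) = 0"
        by (rule bexI[where x = "n - 1"]) (use n in simp)
      then show ?thesis
        unfolding G_eq poly_prod by (rule prod_zero[OF finite_lessThan])
    qed
    show ?thesis unfolding F_def 1 using 2 by auto
  qed
  have "(\<Sum>u\<in>increasing_seqs n {..d}. F u) = (\<Sum>u\<in>{u0}. F u)"
  proof (intro sum.mono_neutral_right finI ballI)
    show "F u = 0" if "u \<in> increasing_seqs n {..d} - {u0}" for u
      using main[of u] that by blast
  qed (use u0 in auto)
  also have "\<dots> = (\<Prod>i<n. lagrange_weight q d (m * i)) * D (\<lambda>i. q ^ (m * i)) * (poly (G u0) C / poly Q C)"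
    using conjunct1[OF main[OF u0]] unfolding D_def
    by (simp add: u0_def cong: pair_prod_cong)
  also have "poly (G u0) C = (\<Prod>i<n. \<Prod>k = m * i..<m * i + (A + d). C - q ^ k)"
    unfolding G_eq poly_prod by (rule prod.cong[OF refl]) (simp add: u0_def)
  also have "poly Q C = (\<Prod>i<n. \<Prod>k = d - m * (n - 1 - i)..<A + d + m * i. C - q ^ k)"
    unfolding Q_def poly_prod by simp
  finally have "(\<Sum>u\<in>increasing_seqs n {..d}. F u) =
      (\<Prod>i<n. lagrange_weight q d (m * i)) * D (\<lambda>i. q ^ (m * i)) *
      ((\<Prod>i<n. \<Prod>k = m * i..<m * i + (A + d). C - q ^ k) /
       (\<Prod>i<n. \<Prod>k = d - m * (n - 1 - i)..<A + d + m * i. C - q ^ k))" .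
  moreover have "(\<Sum>u\<in>increasing_seqs n {..d}. F u) = (\<Sum>u\<in>PiE {..<n} (\<lambda>_. {..d}). F u) / fact n"
    using has_sum_unique[OF has_sum_finite[OF finI] hs] .
  ultimately show ?thesis
    unfolding total by (simp add: field_simps C_def D_def)
qed

end

section \<open>q-Pochhammer symbols at powers of \<open>q\<close>\<close>

lemma qpoch_shift:
  assumes "0 < q" "q < 1"
  shows "qpoch (q ^ Suc a) q k = qpoch q q (a + k) / qpoch q q a"
proof (induction k)
  case 0
  then show ?case using qpoch_q_nonzero[OF assms] by (simp add: qpoch_0)
next
  case (Suc k)
  then show ?case by (simp add: qpoch_Suc power_add mult_ac)
qed

lemma two_times_choose_two: "2 * (k choose 2) = k * (k - 1)"
proof -
  have "even (k * (k - 1))" by (cases k) auto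
  then show ?thesis by (simp add: choose_two)
qed

lemma qpoch_inverse_power:
  assumes q: "0 < q" "q < 1" and "k \<le> d"
  shows "qpoch (1 / q ^ d) q k =
    (-1) ^ k * q ^ (k choose 2) / q ^ (d * k) * (qpoch q q d / qpoch q q (d - k))"
  using \<open>k \<le> d\<close>
proof (induction k)
  case 0
  then show ?case using qpoch_q_nonzero[OF q] by (simp add: qpoch_0 numeral_2_eq_2)
next
  case (Suc k)
  then obtain e where e: "d = Suc (k + e)" using less_imp_Suc_add[of k d] by auto
  have nz: "1 - q * q ^ e \<noteq> 0"
    using power_strict_decreasing[of 0 "Suc e" q] q by simp
  have gen: "s * y / c * (P / (R * w)) * (- w * t / c') = (-1) * s * (t * y) / (c' * c) * (P / R)"
    if "w \<noteq> 0" for s y c P R w t c' :: real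
    using that by (simp add: field_simps)
  have ch: "Suc k choose 2 = k + (k choose 2)" by (simp add: numeral_2_eq_2)
  have factor: "1 - 1 / q ^ d * q ^ k = - (1 - q * q ^ e) * q ^ k / q ^ d"
    using q by (simp add: e field_simps power_add)
  have "qpoch (1 / q ^ d) q (Suc k) =
      (-1) ^ k * q ^ (k choose 2) / q ^ (d * k) * (qpoch q q d / qpoch q q (Suc e)) * (1 - 1 / q ^ d * q ^ k)"
    using Suc e by (simp add: qpoch_Suc Suc_diff_le)
  also have "\<dots> = (-1) * (-1) ^ k * (q ^ k * q ^ (k choose 2)) / (q ^ d * q ^ (d * k)) *
      (qpoch q q d / qpoch q q e)"
    unfolding factor qpoch_Suc by (rule gen[OF nz])
  finally show ?case
    by (simp add: ch power_add e)
qed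

lemma prod_q_power_diff:
  assumes q: "0 < q" "q < 1" and "b + k \<le> c"
  shows "(\<Prod>j = b..<b + k. q ^ c - q ^ j) =
    (-1) ^ k * q ^ ((b + k) choose 2) / q ^ (b choose 2) * (qpoch q q (c - b) / qpoch q q (c - b - k))"
  using \<open>b + k \<le> c\<close>
proof (induction k)
  case 0
  then show ?case using qpoch_q_nonzero[OF q] q by simp
next
  case (Suc k)
  then obtain e where e: "c = Suc (b + k + e)" using less_imp_Suc_add[of "b + k" c] by auto
  have nz: "1 - q * q ^ e \<noteq> 0"
    using power_strict_decreasing[of 0 "Suc e" q] q by simp
  have ch: "Suc (b + k) choose 2 = b + k + ((b + k) choose 2)" by (simp add: numeral_2_eq_2)
  have gen: "s * y / c * (P / (R * w)) * (- w * t) = (-1) * s * (y * t) / c * (P / R)"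
    if "w \<noteq> 0" for s y c P R w t :: real
    using that by (simp add: field_simps)
  have last: "q ^ c - q ^ (b + k) = - (1 - q * q ^ e) * q ^ (b + k)"
    by (simp add: e algebra_simps power_add)
  have "(\<Prod>j = b..<b + Suc k. q ^ c - q ^ j) = (\<Prod>j = b..<b + k. q ^ c - q ^ j) * (q ^ c - q ^ (b + k))"
    by simp
  also have "\<dots> = (-1) ^ k * q ^ ((b + k) choose 2) / q ^ (b choose 2) *
      (qpoch q q (c - b) / qpoch q q (Suc e)) * (q ^ c - q ^ (b + k))"
    using Suc by (simp add: e Suc_diff_le)
  also have "\<dots> = (-1) * (-1) ^ k * (q ^ ((b + k) choose 2) * q ^ (b + k)) / q ^ (b choose 2) *
      (qpoch q q (c - b) / qpoch q q e)"
    unfolding last qpoch_Suc by (rule gen[OF nz])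
  also have "q ^ ((b + k) choose 2) * q ^ (b + k) = q ^ ((b + Suc k) choose 2)"
    by (simp add: ch power_add mult_ac)
  finally show ?case by (simp add: e)
qed

lemma lagrange_weight_eq:
  assumes q: "0 < q" "q < 1" and "k \<le> d"
  shows "lagrange_weight q d k =
    (-1) ^ k / (q ^ (k choose 2) * q ^ (k * (d - k)) * qpoch q q k * qpoch q q (d - k))"
proof -
  have "{..d} - {k} = {0..<0 + k} \<union> {Suc k..d}" using assms(3) by auto
  then have "(\<Prod>j\<in>{..d} - {k}. q ^ k - q ^ j) = (\<Prod>j\<in>{0..<0 + k} \<union> {Suc k..d}. q ^ k - q ^ j)"
    by (rule arg_cong)
  also have "\<dots> = (\<Prod>j = 0..<0 + k. q ^ k - q ^ j) * (\<Prod>j = Suc k..d. q ^ k - q ^ j)"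
    by (rule prod.union_disjoint) auto
  also have "(\<Prod>j = 0..<0 + k. q ^ k - q ^ j) = (-1) ^ k * q ^ (k choose 2) * qpoch q q k"
    by (subst prod_q_power_diff[OF q]) (simp_all add: qpoch_0 numeral_2_eq_2)
  also have "(\<Prod>j = Suc k..d. q ^ k - q ^ j) = (\<Prod>l<d - k. q ^ k * (1 - q * q ^ l))"
  proof (rule prod.reindex_bij_witness[where i = "\<lambda>l. Suc (k + l)" and j = "\<lambda>j. j - Suc k"])
    fix j assume "j \<in> {Suc k..d}"
    then have "q ^ j = q ^ k * (q * q ^ (j - Suc k))"
      using power_add[of q "Suc k" "j - Suc k"] by (simp add: mult_ac)
    then show "q ^ k * (1 - q * q ^ (j - Suc k)) = q ^ k - q ^ j" by (simp add: algebra_simps)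
  qed (use assms(3) in auto)
  also have "\<dots> = q ^ (k * (d - k)) * qpoch q q (d - k)"
    by (simp add: prod.distrib qpoch_def power_mult)
  finally have "(\<Prod>j\<in>{..d} - {k}. q ^ k - q ^ j) =
      (-1) ^ k * (q ^ (k choose 2) * q ^ (k * (d - k)) * qpoch q q k * qpoch q q (d - k))"
    by simp
  moreover have "inverse ((-1) ^ k) = (-1 :: real) ^ k" by (simp add: power_inverse[symmetric])
  ultimately show ?thesis by (simp add: lagrange_weight_def divide_inverse)
qed

text \<open>The index \<open>d - p\<close> is the power of a variable still missing when a monomial
  of \<open>D\<close> supplies the exponent \<open>p\<close> and the exponent \<open>d\<close> is to
  be reached. The remaining dependence on \<open>p\<close> is \<open>q ^ p\<close>, which multiplies
  up to the total degree.\<close>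

lemma signed_qbinomial_ratio:
  assumes q: "0 < q" "q < 1" and "p \<le> d"
  shows "signed_qbinomial q (a + d) (d - p) =
    signed_qbinomial q (a + d) d * q ^ p * (qpoch (1 / q ^ d) q p / qpoch (q ^ Suc a) q p)"
proof -
  obtain e where e: "d = e + p" by (rule that[of "d - p"]) (use assms(3) in simp)
  have c: "q ^ (d choose 2) * q ^ (p choose 2) * q ^ p = q ^ (e choose 2) * q ^ (d * p)"
  proof -
    have "2 * ((d choose 2) + (p choose 2) + p) = 2 * ((e choose 2) + d * p)"
      unfolding distrib_left two_times_choose_two e
      by (cases p; cases e) (auto simp: algebra_simps)
    then have "(d choose 2) + (p choose 2) + p = (e choose 2) + d * p"
      by (subst (asm) nat_mult_eq_cancel1) simp_all
    then show ?thesis by (simp only: power_add[symmetric])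
  qed
  have s: "(-1 :: real) ^ d * (-1) ^ p = (-1) ^ e"
  proof -
    have "(-1 :: real) ^ p * (-1) ^ p = 1" by (simp flip: power_add)
    then show ?thesis by (simp add: e power_add mult.assoc)
  qed
  have "signed_qbinomial q (a + d) d * q ^ p * (qpoch (1 / q ^ d) q p / qpoch (q ^ Suc a) q p) =
     ((-1) ^ d * (-1) ^ p) * ((q ^ (d choose 2) * q ^ (p choose 2) * q ^ p) / q ^ (d * p)) *
       (qpoch q q (a + d) / (qpoch q q e * qpoch q q (a + p)))"
    unfolding qpoch_inverse_power[OF q assms(3)] qpoch_shift[OF q]
    using qpoch_q_nonzero[OF q] by (simp add: signed_qbinomial_def e mult_ac)
  also have "\<dots> = signed_qbinomial q (a + d) (d - p)"
    unfolding c s using q by (simp add: signed_qbinomial_def e add_ac)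
  finally show ?thesis ..
qed

text \<open>The balance of the powers of \<open>q\<close> belonging to one index \<open>i\<close>,
  with \<open>k = m * i\<close>. Doubling removes the halves hidden in the binomial
  coefficients.\<close>

lemma power_choose_identity:
  assumes "k \<le> d"
  shows "((d - k) choose 2) + d * k + d * k =
    (d choose 2) + 2 * k + (k choose 2) + (k choose 2) + (k choose 2) + k * (d - k)"
proof -
  obtain e where e: "d = e + k" by (rule that[of "d - k"]) (use assms in simp)
  have "2 * (((d - k) choose 2) + d * k + d * k) =
    2 * ((d choose 2) + 2 * k + (k choose 2) + (k choose 2) + (k choose 2) + k * (d - k))"
    unfolding distrib_left two_times_choose_two e by (cases k; cases e) (auto simp: algebra_simps)
  then show ?thesis by simp
qed

text \<open>Both sides of \<open>selberg_coefficient\<close> carry the factor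
  \<open>s ^ n * q ^ E\<close>, where \<open>s\<close> is the signed q-binomial coefficient of lower
  index \<open>d\<close>; cancelling it gives the claim. The bound on \<open>d\<close> ensures
  \<open>p i \<le> d\<close> for all exponents that occur.\<close>

lemma selberg_polynomial_at:
  fixes q :: real and m n a d :: nat and L :: "(real \<times> (nat \<Rightarrow> nat)) list"
  assumes q: "0 < q" "q < 1" and m: "m \<ge> 1" and n: "n \<ge> 1"
    and d: "m * n * (n - 1) \<le> d"
    and L_deg: "\<And>c p. (c, p) \<in> set L \<Longrightarrow> (\<Sum>i<n. p i) = m * n * (n - 1)"
    and L_eq: "\<And>x. pair_prod n (selberg_factor q m) x = (\<Sum>(c, p)\<leftarrow>L. c * (\<Prod>i<n. x i ^ p i))"
    and z: "z = 1 / q ^ d"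
  shows "(\<Sum>(c, p)\<leftarrow>L. c * (\<Prod>i<n. qpoch z q (p i) / qpoch (q ^ Suc a) q (p i))) =
    fact n * pair_prod n (selberg_factor q m) (\<lambda>i. q ^ (m * i)) *
    (\<Prod>i<n. qpoch z q (m * i) * (\<Prod>l<m * i. z - q ^ (Suc a + l)) /
      (qpoch (q ^ Suc a) q (m * (n - 1) + m * i) * qpoch q q (m * i)))"
    (is "?N = fact n * ?D * (\<Prod>i<n. ?Y i)")
proof -
  let ?P = "qpoch q q" and ?s = "signed_qbinomial q (a + d) d"
  define E where "E = m * n * (n - 1)"
  note nz = qpoch_q_nonzero[OF q]
  have d1: "m * i \<le> d" if "i < n" for i
  proof -
    have "m * i \<le> m * (n - 1)" using that by (intro mult_le_mono2) auto
    also have "\<dots> \<le> n * (m * (n - 1))" using n by (cases n) auto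
    also have "\<dots> = m * n * (n - 1)" by simp
    finally show ?thesis using d by linarith
  qed
  have "?s \<noteq> 0" using nz q by (simp add: signed_qbinomial_def)
  have lhs: "(\<Sum>(c, p)\<leftarrow>L. c * (\<Prod>i<n. signed_qbinomial q (a + d) (d - p i))) = ?N * (?s ^ n * q ^ E)"
    unfolding sum_list_case_prod_mult_right
  proof (intro arg_cong[of _ _ sum_list] map_cong refl)
    fix t assume "t \<in> set L"
    obtain c p where t: "t = (c, p)" by (cases t)
    have p: "(\<Sum>i<n. p i) = E" using L_deg \<open>t \<in> set L\<close> t by (simp add: E_def)
    have pd: "p i \<le> d" if "i < n" for i
      using member_le_sum[of i "{..<n}" p] that p d by (simp add: E_def)
    have "(\<Prod>i<n. signed_qbinomial q (a + d) (d - p i)) =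
        (\<Prod>i<n. ?s * q ^ p i * (qpoch z q (p i) / qpoch (q ^ Suc a) q (p i)))"
      using pd unfolding z by (intro prod.cong refl signed_qbinomial_ratio[OF q]) auto
    also have "\<dots> = (?s ^ n * q ^ E) * (\<Prod>i<n. qpoch z q (p i) / qpoch (q ^ Suc a) q (p i))"
      by (simp only: prod.distrib p[symmetric] power_sum) simp
    finally show "(case t of (c, p) \<Rightarrow> c * (\<Prod>i<n. signed_qbinomial q (a + d) (d - p i))) =
       (case t of (c, p) \<Rightarrow> c * (\<Prod>i<n. qpoch z q (p i) / qpoch (q ^ Suc a) q (p i)) * (?s ^ n * q ^ E))"
      by (simp add: t)
  qed
  have rhs: "(\<Prod>i<n. lagrange_weight q d (m * i)) *
    ((\<Prod>i<n. \<Prod>k = m * i..<m * i + (a + d). q ^ (a + d + m * (n - 1)) - q ^ k) /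
     (\<Prod>i<n. \<Prod>k = d - m * (n - 1 - i)..<a + d + m * i. q ^ (a + d + m * (n - 1)) - q ^ k)) =
    (?s ^ n * q ^ E) * (\<Prod>i<n. ?Y i)"
  proof -
    let ?C = "a + d + m * (n - 1)"
    have ratio: "(\<Prod>k = m * i..<m * i + (a + d). q ^ ?C - q ^ k) /
        (\<Prod>k = d - m * (n - 1 - i)..<a + d + m * i. q ^ ?C - q ^ k) =
        (-1) ^ (d - m * (n - 1)) / q ^ ((m * i) choose 2) *
        (q ^ ((d - m * (n - Suc i)) choose 2) *
          (?P (a + d + m * (n - Suc i)) / ?P (a + m * (n - 1) + m * (n - Suc i))))" if i: "i < n" for i
    proof -
      have mi: "m * i + m * (n - Suc i) = m * (n - 1)" using i by (simp flip: distrib_left)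
      have dn: "m * (n - 1) \<le> d" using d1[of "n - 1"] n by simp
      \<comment> \<open>Numerator and denominator run over intervals with the same right end, so the
        quotient consists of the first \<open>b\<close> factors of the numerator.\<close>
      define b where "b = d - m * (n - 1)"
      have b: "d - m * (n - Suc i) = m * i + b" "d = m * i + m * (n - Suc i) + b"
        using mi dn by (auto simp: b_def)
      have le: "m * i \<le> m * i + b" "m * i + b \<le> m * i + (a + d)" using b by auto
      have nz': "(\<Prod>k = m * i + b..<m * i + (a + d). q ^ ?C - q ^ k) \<noteq> 0"
      proof -
        have "q ^ ?C - q ^ k \<noteq> 0" if "k < m * i + (a + d)" for k
        proof -
          have "k < ?C" using that mi by linarith
          from power_strict_decreasing[OF this q] show ?thesis by simp
        qed
        then show ?thesis by simp
      qed
      have split: "(\<Prod>k = m * i..<m * i + (a + d). q ^ ?C - q ^ k) =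
          (\<Prod>k = m * i..<m * i + b. q ^ ?C - q ^ k) * (\<Prod>k = m * i + b..<m * i + (a + d). q ^ ?C - q ^ k)"
        by (rule prod.atLeastLessThan_concat[OF le, symmetric])
      have ends: "d - m * (n - 1 - i) = m * i + b" "a + d + m * i = m * i + (a + d)"
        using b by auto
      have "(\<Prod>k = m * i..<m * i + (a + d). q ^ ?C - q ^ k) /
        (\<Prod>k = d - m * (n - 1 - i)..<a + d + m * i. q ^ ?C - q ^ k) = (\<Prod>k = m * i..<m * i + b. q ^ ?C - q ^ k)"
        unfolding ends split by (rule nonzero_mult_div_cancel_right[OF nz'])
      also have "\<dots> = (-1) ^ b * q ^ ((m * i + b) choose 2) / q ^ ((m * i) choose 2) *
          (?P (?C - m * i) / ?P (?C - m * i - b))"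
        using mi b by (intro prod_q_power_diff[OF q]) linarith
      also have "?C - m * i = a + d + m * (n - Suc i)" using mi by linarith
      also have "a + d + m * (n - Suc i) - b = a + m * (n - 1) + m * (n - Suc i)" using mi b by linarith
      finally show ?thesis unfolding b(1) b_def[symmetric] by simp
    qed
    \<comment> \<open>Apart from a sign and a power of \<open>q\<close>, the ratio at
      \<open>i\<close> depends on \<open>n - Suc i\<close>. Reversing the product of these parts
      aligns them with the Lagrange weights at \<open>m * i\<close>.\<close>
    define x where "x k = q ^ ((d - k) choose 2) * (?P (a + d + k) / ?P (a + m * (n - 1) + k))" for k
    have "(\<Prod>i<n. \<Prod>k = m * i..<m * i + (a + d). q ^ ?C - q ^ k) /
       (\<Prod>i<n. \<Prod>k = d - m * (n - 1 - i)..<a + d + m * i. q ^ ?C - q ^ k) =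
      (\<Prod>i<n. (-1) ^ (d - m * (n - 1)) * (1 / q ^ ((m * i) choose 2)) * x (m * (n - Suc i)))"
      unfolding prod_dividef[symmetric]
      by (intro prod.cong refl) (simp only: lessThan_iff ratio x_def, simp)
    also have "\<dots> = ((-1) ^ (d - m * (n - 1))) ^ n * (\<Prod>i<n. 1 / q ^ ((m * i) choose 2)) * (\<Prod>i<n. x (m * (n - Suc i)))"
      by (simp only: prod.distrib) simp
    also have "(\<Prod>i<n. x (m * (n - Suc i))) = (\<Prod>i<n. x (m * i))"
      by (rule prod.nat_diff_reindex)
    also have "((-1 :: real) ^ (d - m * (n - 1))) ^ n = ((-1) ^ d) ^ n"
    proof -
      have dn: "m * (n - 1) \<le> d" using d1[of "n - 1"] n by simp
      have "even ((n - 1) * n)" by (cases n) auto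
      then have "even (m * (n - 1) * n)" by (simp add: mult.assoc)
      moreover have "d * n = (d - m * (n - 1)) * n + m * (n - 1) * n"
        using dn by (simp flip: distrib_right)
      ultimately have "even (d * n) = even ((d - m * (n - 1)) * n)" by simp
      then have "(-1 :: real) ^ ((d - m * (n - 1)) * n) = (-1) ^ (d * n)"
        by (simp only: minus_one_power_iff)
      then show ?thesis by (simp only: power_mult)
    qed
    finally have A: "(\<Prod>i<n. \<Prod>k = m * i..<m * i + (a + d). q ^ ?C - q ^ k) /
       (\<Prod>i<n. \<Prod>k = d - m * (n - 1 - i)..<a + d + m * i. q ^ ?C - q ^ k) =
       (\<Prod>i<n. (-1) ^ d * (1 / q ^ ((m * i) choose 2)) * x (m * i))"
      by (simp only: prod.distrib prod_constant card_lessThan)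
    have S: "2 * (\<Sum>i<n. i) = n * (n - 1)"
      by (induction n) (auto simp: algebra_simps)
    have "(\<Sum>i<n. 2 * (m * i)) = m * (2 * (\<Sum>i<n. i))"
      by (simp add: sum_distrib_left mult.left_commute)
    then have "E = (\<Sum>i<n. 2 * (m * i))"
      unfolding S E_def by (simp only: mult.assoc)
    then have B: "(?s ^ n * q ^ E) * (\<Prod>i<n. ?Y i) = (\<Prod>i<n. ?s * q ^ (2 * (m * i)) * ?Y i)"
      by (simp only: prod.distrib power_sum) simp
    show ?thesis
      unfolding A B prod.distrib[symmetric]
    proof (rule prod.cong[OF refl])
      fix i assume i: "i \<in> {..<n}"
      define k where "k = m * i"
      have kd: "k \<le> d" using d1 i by (simp add: k_def)
      have "(\<Prod>l<k. z - q ^ (Suc a + l)) = (\<Prod>l<k. 1 / q ^ d * (1 - q ^ Suc (a + d) * q ^ l))"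
        unfolding z using q by (intro prod.cong refl) (simp add: field_simps power_add)
      also have "\<dots> = 1 / q ^ (d * k) * qpoch (q ^ Suc (a + d)) q k"
        by (simp only: prod.distrib prod_constant card_lessThan qpoch_def power_divide power_one power_mult)
      finally have zq: "(\<Prod>l<k. z - q ^ (Suc a + l)) = 1 / q ^ (d * k) * (?P (a + d + k) / ?P (a + d))"
        unfolding qpoch_shift[OF q] .
      have pw: "q ^ ((d - k) choose 2) * q ^ (d * k) * q ^ (d * k) =
          q ^ (d choose 2) * q ^ (2 * k) * q ^ (k choose 2) * q ^ (k choose 2) * q ^ (k choose 2) * q ^ (k * (d - k))"
        using power_choose_identity[OF kd] by (simp flip: power_add)
      have "?s * q ^ (2 * k) * (qpoch z q k * (\<Prod>l<k. z - q ^ (Suc a + l)) /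
          (qpoch (q ^ Suc a) q (m * (n - 1) + k) * ?P k)) =
          (-1) ^ d * (-1) ^ k * (q ^ (d choose 2) * q ^ (2 * k) * q ^ (k choose 2) / (q ^ (d * k) * q ^ (d * k))) *
          (?P (a + d + k) / (?P (d - k) * ?P (a + m * (n - 1) + k) * ?P k))"
      proof -
        have s: "?s = (-1) ^ d * q ^ (d choose 2) * ?P (a + d) / (?P d * ?P a)"
          by (simp add: signed_qbinomial_def)
        have gen: "e * x * pad / (pd * pa) * y * (f * w / r * (pd / pdk) * (1 / r * (padk / pad)) / (pc / pa * pk)) =
            e * f * (x * y * w / (r * r)) * (padk / (pdk * pc * pk))"
          if "pad \<noteq> 0" "pd \<noteq> 0" "pa \<noteq> 0" for e x pad pd pa y f w r pdk padk pc pk :: real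
          using that by (simp add: mult_ac)
        have ac: "a + (m * (n - 1) + k) = a + m * (n - 1) + k" by simp
        show ?thesis
          unfolding zq unfolding z s qpoch_inverse_power[OF q kd] qpoch_shift[OF q] ac
          by (rule gen) (rule nz)+
      qed
      also have "q ^ (d choose 2) * q ^ (2 * k) * q ^ (k choose 2) / (q ^ (d * k) * q ^ (d * k)) =
          q ^ ((d - k) choose 2) / (q ^ (k choose 2) * q ^ (k choose 2) * q ^ (k * (d - k)))"
        using pw q by (simp add: field_simps)
      also have "(-1) ^ d * (-1) ^ k * (q ^ ((d - k) choose 2) / (q ^ (k choose 2) * q ^ (k choose 2) * q ^ (k * (d - k)))) *
          (?P (a + d + k) / (?P (d - k) * ?P (a + m * (n - 1) + k) * ?P k)) =
          lagrange_weight q d k * ((-1) ^ d * (1 / q ^ (k choose 2)) * x k)"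
        unfolding lagrange_weight_eq[OF q kd] x_def by (simp add: mult_ac)
      finally show "lagrange_weight q d (m * i) * ((-1) ^ d * (1 / q ^ ((m * i) choose 2)) * x (m * i)) =
          ?s * q ^ (2 * (m * i)) * ?Y i"
        by (simp add: k_def)
    qed
  qed
  have "?N * (?s ^ n * q ^ E) = fact n * ((\<Prod>i<n. lagrange_weight q d (m * i)) * ?D *
    ((\<Prod>i<n. \<Prod>k = m * i..<m * i + (a + d). q ^ (a + d + m * (n - 1)) - q ^ k) /
     (\<Prod>i<n. \<Prod>k = d - m * (n - 1 - i)..<a + d + m * i. q ^ (a + d + m * (n - 1)) - q ^ k)))"
    unfolding lhs[symmetric] by (rule selberg_coefficient[OF q m n d]) (simp_all only: L_deg L_eq)
  also have "\<dots> = fact n * ?D * ((\<Prod>i<n. lagrange_weight q d (m * i)) *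
    ((\<Prod>i<n. \<Prod>k = m * i..<m * i + (a + d). q ^ (a + d + m * (n - 1)) - q ^ k) /
     (\<Prod>i<n. \<Prod>k = d - m * (n - 1 - i)..<a + d + m * i. q ^ (a + d + m * (n - 1)) - q ^ k)))"
    by (simp only: mult.assoc mult.left_commute[of "prod _ _" ?D])
  also have "\<dots> = fact n * ?D * (\<Prod>i<n. ?Y i) * (?s ^ n * q ^ E)"
    unfolding rhs by (simp only: mult.assoc mult.commute[of "prod _ _" "?s ^ n * q ^ E"])
  finally have "?N * (?s ^ n * q ^ E) = fact n * ?D * (\<Prod>i<n. ?Y i) * (?s ^ n * q ^ E)" .
  moreover have "?s ^ n * q ^ E \<noteq> 0" using \<open>?s \<noteq> 0\<close> q by simp
  ultimately show ?thesis by (rule mult_right_cancel[THEN iffD1, rotated])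
qed

lemma poly_qpoch: "poly (\<Prod>l<k. [:1, - (q ^ l):]) z = qpoch z q k"
  by (simp add: poly_prod qpoch_def)

text \<open>The parameter \<open>a\<close> enters only through constants and will be instantiated
  with \<open>a + b + 1\<close>, while \<open>z\<close> is free. Both sides are polynomials in
  \<open>z\<close> that agree at the infinitely many points \<open>1 / q ^ d\<close>.\<close>

lemma selberg_polynomial:
  fixes q z :: real and m n a :: nat and L :: "(real \<times> (nat \<Rightarrow> nat)) list"
  assumes q: "0 < q" "q < 1" and m: "m \<ge> 1" and n: "n \<ge> 1"
    and L_deg: "\<And>c p. (c, p) \<in> set L \<Longrightarrow> (\<Sum>i<n. p i) = m * n * (n - 1)"
    and L_eq: "\<And>x. pair_prod n (selberg_factor q m) x = (\<Sum>(c, p)\<leftarrow>L. c * (\<Prod>i<n. x i ^ p i))"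
  shows "(\<Sum>(c, p)\<leftarrow>L. c * (\<Prod>i<n. qpoch z q (p i) / qpoch (q ^ Suc a) q (p i))) =
    fact n * pair_prod n (selberg_factor q m) (\<lambda>i. q ^ (m * i)) *
    (\<Prod>i<n. qpoch z q (m * i) * (\<Prod>l<m * i. z - q ^ (Suc a + l)) /
      (qpoch (q ^ Suc a) q (m * (n - 1) + m * i) * qpoch q q (m * i)))"
    (is "?f z = ?g z")
proof -
  let ?p = "\<lambda>k. \<Prod>l<k. [:1, - (q ^ l):]"
  define F where "F = (\<Sum>(c, p)\<leftarrow>L. smult c (\<Prod>i<n. smult (1 / qpoch (q ^ Suc a) q (p i)) (?p (p i))))"
  define G where "G = smult (fact n * pair_prod n (selberg_factor q m) (\<lambda>i. q ^ (m * i)))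
    (\<Prod>i<n. smult (1 / (qpoch (q ^ Suc a) q (m * (n - 1) + m * i) * qpoch q q (m * i)))
      (?p (m * i) * (\<Prod>l<m * i. [:- (q ^ (Suc a + l)), 1:])))"
  have F: "poly F z = ?f z" for z
    unfolding F_def by (induction L) (auto simp: poly_prod poly_qpoch[unfolded poly_prod] qpoch_def)
  have G: "poly G z = ?g z" for z
    unfolding G_def by (simp add: poly_prod qpoch_def prod_dividef)
  define X where "X = (\<lambda>d. 1 / q ^ d) ` {m * n * (n - 1)..}"
  have "inj_on (\<lambda>d. 1 / q ^ d) {m * n * (n - 1)..}"
    using q by (intro inj_onI) (simp add: power_inject_exp')
  then have "infinite X"
    unfolding X_def by (simp add: finite_image_iff infinite_Ici)
  moreover have "X \<subseteq> {z. poly (F - G) z = 0}"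
    unfolding X_def using selberg_polynomial_at[OF q m n _ L_deg L_eq refl, where a = a] by (auto simp: F G)
  ultimately have "F - G = 0"
    using poly_roots_finite[of "F - G"] finite_subset by blast
  then show ?thesis using F[of z] G[of z] by simp
qed

section \<open>The \<open>q\<close>-Selberg sum\<close>

lemma qpoch_Suc_left: "qpoch y q (Suc k) = (1 - y) * qpoch (y * q) q k"
  unfolding qpoch_def by (subst prod.lessThan_Suc_shift) (simp add: mult_ac)

lemma qpoch_add: "qpoch y q (j + k) = qpoch y q j * qpoch (y * q ^ j) q k"
  by (induction k) (simp_all add: qpoch_0 qpoch_Suc power_add mult_ac)

lemma qpoch_pos:
  assumes "0 < q" "q < 1" "0 \<le> y" "y < 1"
  shows "0 < qpoch y q k"
proof -
  have "y * q ^ l < 1" for l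
    using mult_right_le_one_le[of y "q ^ l"] assms by (simp add: power_le_one less_imp_le le_less_trans)
  then show ?thesis by (simp add: qpoch_def prod_pos)
qed

text \<open>The new factor \<open>1 - q ^ Suc b * q ^ v\<close> splits the sum into the sums for
  \<open>z\<close> and for \<open>z * q\<close>; hence the induction is for all \<open>z\<close> at
  once.\<close>

lemma has_sum_q_beta:
  assumes q: "0 < q" "q < 1" and z: "0 < z" "z < 1"
  shows "((\<lambda>v. z ^ v * qpoch (q ^ (v + 1)) q b) has_sum (qpoch q q b / qpoch z q (Suc b))) UNIV"
  using z
proof (induction b arbitrary: z)
  case 0
  have "((\<lambda>v. z ^ v) has_sum (1 / (1 - z))) UNIV"
    using 0 geometric_sums[of z] by (intro sums_nonneg_imp_has_sum) auto
  then show ?case by (simp add: qpoch_0 qpoch_Suc)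
next
  case (Suc b)
  have zq: "0 < z * q" "z * q < 1"
    using Suc.prems q mult_strict_mono[of z 1 q 1] by auto
  have nz: "1 - z \<noteq> 0" "1 - z * q ^ Suc b \<noteq> 0" "qpoch (z * q) q b \<noteq> 0"
  proof -
    show "qpoch (z * q) q b \<noteq> 0" using qpoch_pos[OF q, of "z * q" b] zq by simp
    have "z * q ^ Suc b < 1"
      using Suc.prems q mult_strict_mono[of z 1 "q ^ Suc b" 1] power_Suc_less_one[of q b] by auto
    then show "1 - z * q ^ Suc b \<noteq> 0" by simp
  qed (use Suc.prems in simp)
  have "((\<lambda>v. z ^ v * qpoch (q ^ (v + 1)) q b + - (q ^ Suc b) * ((z * q) ^ v * qpoch (q ^ (v + 1)) q b)) has_sum
      (qpoch q q b / qpoch z q (Suc b) + - (q ^ Suc b) * (qpoch q q b / qpoch (z * q) q (Suc b)))) UNIV"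
    by (intro has_sum_add has_sum_cmult_right Suc.IH Suc.prems zq)
  moreover have "z ^ v * qpoch (q ^ (v + 1)) q b + - (q ^ Suc b) * ((z * q) ^ v * qpoch (q ^ (v + 1)) q b) =
      z ^ v * qpoch (q ^ (v + 1)) q (Suc b)" for v
    by (simp add: qpoch_Suc algebra_simps power_add power_mult_distrib)
  moreover have "qpoch q q b / qpoch z q (Suc b) - q ^ Suc b * (qpoch q q b / qpoch (z * q) q (Suc b)) =
      qpoch q q (Suc b) / qpoch z q (Suc (Suc b))"
  proof -
    define r where "r = qpoch (z * q) q b"
    define s where "s = q ^ Suc b"
    have 1: "qpoch z q (Suc b) = (1 - z) * r" by (simp add: r_def qpoch_Suc_left)
    have 2: "qpoch (z * q) q (Suc b) = r * (1 - z * s)" by (simp add: r_def s_def qpoch_Suc mult_ac)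
    have 3: "qpoch z q (Suc (Suc b)) = (1 - z) * (r * (1 - z * s))" by (subst qpoch_Suc_left) (simp add: 2)
    have 4: "qpoch q q (Suc b) = qpoch q q b * (1 - s)" by (simp add: s_def qpoch_Suc)
    have gen: "x / (u * r) - s * (x / (r * w)) = x * (1 - s) / (u * (r * w))"
      if "u \<noteq> 0" "r \<noteq> 0" "w \<noteq> 0" "w - s * u = 1 - s" for x u r w s :: real
    proof -
      have "x / (u * r) - s * (x / (r * w)) = x * (w - s * u) / (u * (r * w))"
        using that(1-3) by (simp add: field_simps)
      then show ?thesis using that(4) by simp
    qed
    show ?thesis
      unfolding 1 2 3 4 s_def[symmetric] using nz
      by (intro gen) (simp_all add: r_def s_def algebra_simps)
  qed
  ultimately show ?case by (simp only: diff_conv_add_uminus mult_minus_left)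
qed

text \<open>Since \<open>infsum\<close> is \<open>0\<close> for families that are not summable, the assumption that no \<open>S x\<close> vanishes
  yields summability over the product.\<close>

lemma has_sum_prod_PiE:
  fixes f :: "'a \<Rightarrow> 'b \<Rightarrow> real"
  assumes "finite A" "\<And>x. x \<in> A \<Longrightarrow> (f x has_sum S x) (B x)" "\<And>x. x \<in> A \<Longrightarrow> S x \<noteq> 0"
  shows "((\<lambda>g. \<Prod>x\<in>A. f x (g x)) has_sum (\<Prod>x\<in>A. S x)) (PiE A B)"
proof -
  have "f x abs_summable_on B x" if "x \<in> A" for x
    using assms(2)[OF that] summable_on_iff_abs_summable_on_real by (auto simp: summable_on_def)
  then have inf: "infsum (\<lambda>g. \<Prod>x\<in>A. f x (g x)) (PiE A B) = (\<Prod>x\<in>A. S x)"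
    using assms(1,2) by (subst infsum_prod_PiE_abs) (auto intro!: prod.cong infsumI)
  have "(\<lambda>g. \<Prod>x\<in>A. f x (g x)) summable_on PiE A B"
  proof (rule ccontr)
    assume "\<not> (\<lambda>g. \<Prod>x\<in>A. f x (g x)) summable_on PiE A B"
    then have "(\<Prod>x\<in>A. S x) = 0" using inf by (simp add: infsum_not_exists)
    then show False using assms by simp
  qed
  then show ?thesis using inf has_sum_infsum by fastforce
qed

lemma has_sum_sum_list:
  fixes f :: "'b \<Rightarrow> 'a \<Rightarrow> real"
  assumes "\<And>t. t \<in> set L \<Longrightarrow> (f t has_sum S t) A"
  shows "((\<lambda>v. \<Sum>t\<leftarrow>L. f t v) has_sum (\<Sum>t\<leftarrow>L. S t)) A"
  using assms by (induction L) (auto intro!: has_sum_add has_sum_0)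

section \<open>Closed forms of the constant factors\<close>

lemma qpoch_eq_qfact:
  assumes "q \<noteq> 1"
  shows "qpoch q q k = (1 - q) ^ k * qfact q k"
proof -
  have "qfact q k = (\<Prod>l<k. (1 - q * q ^ l) / (1 - q))"
    unfolding qfact_def by (simp add: prod.atLeast1_atMost_eq)
  then show ?thesis using assms by (simp add: prod_dividef qpoch_def)
qed

lemma selberg_factor_q_powers:
  assumes q: "0 < q" "q < 1" and m: "m \<ge> 1"
  shows "selberg_factor q m (q ^ c) (q ^ (c + m * Suc k)) =
    (q ^ c) ^ (2 * m) * ((1 - q ^ (m * Suc k)) * (qpoch q q (m * Suc k + m - 1) / qpoch q q (m * k)))"
proof -
  have "q ^ c - q powi (1 - int m + int l) * q ^ (c + m * Suc k) = q ^ c * (1 - q ^ Suc (m * k) * q ^ l)" for l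
  proof -
    have "q powi (1 - int m + int l) * q ^ (c + m * Suc k) =
        q powi (int 0 + (1 - int m + int l) + int (c + m * Suc k))"
      using power_mult_powi_mult_power[of q 0 "1 - int m + int l" "c + m * Suc k"] q
      by (simp only: power_0 mult_1)
    also have "int 0 + (1 - int m + int l) + int (c + m * Suc k) = int (c + (Suc (m * k) + l))" by simp
    finally show ?thesis by (simp only: power_int_of_nat power_add) (simp add: algebra_simps)
  qed
  then have "(\<Prod>l<2 * m - 1. q ^ c - q powi (1 - int m + int l) * q ^ (c + m * Suc k)) =
      (q ^ c) ^ (2 * m - 1) * qpoch (q ^ Suc (m * k)) q (2 * m - 1)"
    by (simp add: prod.distrib qpoch_def)
  also have "qpoch (q ^ Suc (m * k)) q (2 * m - 1) = qpoch q q (m * Suc k + m - 1) / qpoch q q (m * k)"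
  proof -
    have "m * k + (2 * m - 1) = m * Suc k + m - 1" using m by simp
    then show ?thesis unfolding qpoch_shift[OF q] by simp
  qed
  finally have "selberg_factor q m (q ^ c) (q ^ (c + m * Suc k)) = (q ^ c - q ^ (c + m * Suc k)) *
      ((q ^ c) ^ (2 * m - 1) * (qpoch q q (m * Suc k + m - 1) / qpoch q q (m * k)))"
    by (simp only: selberg_factor_def)
  also have "q ^ c - q ^ (c + m * Suc k) = q ^ c * (1 - q ^ (m * Suc k))"
    by (simp add: power_add algebra_simps)
  also have "q ^ c * (1 - q ^ (m * Suc k)) * ((q ^ c) ^ (2 * m - 1) * (qpoch q q (m * Suc k + m - 1) / qpoch q q (m * k))) =
      (q ^ c) ^ Suc (2 * m - 1) * ((1 - q ^ (m * Suc k)) * (qpoch q q (m * Suc k + m - 1) / qpoch q q (m * k)))"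
    by simp
  also have "Suc (2 * m - 1) = 2 * m" using m by simp
  finally show ?thesis .
qed

text \<open>The factor \<open>1 - q ^ (m * Suc k)\<close> completes
  \<open>qpoch q q (m * k + m - 1)\<close> to \<open>qpoch q q (m * Suc k)\<close>, which the next
  denominator cancels.\<close>

lemma prod_selberg_telescope:
  assumes q: "0 < q" "q < 1" and m: "m \<ge> 1"
  shows "(\<Prod>k<j. (1 - q ^ (m * Suc k)) * (qpoch q q (m * Suc k + m - 1) / qpoch q q (m * k))) =
    qpoch q q (m * j + m - 1) * qpoch q q (m * j) / qpoch q q (m - 1)"
proof (induction j)
  case 0
  then show ?case using qpoch_q_nonzero[OF q] by (simp add: qpoch_0)
next
  case (Suc j)
  have "m * Suc j = Suc (m * j + m - 1)" using m by simp
  then have "qpoch q q (m * Suc j) = qpoch q q (m * j + m - 1) * (1 - q ^ (m * Suc j))"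
    by (simp only: qpoch_Suc power_Suc)
  then show ?case
    unfolding prod.lessThan_Suc Suc.IH using qpoch_q_nonzero[OF q] by simp
qed

lemma sum_lessThan_choose: "(\<Sum>j<n. j) = n choose 2" "(\<Sum>j<n. j choose 2) = n choose 3"
  by (induction n) (simp_all add: numeral_2_eq_2 numeral_3_eq_3)

lemma pair_prod_selberg_minimal:
  assumes q: "0 < q" "q < 1" and m: "m \<ge> 1"
  shows "pair_prod n (selberg_factor q m) (\<lambda>i. q ^ (m * i)) =
    (\<Prod>j<n. q ^ (2 * m\<^sup>2 * (j choose 2)) *
      (qpoch q q (m * j + m - 1) * qpoch q q (m * j) / qpoch q q (m - 1)))"
  unfolding pair_prod_def
proof (rule prod.cong[OF refl])
  fix j
  let ?g = "\<lambda>k. (1 - q ^ (m * Suc k)) * (qpoch q q (m * Suc k + m - 1) / qpoch q q (m * k))"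
  have "(\<Prod>i<j. selberg_factor q m (q ^ (m * i)) (q ^ (m * j))) = (\<Prod>i<j. (q ^ (m * i)) ^ (2 * m) * ?g (j - Suc i))"
  proof (rule prod.cong[OF refl])
    fix i assume "i \<in> {..<j}"
    then have "j = i + Suc (j - Suc i)" by simp
    then have "m * j = m * i + m * Suc (j - Suc i)" by (metis distrib_left)
    then show "selberg_factor q m (q ^ (m * i)) (q ^ (m * j)) = (q ^ (m * i)) ^ (2 * m) * ?g (j - Suc i)"
      using selberg_factor_q_powers[OF q m, of "m * i" "j - Suc i"] by simp
  qed
  also have "\<dots> = (\<Prod>i<j. (q ^ (m * i)) ^ (2 * m)) * (\<Prod>i<j. ?g (j - Suc i))"
    by (rule prod.distrib)
  also have "(\<Prod>i<j. ?g (j - Suc i)) = (\<Prod>k<j. ?g k)"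
    by (rule prod.nat_diff_reindex)
  also have "\<dots> = qpoch q q (m * j + m - 1) * qpoch q q (m * j) / qpoch q q (m - 1)"
    by (rule prod_selberg_telescope[OF q m])
  also have "(\<Prod>i<j. (q ^ (m * i)) ^ (2 * m)) = q ^ (2 * m\<^sup>2 * (j choose 2))"
  proof -
    have "(\<Prod>i<j. (q ^ (m * i)) ^ (2 * m)) = (\<Prod>i<j. q ^ (2 * m\<^sup>2 * i))"
      by (intro prod.cong refl) (simp add: power_mult[symmetric] power2_eq_square mult_ac)
    then show ?thesis by (simp only: power_sum[symmetric] sum_distrib_left[symmetric] sum_lessThan_choose)
  qed
  finally show "(\<Prod>i<j. selberg_factor q m (q ^ (m * i)) (q ^ (m * j))) = q ^ (2 * m\<^sup>2 * (j choose 2)) *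
      (qpoch q q (m * j + m - 1) * qpoch q q (m * j) / qpoch q q (m - 1))" .
qed

lemma vandermonde_q_powers_square:
  assumes q: "0 < q" "q < 1"
  shows "(vandermonde n (\<lambda>i. q ^ i))\<^sup>2 = (\<Prod>j<n. (q ^ (j choose 2) * qpoch q q j)\<^sup>2)"
  unfolding pair_prod_def prod_power_distrib
proof (rule prod.cong[OF refl])
  fix j
  have "(\<Prod>i<j. q ^ j - q ^ i) = (\<Prod>i = 0..<0 + j. q ^ j - q ^ i)"
    by (simp add: atLeast0LessThan)
  also have "\<dots> = (-1) ^ j * (q ^ (j choose 2) * qpoch q q j)"
    by (subst prod_q_power_diff[OF q]) (simp_all add: qpoch_0 numeral_2_eq_2)
  finally have "(\<Prod>i<j. q ^ j - q ^ i)\<^sup>2 = (q ^ (j choose 2) * qpoch q q j)\<^sup>2"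
    by (simp add: power_mult_distrib flip: power_mult)
  then show "(\<Prod>i<j. (q ^ j - q ^ i)\<^sup>2) = (q ^ (j choose 2) * qpoch q q j)\<^sup>2"
    by (simp add: prod_power_distrib)
qed

lemma sum_degree_eq: "(\<Sum>j<n. j * (2 * m)) = m * n * (n - 1)" for n m :: nat
proof -
  have "(\<Sum>j<n. j * (2 * m)) = m * (2 * (n choose 2))"
    by (simp only: sum_distrib_right[symmetric] sum_lessThan_choose) (simp add: mult_ac)
  then show ?thesis by (simp only: two_times_choose_two mult.assoc)
qed

text \<open>For one monomial of \<open>D\<close> the sum over all sequences is a product of q-beta
  sums, taken at \<open>z * q ^ p i\<close>. Adding up the monomials leaves the expression evaluated
  by \<open>selberg_polynomial\<close>.\<close>

lemma has_sum_selberg_all: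
  fixes q :: real
  assumes q: "0 < q" "q < 1" and n: "n \<ge> 1" and m: "m \<ge> 1" and z: "z = q ^ Suc a"
  shows "((\<lambda>v. (\<Prod>i<n. z ^ v i * qpoch (q ^ (v i + 1)) q b) * pair_prod n (selberg_factor q m) (\<lambda>i. q ^ v i))
    has_sum (fact n * pair_prod n (selberg_factor q m) (\<lambda>i. q ^ (m * i)) *
      (\<Prod>i<n. qpoch q q b / qpoch z q (Suc b) * (qpoch z q (m * i) * (\<Prod>l<m * i. z - q ^ (Suc (a + b + 1) + l)) /
      (qpoch (q ^ Suc (a + b + 1)) q (m * (n - 1) + m * i) * qpoch q q (m * i)))))) (PiE {..<n} (\<lambda>_. UNIV))"
proof -
  let ?D = "pair_prod n (selberg_factor q m)" and ?w = "q ^ Suc (a + b + 1)"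
  have z01: "0 < z" "z < 1" using q power_Suc_less_one[of q a] by (auto simp: z)
  obtain L where L: "\<And>c p. (c, p) \<in> set L \<Longrightarrow> (\<Sum>i<n. p i) = m * n * (n - 1)"
    "\<And>x. ?D x = (\<Sum>(c, p)\<leftarrow>L. c * (\<Prod>i<n. x i ^ p i))"
    using homogeneous_selberg[OF m order_refl, of n q] unfolding homogeneous_def sum_degree_eq by blast
  have summand: "((\<lambda>v. c * (\<Prod>i<n. z ^ v i * qpoch (q ^ (v i + 1)) q b * (q ^ v i) ^ p i)) has_sum
     (c * (\<Prod>i<n. qpoch q q b / qpoch z q (Suc b) * (qpoch z q (p i) / qpoch ?w q (p i))))) (PiE {..<n} (\<lambda>_. UNIV))"
    for c and p :: "nat \<Rightarrow> nat"
  proof (intro has_sum_cmult_right has_sum_prod_PiE finite_lessThan)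
    fix i
    have "z * q ^ p i \<le> z"
      using q z01 by (simp add: mult_left_le power_le_one)
    then have y: "0 < z * q ^ p i" "z * q ^ p i < 1" using q z01 by (simp, linarith)
    have nz: "qpoch (z * q ^ p i) q (Suc b) \<noteq> 0" "qpoch z q (Suc b) \<noteq> 0" "qpoch ?w q (p i) \<noteq> 0" "qpoch z q (p i) \<noteq> 0" "qpoch q q b \<noteq> 0"
    proof -
      have "0 < ?w" "?w < 1" using q power_Suc_less_one[of q "a + b + 1"] by auto
      then show "qpoch ?w q (p i) \<noteq> 0" using qpoch_pos[OF q, of ?w "p i"] by simp
      show "qpoch (z * q ^ p i) q (Suc b) \<noteq> 0" using qpoch_pos[OF q, of "z * q ^ p i" "Suc b"] y by simp
      show "qpoch z q (Suc b) \<noteq> 0" "qpoch z q (p i) \<noteq> 0" using qpoch_pos[OF q, of z] z01 by (auto simp: less_imp_neq[symmetric])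
      show "qpoch q q b \<noteq> 0" by (rule qpoch_q_nonzero[OF q])
    qed
    \<comment> \<open>Both sides equal \<open>qpoch z q (p i + Suc b)\<close>, split at two
      different places. This moves the dependence on \<open>p i\<close> out of the q-beta
      value.\<close>
    have "qpoch z q (p i) * qpoch (z * q ^ p i) q (Suc b) = qpoch z q (Suc b) * qpoch (z * q ^ Suc b) q (p i)"
      unfolding qpoch_add[symmetric] by (simp add: add_ac)
    moreover have "z * q ^ Suc b = ?w" by (simp add: z power_add)
    ultimately have eq: "qpoch z q (p i) * qpoch (z * q ^ p i) q (Suc b) = qpoch z q (Suc b) * qpoch ?w q (p i)"
      by (simp only:)
    have "qpoch q q b / qpoch (z * q ^ p i) q (Suc b) = qpoch q q b / qpoch z q (Suc b) * (qpoch z q (p i) / qpoch ?w q (p i))"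
    proof -
      have "qpoch q q b / qpoch z q (Suc b) * (qpoch z q (p i) / qpoch ?w q (p i)) =
          qpoch q q b * qpoch z q (p i) / (qpoch z q (Suc b) * qpoch ?w q (p i))"
        by (rule times_divide_times_eq)
      also have "\<dots> = qpoch q q b / qpoch (z * q ^ p i) q (Suc b)"
        unfolding eq[symmetric] using nz(4) by simp
      finally show ?thesis ..
    qed
    moreover have "((\<lambda>v. (z * q ^ p i) ^ v * qpoch (q ^ (v + 1)) q b) has_sum
        (qpoch q q b / qpoch (z * q ^ p i) q (Suc b))) UNIV"
      by (rule has_sum_q_beta[OF q y])
    moreover have "(z * q ^ p i) ^ v * qpoch (q ^ (v + 1)) q b = z ^ v * qpoch (q ^ (v + 1)) q b * (q ^ v) ^ p i" for v
      by (simp add: power_mult_distrib mult_ac flip: power_mult)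
    ultimately show "((\<lambda>v. z ^ v * qpoch (q ^ (v + 1)) q b * (q ^ v) ^ p i) has_sum
        (qpoch q q b / qpoch z q (Suc b) * (qpoch z q (p i) / qpoch ?w q (p i)))) UNIV"
      by (simp only:)
    show "qpoch q q b / qpoch z q (Suc b) * (qpoch z q (p i) / qpoch ?w q (p i)) \<noteq> 0"
      using nz by simp
  qed
  have "((\<lambda>v. \<Sum>t\<leftarrow>L. case t of (c, p) \<Rightarrow> c * (\<Prod>i<n. z ^ v i * qpoch (q ^ (v i + 1)) q b * (q ^ v i) ^ p i)) has_sum
     (\<Sum>t\<leftarrow>L. case t of (c, p) \<Rightarrow> c * (\<Prod>i<n. qpoch q q b / qpoch z q (Suc b) * (qpoch z q (p i) / qpoch ?w q (p i)))))
     (PiE {..<n} (\<lambda>_. UNIV))"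
  proof (rule has_sum_sum_list)
    fix t :: "real \<times> (nat \<Rightarrow> nat)"
    show "((\<lambda>v. case t of (c, p) \<Rightarrow> c * (\<Prod>i<n. z ^ v i * qpoch (q ^ (v i + 1)) q b * (q ^ v i) ^ p i)) has_sum
     (case t of (c, p) \<Rightarrow> c * (\<Prod>i<n. qpoch q q b / qpoch z q (Suc b) * (qpoch z q (p i) / qpoch ?w q (p i)))))
     (PiE {..<n} (\<lambda>_. UNIV))"
      by (cases t) (simp only: prod.case summand)
  qed
  moreover have "(\<Sum>t\<leftarrow>L. case t of (c, p) \<Rightarrow> c * (\<Prod>i<n. z ^ v i * qpoch (q ^ (v i + 1)) q b * (q ^ v i) ^ p i)) =
      (\<Prod>i<n. z ^ v i * qpoch (q ^ (v i + 1)) q b) * ?D (\<lambda>i. q ^ v i)" for v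
  proof -
    have "?D (\<lambda>i. q ^ v i) * (\<Prod>i<n. z ^ v i * qpoch (q ^ (v i + 1)) q b) =
        (\<Sum>(c, p)\<leftarrow>L. c * (\<Prod>i<n. (q ^ v i) ^ p i) * (\<Prod>i<n. z ^ v i * qpoch (q ^ (v i + 1)) q b))"
      unfolding L(2) by (rule sum_list_case_prod_mult_right)
    also have "\<dots> = (\<Sum>t\<leftarrow>L. case t of (c, p) \<Rightarrow> c * (\<Prod>i<n. z ^ v i * qpoch (q ^ (v i + 1)) q b * (q ^ v i) ^ p i))"
      by (intro arg_cong[of _ _ sum_list] map_cong refl) (simp add: prod.distrib mult_ac split: prod.split)
    finally show ?thesis by (simp only: mult.commute)
  qed
  moreover have "(\<Sum>t\<leftarrow>L. case t of (c, p) \<Rightarrow> c * (\<Prod>i<n. qpoch q q b / qpoch z q (Suc b) * (qpoch z q (p i) / qpoch ?w q (p i)))) =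
     fact n * ?D (\<lambda>i. q ^ (m * i)) *
      (\<Prod>i<n. qpoch q q b / qpoch z q (Suc b) * (qpoch z q (m * i) * (\<Prod>l<m * i. z - q ^ (Suc (a + b + 1) + l)) /
      (qpoch ?w q (m * (n - 1) + m * i) * qpoch q q (m * i))))"
  proof -
    define r where "r = qpoch q q b / qpoch z q (Suc b)"
    let ?N = "\<Sum>(c, p)\<leftarrow>L. c * (\<Prod>i<n. qpoch z q (p i) / qpoch ?w q (p i))"
    let ?y = "\<lambda>i. qpoch z q (m * i) * (\<Prod>l<m * i. z - q ^ (Suc (a + b + 1) + l)) /
      (qpoch ?w q (m * (n - 1) + m * i) * qpoch q q (m * i))"
    have N: "?N = fact n * ?D (\<lambda>i. q ^ (m * i)) * (\<Prod>i<n. ?y i)"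
      by (rule selberg_polynomial[OF q m n]) (simp_all only: L)
    have "(\<Sum>(c, p)\<leftarrow>L. c * (\<Prod>i<n. r * (qpoch z q (p i) / qpoch ?w q (p i)))) =
       (\<Sum>(c, p)\<leftarrow>L. c * (\<Prod>i<n. qpoch z q (p i) / qpoch ?w q (p i)) * (\<Prod>i<n. r))"
      by (intro arg_cong[of _ _ sum_list] map_cong refl) (simp only: prod.distrib mult_ac split: prod.split)
    also have "\<dots> = ?N * (\<Prod>i<n. r)"
      by (rule sum_list_case_prod_mult_right[symmetric])
    also have "\<dots> = fact n * ?D (\<lambda>i. q ^ (m * i)) * (\<Prod>i<n. r * ?y i)"
      unfolding N prod.distrib by (simp only: mult_ac)
    finally show ?thesis by (simp only: r_def)
  qed
  ultimately show ?thesis by (simp only:)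
qed

lemma has_sum_selberg_increasing:
  fixes q :: real
  assumes q: "0 < q" "q < 1" and n: "n \<ge> 1" and m: "m \<ge> 1" and z: "z = q ^ Suc a"
  shows "((\<lambda>v. (\<Prod>i<n. z ^ v i * qpoch (q ^ (v i + 1)) q b) * pair_prod n (selberg_factor q m) (\<lambda>i. q ^ v i))
    has_sum (pair_prod n (selberg_factor q m) (\<lambda>i. q ^ (m * i)) *
      (\<Prod>i<n. qpoch q q b / qpoch z q (Suc b) * (qpoch z q (m * i) * (\<Prod>l<m * i. z - q ^ (Suc (a + b + 1) + l)) /
      (qpoch (q ^ Suc (a + b + 1)) q (m * (n - 1) + m * i) * qpoch q q (m * i)))))) (increasing_seqs n UNIV)"
    (is "(?F has_sum ?S) _")
proof -
  let ?D = "pair_prod n (selberg_factor q m)"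
  have "(?F has_sum (fact n * ?S / fact n)) (increasing_seqs n UNIV)"
  proof (rule has_sum_increasing_seqs)
    show "(?F has_sum (fact n * ?S)) (PiE {..<n} (\<lambda>_. UNIV))"
      using has_sum_selberg_all[OF assms, of b] by (simp only: mult.assoc)
    show "?F (u \<circ> p) = ?F u" if p: "p permutes {..<n}" for p u
    proof -
      have "?D (\<lambda>i. q ^ (u \<circ> p) i) = ?D (\<lambda>i. q ^ u i)"
        by (rule pair_prod_selberg_permute[OF q(1) m p])
      moreover have "(\<Prod>i<n. z ^ (u \<circ> p) i * qpoch (q ^ ((u \<circ> p) i + 1)) q b) = (\<Prod>i<n. z ^ u i * qpoch (q ^ (u i + 1)) q b)"
        using prod.permute[OF p, of "\<lambda>i. z ^ u i * qpoch (q ^ (u i + 1)) q b"] by (simp add: o_def)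
      ultimately show ?thesis by simp
    qed
    show "?F u = 0" if "\<not> inj_on u {..<n}" for u
      using pair_prod_selberg_not_inj_on[OF that] by simp
  qed
  then show ?thesis by simp
qed

lemma bij_betw_diag_seqs:
  "bij_betw (\<lambda>d. restrict (\<lambda>i. d i + i) {..<n}) (diag_seqs n) (increasing_seqs n UNIV)"
proof (rule bij_betw_byWitness[where f' = "\<lambda>u i. if i < n then u i - i else 0"])
  show "\<forall>d\<in>diag_seqs n. (\<lambda>i. if i < n then restrict (\<lambda>i. d i + i) {..<n} i - i else 0) = d"
    by (auto simp: diag_seqs_def fun_eq_iff)
  have ge: "i \<le> u i" if "u \<in> increasing_seqs n UNIV" "i < n" for u i
    using that(2)
  proof (induction i)
    case (Suc i)
    then have "u i < u (Suc i)" using that(1) by (auto simp: increasing_seqs_def)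
    then show ?case using Suc by simp
  qed simp
  show "\<forall>u\<in>increasing_seqs n UNIV. restrict (\<lambda>i. (if i < n then u i - i else 0) + i) {..<n} = u"
  proof
    fix u :: "nat \<Rightarrow> nat" assume u: "u \<in> increasing_seqs n UNIV"
    then have ext: "u i = undefined" if "\<not> i < n" for i
      using that PiE_arb[of u "{..<n}" "\<lambda>_. UNIV" i] by (simp add: increasing_seqs_def)
    show "restrict (\<lambda>i. (if i < n then u i - i else 0) + i) {..<n} = u"
      using ge[OF u] ext by (auto simp: fun_eq_iff restrict_def)
  qed
  show "(\<lambda>d. restrict (\<lambda>i. d i + i) {..<n}) ` diag_seqs n \<subseteq> increasing_seqs n UNIV"
  proof (rule image_subsetI)
    fix d :: "nat \<Rightarrow> nat" assume d: "d \<in> diag_seqs n"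
    have "d i + i < d j + j" if "i < j" "j < n" for i j
      using diag_seqs_mono[OF d, of i j] that by simp
    then show "restrict (\<lambda>i. d i + i) {..<n} \<in> increasing_seqs n UNIV"
      by (auto simp: increasing_seqs_def)
  qed
  show "(\<lambda>u i. if i < n then u i - i else 0) ` increasing_seqs n UNIV \<subseteq> diag_seqs n"
  proof (rule image_subsetI)
    fix u :: "nat \<Rightarrow> nat" assume u: "u \<in> increasing_seqs n UNIV"
    have "u i < u (Suc i)" if "Suc i < n" for i using u that by (auto simp: increasing_seqs_def)
    then have "u i - i \<le> u (Suc i) - Suc i" if "Suc i < n" for i using that by fastforce
    then show "(\<lambda>i. if i < n then u i - i else 0) \<in> diag_seqs n"
      by (simp add: diag_seqs_def)
  qed
qed

text \<open>The Selberg sum carries \<open>z ^ v i\<close> with \<open>v i = d i + i\<close>, the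
  weight only \<open>z ^ d i\<close>; the quotient by \<open>\<Prod>i<n. z ^ i\<close> corrects
  this.\<close>

lemma has_sum_wt_RPP_product:
  fixes q :: real
  assumes q: "0 < q" "q < 1" and n: "n \<ge> 1" and m: "m \<ge> 1" and z: "z = q ^ Suc a"
  shows "(wt q n a b m has_sum (pair_prod n (selberg_factor q m) (\<lambda>i. q ^ (m * i)) *
      (\<Prod>i<n. qpoch q q b / qpoch z q (Suc b) * (qpoch z q (m * i) * (\<Prod>l<m * i. z - q ^ (Suc (a + b + 1) + l)) /
      (qpoch (q ^ Suc (a + b + 1)) q (m * (n - 1) + m * i) * qpoch q q (m * i)))) /
      (\<Prod>i<n. z ^ i) / (vandermonde n (\<lambda>i. q ^ i))\<^sup>2)) (RPP n)"
proof (rule has_sum_wt_RPP[OF q])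
  let ?D = "pair_prod n (selberg_factor q m)"
  let ?F = "\<lambda>v. (\<Prod>i<n. z ^ v i * qpoch (q ^ (v i + 1)) q b) * ?D (\<lambda>i. q ^ v i)"
  have "((\<lambda>d. ?F (restrict (\<lambda>i. d i + i) {..<n})) has_sum (?D (\<lambda>i. q ^ (m * i)) *
      (\<Prod>i<n. qpoch q q b / qpoch z q (Suc b) * (qpoch z q (m * i) * (\<Prod>l<m * i. z - q ^ (Suc (a + b + 1) + l)) /
      (qpoch (q ^ Suc (a + b + 1)) q (m * (n - 1) + m * i) * qpoch q q (m * i)))))) (diag_seqs n)"
    using has_sum_selberg_increasing[OF assms, of b]
    by (subst has_sum_reindex_bij_betw[OF bij_betw_diag_seqs])
  then have "((\<lambda>d. ?F (restrict (\<lambda>i. d i + i) {..<n}) * inverse (\<Prod>i<n. z ^ i)) has_sum (?D (\<lambda>i. q ^ (m * i)) *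
      (\<Prod>i<n. qpoch q q b / qpoch z q (Suc b) * (qpoch z q (m * i) * (\<Prod>l<m * i. z - q ^ (Suc (a + b + 1) + l)) /
      (qpoch (q ^ Suc (a + b + 1)) q (m * (n - 1) + m * i) * qpoch q q (m * i)))) * inverse (\<Prod>i<n. z ^ i))) (diag_seqs n)"
    by (rule has_sum_cmult_left)
  moreover have "?F (restrict (\<lambda>i. d i + i) {..<n}) * inverse (\<Prod>i<n. z ^ i) =
      (\<Prod>i<n. q ^ ((1 + a) * d i) * qpoch (q ^ (d i + i + 1)) q b) * ?D (\<lambda>i. q ^ (d i + i))" for d
  proof -
    have "z \<noteq> 0" using q by (simp add: z)
    have 1: "?D (\<lambda>i. q ^ restrict (\<lambda>i. d i + i) {..<n} i) = ?D (\<lambda>i. q ^ (d i + i))"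
      by (rule pair_prod_cong) simp
    have 2: "(\<Prod>i<n. z ^ restrict (\<lambda>i. d i + i) {..<n} i * qpoch (q ^ (restrict (\<lambda>i. d i + i) {..<n} i + 1)) q b) =
        (\<Prod>i<n. z ^ i) * (\<Prod>i<n. q ^ ((1 + a) * d i) * qpoch (q ^ (d i + i + 1)) q b)"
      unfolding prod.distrib[symmetric]
      by (intro prod.cong refl) (simp add: z power_add power_mult[symmetric] algebra_simps)
    have "(\<Prod>i<n. z ^ i) \<noteq> 0" using \<open>z \<noteq> 0\<close> by simp
    moreover have "x * y * w * inverse x = y * w" if "x \<noteq> 0" for x y w :: real
      using that by simp
    ultimately show ?thesis unfolding 1 2 by blast
  qed
  ultimately show "((\<lambda>d. (\<Prod>i<n. q ^ ((1 + a) * d i) * qpoch (q ^ (d i + i + 1)) q b) * ?D (\<lambda>i. q ^ (d i + i))) has_sum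
      (?D (\<lambda>i. q ^ (m * i)) *
      (\<Prod>i<n. qpoch q q b / qpoch z q (Suc b) * (qpoch z q (m * i) * (\<Prod>l<m * i. z - q ^ (Suc (a + b + 1) + l)) /
      (qpoch (q ^ Suc (a + b + 1)) q (m * (n - 1) + m * i) * qpoch q q (m * i)))) / (\<Prod>i<n. z ^ i))) (diag_seqs n)"
    by (simp only: divide_inverse)
qed

lemma prod_shift_q_powers:
  assumes q: "0 < q" "q < 1"
  shows "(\<Prod>l<k. q ^ Suc a - q ^ (Suc (a + b + 1) + l)) = (q ^ Suc a) ^ k * (qpoch q q (b + k) / qpoch q q b)"
proof -
  have "(\<Prod>l<k. q ^ Suc a - q ^ (Suc (a + b + 1) + l)) = (\<Prod>l<k. q ^ Suc a * (1 - q ^ Suc b * q ^ l))"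
    by (intro prod.cong refl) (simp add: algebra_simps power_add)
  also have "\<dots> = (q ^ Suc a) ^ k * qpoch (q ^ Suc b) q k"
    by (simp only: prod.distrib prod_constant card_lessThan qpoch_def)
  finally show ?thesis by (simp only: qpoch_shift[OF q])
qed

text \<open>The symbol \<open>qpoch q q (m * j)\<close> from the tightest packing cancels the one
  from the grid evaluation, and the q-beta constant cancels the denominators created by shifting to
  base point \<open>q\<close>.\<close>

lemma selberg_term_eq:
  assumes q: "0 < q" "q < 1" and z: "z = q ^ Suc a"
  shows "q ^ (2 * m\<^sup>2 * (j choose 2)) * (qpoch q q (m * j + m - 1) * qpoch q q (m * j) / qpoch q q (m - 1)) *
      (qpoch q q b / qpoch z q (Suc b) * (qpoch z q (m * j) * (\<Prod>l<m * j. z - q ^ (Suc (a + b + 1) + l)) /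
      (qpoch (q ^ Suc (a + b + 1)) q c * qpoch q q (m * j)))) / z ^ j / (q ^ (j choose 2) * qpoch q q j)\<^sup>2 =
    q ^ (2 * m\<^sup>2 * (j choose 2) + Suc a * m * j) / q ^ (Suc a * j + 2 * (j choose 2)) *
      (qpoch q q (a + m * j) * qpoch q q (b + m * j) * qpoch q q (m * j + m - 1) /
        (qpoch q q (a + b + 1 + c) * qpoch q q (m - 1) * (qpoch q q j)\<^sup>2))"
proof -
  note nz = qpoch_q_nonzero[OF q]
  have gen: "t * (x * y / w) * (pb / (pab / pa) * (pam / pa * (zk * (pbm / pb)) / (pc / pab * y))) / zj / (tj * pj)\<^sup>2 =
      t * zk / (zj * tj\<^sup>2) * (pam * pbm * x / (pc * w * pj\<^sup>2))"
    if "y \<noteq> 0" "pb \<noteq> 0" "pab \<noteq> 0" "pa \<noteq> 0" for t x y w pb pab pa pam zk pbm pc zj tj pj :: real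
    using that by (simp add: power_mult_distrib mult_ac)
  have "Suc (a + b) = a + b + 1" "a + Suc b = a + b + 1" by simp_all
  then have shift: "qpoch (q ^ Suc a) q (Suc b) = qpoch q q (a + b + 1) / qpoch q q a"
    "qpoch (q ^ Suc (a + b + 1)) q c = qpoch q q (a + b + 1 + c) / qpoch q q (a + b + 1)"
    by (simp_all only: qpoch_shift[OF q])
  have pw: "q ^ (2 * m\<^sup>2 * (j choose 2)) * (q ^ Suc a) ^ (m * j) / ((q ^ Suc a) ^ j * (q ^ (j choose 2))\<^sup>2) =
      q ^ (2 * m\<^sup>2 * (j choose 2) + Suc a * m * j) / q ^ (Suc a * j + 2 * (j choose 2))"
    by (simp only: power_mult[symmetric] power_add[symmetric] mult.assoc mult.commute[of "j choose 2" 2])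
  show ?thesis
    unfolding z shift prod_shift_q_powers[OF q] qpoch_shift[OF q, of a "m * j"] pw[symmetric]
    by (rule gen) (rule nz)+
qed

lemma prod_qpoch_eq_prod_qfact:
  assumes q: "0 < q" "q < 1" and m: "m \<ge> 1"
  shows "(\<Prod>j<n. qpoch q q (a + m * j) * qpoch q q (b + m * j) * qpoch q q (m * j + m - 1) /
        (qpoch q q (a + b + 1 + (m * (n - 1) + m * j)) * qpoch q q (m - 1) * (qpoch q q j)\<^sup>2)) =
    (\<Prod>j<n. qfact q (a + m * j) * qfact q (b + m * j) * qfact q (m * j + m - 1) /
        (qfact q (a + b + 1 + (m * (n - 1) + m * j)) * qfact q (m - 1) * (qfact q j)\<^sup>2)) / (1 - q) ^ (n\<^sup>2)"
proof -
  have q1: "q \<noteq> 1" using q by simp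
  define X where "X j = (a + m * j) + (b + m * j) + (m * j + m - 1)" for j
  define Y where "Y j = (a + b + 1 + (m * (n - 1) + m * j)) + (m - 1) + 2 * j" for j
  \<comment> \<open>\<open>X\<close> and \<open>Y\<close> count the factors \<open>1 - q\<close> of
    numerator and denominator; their total excess is the exponent \<open>n\<^sup>2\<close> of the
    result.\<close>
  have XY: "(\<Sum>j<n. X j) + n\<^sup>2 = (\<Sum>j<n. Y j)"
  proof -
    have S: "2 * (\<Sum>j<n. j) = n * (n - 1)"
      by (simp only: sum_lessThan_choose two_times_choose_two)
    have X: "X j = (a + b + m - 1) + 3 * m * j" and Y: "Y j = (a + b + m + m * (n - 1)) + (m + 2) * j" for j
      using m by (simp_all add: X_def Y_def algebra_simps)
    have sX: "(\<Sum>j<n. X j) = n * (a + b + m - 1) + m * (\<Sum>j<n. j) + m * (2 * (\<Sum>j<n. j))"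
      unfolding X sum.distrib sum_distrib_left[symmetric] by (simp add: algebra_simps)
    have sY: "(\<Sum>j<n. Y j) = n * (a + b + m + m * (n - 1)) + m * (\<Sum>j<n. j) + 2 * (\<Sum>j<n. j)"
      unfolding Y sum.distrib sum_distrib_left[symmetric] by (simp add: algebra_simps)
    obtain m' where m': "m = Suc m'" using m by (cases m) auto
    show ?thesis
      unfolding sX sY S m' by (cases n) (simp_all add: algebra_simps power2_eq_square)
  qed
  have "(\<Prod>j<n. qpoch q q (a + m * j) * qpoch q q (b + m * j) * qpoch q q (m * j + m - 1) /
        (qpoch q q (a + b + 1 + (m * (n - 1) + m * j)) * qpoch q q (m - 1) * (qpoch q q j)\<^sup>2)) =
      (\<Prod>j<n. (1 - q) ^ X j / (1 - q) ^ Y j * (qfact q (a + m * j) * qfact q (b + m * j) * qfact q (m * j + m - 1) /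
        (qfact q (a + b + 1 + (m * (n - 1) + m * j)) * qfact q (m - 1) * (qfact q j)\<^sup>2)))"
  proof (rule prod.cong[OF refl])
    fix j
    have gen: "x1 * f1 * (x2 * f2) * (x3 * f3) / (y1 * g1 * (y2 * g2) * (y3 * g3)\<^sup>2) =
        x1 * x2 * x3 / (y1 * y2 * y3\<^sup>2) * (f1 * f2 * f3 / (g1 * g2 * g3\<^sup>2))"
      for x1 x2 x3 y1 y2 y3 f1 f2 f3 g1 g2 g3 :: real
      by (simp add: power_mult_distrib mult_ac)
    have "(1 - q) ^ (2 * j) = ((1 - q) ^ j)\<^sup>2" by (simp add: power_mult[symmetric] mult.commute)
    then have "(1 - q) ^ X j / (1 - q) ^ Y j = (1 - q) ^ (a + m * j) * (1 - q) ^ (b + m * j) * (1 - q) ^ (m * j + m - 1) /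
        ((1 - q) ^ (a + b + 1 + (m * (n - 1) + m * j)) * (1 - q) ^ (m - 1) * ((1 - q) ^ j)\<^sup>2)"
      by (simp only: X_def Y_def power_add)
    then show "qpoch q q (a + m * j) * qpoch q q (b + m * j) * qpoch q q (m * j + m - 1) /
        (qpoch q q (a + b + 1 + (m * (n - 1) + m * j)) * qpoch q q (m - 1) * (qpoch q q j)\<^sup>2) =
      (1 - q) ^ X j / (1 - q) ^ Y j * (qfact q (a + m * j) * qfact q (b + m * j) * qfact q (m * j + m - 1) /
        (qfact q (a + b + 1 + (m * (n - 1) + m * j)) * qfact q (m - 1) * (qfact q j)\<^sup>2))"
      unfolding qpoch_eq_qfact[OF q1] gen by (rule arg_cong2[of _ _ _ _ "(*)", OF sym refl])
  qed
  also have "\<dots> = (\<Prod>j<n. (1 - q) ^ X j) / (\<Prod>j<n. (1 - q) ^ Y j) * (\<Prod>j<n. qfact q (a + m * j) * qfact q (b + m * j) * qfact q (m * j + m - 1) /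
        (qfact q (a + b + 1 + (m * (n - 1) + m * j)) * qfact q (m - 1) * (qfact q j)\<^sup>2))"
    by (simp only: prod.distrib prod_dividef)
  also have "(\<Prod>j<n. (1 - q) ^ X j) / (\<Prod>j<n. (1 - q) ^ Y j) = 1 / (1 - q) ^ (n\<^sup>2)"
    unfolding power_sum[symmetric] XY[symmetric] power_add using q by simp
  finally show ?thesis by simp
qed

theorem theorem8p20:
  fixes q :: real and n a b m :: nat
  assumes "0 < q" and "q < 1" and "n \<ge> 1" and "m \<ge> 1"
  shows "((\<lambda>T. wt q n a b m T) has_sum
    (q powi ((1 - int a + int m + int a * int m) * int (n choose 2)
             - 2 * int ((n + 1) choose 3)
             + 2 * (int m)\<^sup>2 * int (n choose 3))
     / (1 - q) ^ (n\<^sup>2)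
     * (\<Prod>j = 1..n.
          qfact q (a + (j - 1) * m) * qfact q (b + (j - 1) * m) * qfact q (j * m - 1)
          / (qfact q (a + b + (n + j - 2) * m + 1) * qfact q (m - 1) * (qfact q (j - 1))\<^sup>2))))
    (RPP n)"
proof -
  note q = assms(1,2)
  define z where "z = q ^ Suc a"
  let ?f = "\<lambda>j. qfact q (a + m * j) * qfact q (b + m * j) * qfact q (m * j + m - 1) /
        (qfact q (a + b + 1 + (m * (n - 1) + m * j)) * qfact q (m - 1) * (qfact q j)\<^sup>2)"
  let ?t = "\<lambda>j. q ^ (2 * m\<^sup>2 * (j choose 2)) * (qpoch q q (m * j + m - 1) * qpoch q q (m * j) / qpoch q q (m - 1)) *
      (qpoch q q b / qpoch z q (Suc b) * (qpoch z q (m * j) * (\<Prod>l<m * j. z - q ^ (Suc (a + b + 1) + l)) /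
      (qpoch (q ^ Suc (a + b + 1)) q (m * (n - 1) + m * j) * qpoch q q (m * j)))) / z ^ j / (q ^ (j choose 2) * qpoch q q j)\<^sup>2"
  let ?e = "(1 - int a + int m + int a * int m) * int (n choose 2) - 2 * int ((n + 1) choose 3)
             + 2 * (int m)\<^sup>2 * int (n choose 3)"
  define X where "X = 2 * m\<^sup>2 * (n choose 3) + Suc a * m * (n choose 2)"
  define Y where "Y = Suc a * (n choose 2) + 2 * (n choose 3)"
  have "(wt q n a b m has_sum (\<Prod>j<n. ?t j)) (RPP n)"
    using has_sum_wt_RPP_product[OF q assms(3,4) z_def, of b]
    by (simp only: pair_prod_selberg_minimal[OF q assms(4)] vandermonde_q_powers_square[OF q] prod.distrib prod_dividef)
  also have "(\<Prod>j<n. ?t j) = (\<Prod>j<n. q ^ (2 * m\<^sup>2 * (j choose 2) + Suc a * m * j)) /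
      (\<Prod>j<n. q ^ (Suc a * j + 2 * (j choose 2))) * ((\<Prod>j<n. ?f j) / (1 - q) ^ (n\<^sup>2))"
    unfolding selberg_term_eq[OF q z_def] prod.distrib prod_qpoch_eq_prod_qfact[OF q assms(4)]
    by (simp only: prod_dividef)
  also have "(\<Prod>j<n. q ^ (2 * m\<^sup>2 * (j choose 2) + Suc a * m * j)) = q ^ X"
    by (simp only: power_sum[symmetric] sum.distrib sum_distrib_left[symmetric] sum_lessThan_choose X_def)
  also have "(\<Prod>j<n. q ^ (Suc a * j + 2 * (j choose 2))) = q ^ Y"
    by (simp only: power_sum[symmetric] sum.distrib sum_distrib_left[symmetric] sum_lessThan_choose Y_def)
  also have "q ^ X / q ^ Y = q powi ?e"
  proof -
    \<comment> \<open>The extra \<open>-2 * (n choose 2)\<close> released by Pascal's rule turns the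
      coefficient \<open>1 - a + m + a * m\<close> into \<open>(a + 1) * (m - 1)\<close>, which is
      the coefficient of \<open>n choose 2\<close> in \<open>X - Y\<close>.\<close>
    have "(n + 1) choose 3 = (n choose 2) + (n choose 3)" by (simp add: numeral_3_eq_3 numeral_2_eq_2)
    then have "?e = int X - int Y" by (simp add: X_def Y_def algebra_simps)
    then show ?thesis using q by (simp add: power_int_diff)
  qed
  also have "(\<Prod>j<n. ?f j) = (\<Prod>j = 1..n.
          qfact q (a + (j - 1) * m) * qfact q (b + (j - 1) * m) * qfact q (j * m - 1)
          / (qfact q (a + b + (n + j - 2) * m + 1) * qfact q (m - 1) * (qfact q (j - 1))\<^sup>2))"
  proof (rule prod.reindex_bij_witness[where i = "\<lambda>j. j - 1" and j = Suc])
    fix j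
    \<comment> \<open>The subtraction of \<open>2\<close> is not truncated, since \<open>n\<close>
      and \<open>Suc j\<close> are both at least \<open>1\<close>.\<close>
    have "a + b + (n + Suc j - 2) * m + 1 = a + b + 1 + (m * (n - 1) + m * j)"
      using assms(3) by (cases n) (simp_all add: algebra_simps)
    moreover have "Suc j * m - 1 = m * j + m - 1" by (simp add: mult.commute add.commute)
    ultimately show "qfact q (a + (Suc j - 1) * m) * qfact q (b + (Suc j - 1) * m) * qfact q (Suc j * m - 1)
          / (qfact q (a + b + (n + Suc j - 2) * m + 1) * qfact q (m - 1) * (qfact q (Suc j - 1))\<^sup>2) = ?f j"
      by (simp only: diff_Suc_1 mult.commute[of j m])
  qed auto
  finally show ?thesis by (simp only: times_divide_eq_right times_divide_eq_left)
qed

end
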